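(* For compositions $\alpha,\beta,\gamma$ let the coefficients $C^\gamma_{\alpha\beta}$ be defined, equivalently, by any of the following expansions: $$\mathcal S^*_\alpha\cdot\mathcal S^*_\beta=\sum_\gamma C^\gamma_{\alpha\beta}\,\mathcal S^*_\gamma,\qquad \Delta\mathcal S_\gamma=\sum_{\alpha,\beta}C^\gamma_{\alpha\beta}\,\mathcal S_\alpha\otimes\mathcal S_\beta,\qquad \mathcal S_{\gamma/\!/\beta}=\sum_\alpha C^\gamma_{\alpha\beta}\,\mathcal S_\alpha,$$ $$C^\gamma_{\alpha\beta}=\langle\mathcal S_{\gamma/\!/\beta},\mathcal S^*_\alpha\rangle=\langle\mathcal S_\gamma,\mathcal S^*_\alpha\cdot\mathcal S^*_\beta\rangle .$$ Then $C^\gamma_{\alpha\beta}$ equals the number of standard composition tableaux $T$ of shape $\gamma/\!/\beta$ such that $\mathrm{rect}(T)=U_\alpha$.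
   Context: Compositions and diagrams. A composition is a finite (possibly empty) sequence of positive integers; a weak composition is a finite sequence of nonnegative integers. $|\alpha|$ is the sum of the parts, $\ell(\alpha)$ the number of parts. The diagram of $\alpha$ is the left-justified array of cells with $\alpha_i$ cells in row $i$, rows numbered from the top; cells are indexed (row, column). Write $\beta\Subset\gamma$ if $\ell(\beta)\le\ell(\gamma)$ and $\beta_{\ell(\beta)-i}\le\gamma_{\ell(\gamma)-i}$ for $0\le i<\ell(\beta)$. In that case the diagram of $\beta$ is placed in the lower left of that of $\gamma$ (last row of $\beta$ in row $\ell(\gamma)$), and the skew shape $\gamma/\!/\beta$ consists of the cells of $\gamma$ not in $\beta$. A straight shape is $\alpha=\alpha/\!/\emptyset$. Composition tableaux. Cell $(i,k)$ attacks $(j,k+1)$ if $i<j$, $(j,k+1)\in\gamma/\!/\beta$ and $(i,k+1)\notin\beta$ (possibly $(i,k)\in\beta$). A semistandard composition tableau (SSCT) of shape $\gamma/\!/\beta$ is a filling $T$ of the cells of $\gamma/\!/\beta$ by positive integers such that: (1) row entries weakly decrease left to right; (2) entries in the first column strictly increase top to bottom; (3) if $(i,k)\in\gamma$ attacks $(j,k+1)$ and either $(i,k)\in\beta$ or $T(j,k+1)\le T(i,k)$, then $(i,k+1)\in\gamma/\!/\beta$ and $T(j,k+1)<T(i,k+1)$. It is a standard composition tableau (SCT) if moreover it is a bijection onto $\{1,\dots,n\}$, $n=|\gamma|-|\beta|$. If $\beta\not\Subset\gamma$ there are no SSCT of shape $\gamma/\!/\beta$. $\mathrm{cont}(T)$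 is the weak composition whose $i$-th part is the number of entries equal to $i$. Rectification. A semistandard reverse tableau (SSRT) of partition shape has rows weakly decreasing left to right and columns strictly decreasing top to bottom. Mason's bijection $\rho$ sends an SSCT of straight shape to the SSRT obtained by sorting each column in decreasing order and top-justifying. Its inverse: write the first column's entries in increasing order top to bottom; then, for each further column from left to right, place its entries in descending order, each as high as possible subject to rows remaining weakly decreasing (left neighbour present and at least as large). The column word $w_{col}(T)$ lists the entries of each column in increasing order, columns taken from left to right. $P(w)$ is the SSRT obtained by inserting the letters of $w$ from left to right by reverse Schensted row insertion: when inserting $x$ into a row, if no entry is $<x$ append $x$ at the end; otherwise $x$ replaces the leftmost entry $<x$, which is inserted into the next row. For an SSCT $T$, $\mathrm{rect}(T)=\rho^{-1}(P(w_{col}(T)))$. $U_\alpha$ is the SCT of shape $\alpha$ obtained by filling the cells with $|\alpha|,|\alpha|-1,\dots,1$ in this order, going through the last (bottom) row left to right, then the next to last row left to right, and so on up. Quasisymmetric functions. $QSym\subset\mathbb Q[[x_1,x_2,\dots]]$ has the monomial basis $M_\alpha=\sum_\gamma\mathbf x^\gamma$ (sum over weak compositions $\gamma$, identified up to trailing zeros, whose sequence of nonzero parts is $\alpha$; $\mathbf x^\gamma=\prod x_i^{\gamma_i}$), and coproduct $\Delta M_\alpha=\sum_{\beta\gamma=\alpha}M_\beta\otimes M_\gamma$ (concatenation). The quasisymmetric Schur functions $\mathcal S_\alpha=\sum_{T}\mathbf x^{\mathrm{cont}(T)}$ (sum over SSCT $T$ of straight shape $\alpha$) form a basis of $QSym$.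 The skew quasisymmetric Schur functions $\mathcal S_{\gamma/\!/\beta}$ are defined by $\Delta\mathcal S_\gamma=\sum_\beta\mathcal S_{\gamma/\!/\beta}\otimes\mathcal S_\beta$, $\beta$ ranging over all compositions. $NSym$ is the graded Hopf dual of $QSym$, with pairing $\langle\cdot,\cdot\rangle$ and product dual to $\Delta$; the noncommutative Schur functions $\mathcal S^*_\alpha$ are the basis of $NSym$ dual to $\{\mathcal S_\alpha\}$, $\langle\mathcal S_\alpha,\mathcal S^*_\beta\rangle=\delta_{\alpha\beta}$. *)

theory Defs
  imports
    Complex_Main
    "HOL-Library.Multiset"
    "HOL-Library.Poly_Mapping"
    "HOL-Library.Function_Algebras"
begin

section \<open>Compositions and skew diagrams\<close>

definition Comp :: "nat list set" where
  "Comp = {\<alpha>. \<forall>a \<in> set \<alpha>. 0 < a}"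

text \<open>Cells are pairs (row, column), both counted from 0, row 0 being the top row.\<close>

definition cells :: "nat list \<Rightarrow> (nat \<times> nat) set" where
  "cells \<gamma> = {(i, k). i < length \<gamma> \<and> k < \<gamma> ! i}"

definition contained :: "nat list \<Rightarrow> nat list \<Rightarrow> bool" (infix \<open>\<Subset>\<close> 50) where
  "\<beta> \<Subset> \<gamma> \<longleftrightarrow> length \<beta> \<le> length \<gamma> \<and>
     (\<forall>i < length \<beta>. \<beta> ! (length \<beta> - 1 - i) \<le> \<gamma> ! (length \<gamma> - 1 - i))"

text \<open>The diagram of \<open>\<beta>\<close> placed in the lower left of that of \<open>\<gamma>\<close>.\<close>

definition inner_cells :: "nat list \<Rightarrow> nat list \<Rightarrow> (nat \<times> nat) set" where
  "inner_cells \<gamma> \<beta> = {(i + (length \<gamma> - length \<beta>), k) | i k. (i, k) \<in> cells \<beta>}"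

definition skew_cells :: "nat list \<Rightarrow> nat list \<Rightarrow> (nat \<times> nat) set" where
  "skew_cells \<gamma> \<beta> = cells \<gamma> - inner_cells \<gamma> \<beta>"


section \<open>Composition tableaux\<close>

text \<open>A filling by positive integers is a function on all cells that is 0 exactly outside the
  shape; in particular, a filling determines its set of filled cells.\<close>

type_synonym filling = "nat \<times> nat \<Rightarrow> nat"

definition attacks :: "nat list \<Rightarrow> nat list \<Rightarrow> nat \<times> nat \<Rightarrow> nat \<times> nat \<Rightarrow> bool" where
  "attacks \<gamma> \<beta> c d \<longleftrightarrow> (case (c, d) of ((i, k), (j, l)) \<Rightarrow>
     l = k + 1 \<and> i < j \<and> (j, k + 1) \<in> skew_cells \<gamma> \<beta> \<and> (i, k + 1) \<notin> inner_cells \<gamma> \<beta>)"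

definition ssct :: "nat list \<Rightarrow> nat list \<Rightarrow> filling \<Rightarrow> bool" where
  "ssct \<gamma> \<beta> T \<longleftrightarrow>
     \<beta> \<Subset> \<gamma> \<and>
     (\<forall>c. T c \<noteq> 0 \<longleftrightarrow> c \<in> skew_cells \<gamma> \<beta>) \<and>
     (\<forall>i k l. k \<le> l \<longrightarrow> (i, k) \<in> skew_cells \<gamma> \<beta> \<longrightarrow> (i, l) \<in> skew_cells \<gamma> \<beta> \<longrightarrow> T (i, l) \<le> T (i, k)) \<and>
     (\<forall>i j. i < j \<longrightarrow> (i, 0) \<in> skew_cells \<gamma> \<beta> \<longrightarrow> (j, 0) \<in> skew_cells \<gamma> \<beta> \<longrightarrow> T (i, 0) < T (j, 0)) \<and>
     (\<forall>i j k. (i, k) \<in> cells \<gamma> \<longrightarrow> attacks \<gamma> \<beta> (i, k) (j, k + 1) \<longrightarrow>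
        (i, k) \<in> inner_cells \<gamma> \<beta> \<or> T (j, k + 1) \<le> T (i, k) \<longrightarrow>
        (i, k + 1) \<in> skew_cells \<gamma> \<beta> \<and> T (j, k + 1) < T (i, k + 1))"

definition sct :: "nat list \<Rightarrow> nat list \<Rightarrow> filling \<Rightarrow> bool" where
  "sct \<gamma> \<beta> T \<longleftrightarrow> ssct \<gamma> \<beta> T \<and>
     bij_betw T (skew_cells \<gamma> \<beta>) {1..sum_list \<gamma> - sum_list \<beta>}"

text \<open>Contents and exponents are indexed from 0: index \<open>i\<close> belongs to the entry \<open>i + 1\<close>,
  that is, to the variable \<open>x\<^sub>i\<^sub>+\<^sub>1\<close>.\<close>

definition cont :: "filling \<Rightarrow> nat \<Rightarrow> nat" where
  "cont T i = card {c. T c = i + 1}"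

text \<open>The entries \<open>|\<alpha>|, \<dots>, 1\<close> are placed row by row starting from the bottom: the cells filled
  before \<open>(i, k)\<close> are those in the rows below and the first \<open>k\<close> cells of row \<open>i\<close>.\<close>

definition U :: "nat list \<Rightarrow> filling" where
  "U \<alpha> = (\<lambda>(i, k). if (i, k) \<in> cells \<alpha>
     then sum_list \<alpha> - sum_list (drop (Suc i) \<alpha>) - k else 0)"


section \<open>Rectification\<close>

text \<open>The entries of a column in increasing order.\<close>

definition column :: "filling \<Rightarrow> nat \<Rightarrow> nat list" where
  "column T k = sorted_list_of_multiset
     (image_mset (\<lambda>i. T (i, k)) (mset_set {i. T (i, k) \<noteq> 0}))"

definition col_word :: "filling \<Rightarrow> nat list" where
  "col_word T = concat (map (column T) (sorted_list_of_set {k. \<exists>i. T (i, k) \<noteq> 0}))"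

text \<open>Mason's map: sort each column decreasingly and top-justify it.\<close>

definition rho :: "filling \<Rightarrow> filling" where
  "rho T = (\<lambda>(i, k). if i < length (column T k) then rev (column T k) ! i else 0)"

definition rho_inv :: "filling \<Rightarrow> filling" where
  "rho_inv = inv_into {T. \<exists>\<alpha> \<in> Comp. ssct \<alpha> [] T} rho"

text \<open>Inserting into a row returns the new row and the bumped entry, if any.\<close>

fun row_insert :: "nat \<Rightarrow> nat list \<Rightarrow> nat list \<times> nat option" where
  "row_insert x [] = ([x], None)"
| "row_insert x (y # ys) =
     (if y < x then (x # ys, Some y)
      else (case row_insert x ys of (zs, b) \<Rightarrow> (y # zs, b)))"

fun insert_letter :: "nat \<Rightarrow> nat list list \<Rightarrow> nat list list" where
  "insert_letter x [] = [[x]]"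
| "insert_letter x (r # rs) =
     (case row_insert x r of
        (r', None) \<Rightarrow> r' # rs
      | (r', Some y) \<Rightarrow> r' # insert_letter y rs)"

definition filling_of_rows :: "nat list list \<Rightarrow> filling" where
  "filling_of_rows rs = (\<lambda>(i, k). if i < length rs \<and> k < length (rs ! i) then rs ! i ! k else 0)"

definition P_tab :: "nat list \<Rightarrow> filling" where
  "P_tab w = filling_of_rows (fold insert_letter w [])"

definition rect :: "filling \<Rightarrow> filling" where
  "rect T = rho_inv (P_tab (col_word T))"


section \<open>Vector spaces of formal power series\<close>

text \<open>A formal power series is given by its coefficients.  The exponents, weak compositions up to
  trailing zeros, are the finitely supported functions \<open>nat \<Rightarrow>\<^sub>0 nat\<close>.\<close>

type_synonym exponent = "nat \<Rightarrow>\<^sub>0 nat"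
type_synonym series = "exponent \<Rightarrow> rat"

definition scale :: "rat \<Rightarrow> ('a \<Rightarrow> rat) \<Rightarrow> 'a \<Rightarrow> rat" (infixr \<open>*\<^sub>Q\<close> 75) where
  "c *\<^sub>Q f = (\<lambda>x. c * f x)"

interpretation Q: vector_space "scale :: rat \<Rightarrow> ('a \<Rightarrow> rat) \<Rightarrow> 'a \<Rightarrow> rat"
  by unfold_locales (auto simp: scale_def algebra_simps)

text \<open>\<open>v\<close> is the (finite) linear combination of the \<open>b i\<close> with coefficients \<open>c i\<close>, \<open>i \<in> I\<close>.\<close>

definition has_expansion ::
  "('a \<Rightarrow> rat) \<Rightarrow> 'i set \<Rightarrow> ('i \<Rightarrow> 'a \<Rightarrow> rat) \<Rightarrow> ('i \<Rightarrow> rat) \<Rightarrow> bool" where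
  "has_expansion v I b c \<longleftrightarrow>
     finite {i \<in> I. c i \<noteq> 0} \<and> v = (\<Sum>i \<in> {i \<in> I. c i \<noteq> 0}. c i *\<^sub>Q b i)"

text \<open>\<open>Q[[x]] \<otimes> Q[[x]]\<close>, and with it \<open>QSym \<otimes> QSym\<close>, embeds into the power series in two sets of
  variables, \<open>f \<otimes> g\<close> being \<open>f(x) g(y)\<close>.\<close>

definition tensor :: "series \<Rightarrow> series \<Rightarrow> exponent \<times> exponent \<Rightarrow> rat" (infixr \<open>\<otimes>\<close> 70) where
  "f \<otimes> g = (\<lambda>(a, b). f a * g b)"


section \<open>Quasisymmetric functions\<close>

definition nonzero_parts :: "exponent \<Rightarrow> nat list" where
  "nonzero_parts a = map (Poly_Mapping.lookup a) (sorted_list_of_set (Poly_Mapping.keys a))"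

definition M :: "nat list \<Rightarrow> series" where
  "M \<alpha> = (\<lambda>a. if nonzero_parts a = \<alpha> then 1 else 0)"

definition QSym :: "series set" where
  "QSym = Q.span (M ` Comp)"

definition QSym_deg :: "nat \<Rightarrow> series set" where
  "QSym_deg n = Q.span (M ` {\<alpha> \<in> Comp. sum_list \<alpha> = n})"

text \<open>\<open>Q.representation B f b\<close> is the coefficient of \<open>b\<close> in the expansion of \<open>f\<close> in the basis \<open>B\<close>
  of its span (and 0 if \<open>f\<close> is not in that span).\<close>

definition coproduct :: "series \<Rightarrow> exponent \<times> exponent \<Rightarrow> rat" (\<open>\<Delta>\<close>) where
  "\<Delta> f = (let coeff = (\<lambda>\<alpha>. Q.representation (M ` Comp) f (M \<alpha>)) in
     \<Sum>\<alpha> \<in> {\<alpha> \<in> Comp. coeff \<alpha> \<noteq> 0}.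
       coeff \<alpha> *\<^sub>Q (\<Sum>(\<beta>, \<gamma>) \<in> {(\<beta>, \<gamma>). \<beta> @ \<gamma> = \<alpha>}. M \<beta> \<otimes> M \<gamma>))"

lemma nonzero_parts_surj:
  assumes "\<alpha> \<in> Comp"
  obtains a where "nonzero_parts a = \<alpha>"
proof -
  let ?f = "\<lambda>i. if i < length \<alpha> then \<alpha> ! i else 0"
  have pos: "\<alpha> ! i > 0" if "i < length \<alpha>" for i
    using assms that by (auto simp: Comp_def)
  have supp: "{i. ?f i \<noteq> 0} = {..<length \<alpha>}"
    using pos by (force split: if_splits)
  then have look: "Poly_Mapping.lookup (Abs_poly_mapping ?f) = ?f"
    by (intro lookup_Abs_poly_mapping) simp
  have keys: "Poly_Mapping.keys (Abs_poly_mapping ?f) = {..<length \<alpha>}"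
    using supp by (simp add: keys.rep_eq look)
  have "nonzero_parts (Abs_poly_mapping ?f) = map ?f [0..<length \<alpha>]"
    unfolding nonzero_parts_def look keys by (simp add: lessThan_atLeast0)
  also have "\<dots> = \<alpha>"
    by (rule nth_equalityI) auto
  finally show ?thesis by (rule that)
qed

lemma M_inj: "inj_on M Comp"
proof (rule inj_onI)
  fix \<alpha> \<beta> assume "\<alpha> \<in> Comp" and eq: "M \<alpha> = M \<beta>"
  then obtain a where "nonzero_parts a = \<alpha>" by (metis nonzero_parts_surj)
  then show "\<alpha> = \<beta>" using fun_cong[OF eq, of a] by (auto simp: M_def split: if_splits)
qed

lemma sum_fun_apply: "(\<Sum>i\<in>A. f i) x = (\<Sum>i\<in>A. f i x)"
  by (induction A rule: infinite_finite_induct) auto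

lemma M_independent: "Q.independent (M ` Comp)"
proof
  assume "Q.dependent (M ` Comp)"
  then obtain t u v where t: "finite t" "t \<subseteq> M ` Comp"
    and sum: "(\<Sum>w\<in>t. u w *\<^sub>Q w) = 0" and v: "v \<in> t" "u v \<noteq> 0"
    unfolding Q.dependent_explicit by blast
  from v t obtain \<alpha> where \<alpha>: "\<alpha> \<in> Comp" "v = M \<alpha>" by auto
  then obtain a where a: "nonzero_parts a = \<alpha>" by (metis nonzero_parts_surj)
  have "w a = (if w = v then 1 else 0)" if "w \<in> t" for w
    using that t \<alpha> a by (auto simp: M_def)
  then have "u w * w a = (if w = v then u w else 0)" if "w \<in> t" for w
    using that by (cases "w = v") (metis mult.right_neutral, metis mult_zero_right)
  then have "(\<Sum>w\<in>t. u w * w a) = (\<Sum>w\<in>t. if w = v then u w else 0)"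
    by (rule sum.cong[OF refl])
  also have "\<dots> = u v" using t v by simp
  finally show False
    using v fun_cong[OF sum, of a] by (simp add: sum_fun_apply scale_def)
qed

lemma coproduct_M:
  assumes "\<alpha> \<in> Comp"
  shows "\<Delta> (M \<alpha>) = (\<Sum>(\<beta>, \<gamma>) \<in> {(\<beta>, \<gamma>). \<beta> @ \<gamma> = \<alpha>}. M \<beta> \<otimes> M \<gamma>)"
proof -
  have r: "Q.representation (M ` Comp) (M \<alpha>) = (\<lambda>v. if v = M \<alpha> then 1 else 0)"
    using assms by (intro Q.representation_basis M_independent) auto
  have "{\<alpha>' \<in> Comp. (if M \<alpha>' = M \<alpha> then 1 else 0) \<noteq> (0 :: rat)} = {\<alpha>}"
    using assms M_inj by (auto dest: inj_onD)
  then show ?thesis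
    by (simp add: coproduct_def r)
qed

definition S :: "nat list \<Rightarrow> series" where
  "S \<alpha> = (\<lambda>a. of_nat (card {T. ssct \<alpha> [] T \<and> cont T = Poly_Mapping.lookup a}))"

text \<open>The family \<open>S\<^bsub>\<gamma>//\<beta>\<^esub>\<close>, \<open>\<beta>\<close> ranging over all compositions; it is extended by 0 to other lists
  only in order to be unique.\<close>

definition skew_S :: "nat list \<Rightarrow> nat list \<Rightarrow> series" where
  "skew_S \<gamma> = (THE F.
     (\<forall>\<beta> \<in> Comp. F \<beta> \<in> QSym) \<and>
     (\<forall>\<beta>. \<beta> \<notin> Comp \<longrightarrow> F \<beta> = 0) \<and>
     finite {\<beta>. F \<beta> \<noteq> 0} \<and>
     \<Delta> (S \<gamma>) = (\<Sum>\<beta> \<in> {\<beta>. F \<beta> \<noteq> 0}. F \<beta> \<otimes> S \<beta>))"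


section \<open>Noncommutative symmetric functions\<close>

text \<open>The graded dual of \<open>QSym\<close>: linear functionals on \<open>QSym\<close> that vanish on all but finitely many
  homogeneous components.  Functionals are 0 outside \<open>QSym\<close>, so that they are equal as functions
  iff they agree on \<open>QSym\<close>.\<close>

type_synonym functional = "series \<Rightarrow> rat"

definition NSym :: "functional set" where
  "NSym = {\<phi>.
     (\<forall>f \<in> QSym. \<forall>g \<in> QSym. \<phi> (f + g) = \<phi> f + \<phi> g) \<and>
     (\<forall>c. \<forall>f \<in> QSym. \<phi> (c *\<^sub>Q f) = c * \<phi> f) \<and>
     (\<forall>f. f \<notin> QSym \<longrightarrow> \<phi> f = 0) \<and>
     finite {n. \<exists>f \<in> QSym_deg n. \<phi> f \<noteq> 0}}"

definition pairing :: "series \<Rightarrow> functional \<Rightarrow> rat" (\<open>\<langle>_, _\<rangle>\<close>) where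
  "\<langle>f, \<phi>\<rangle> = \<phi> f"

text \<open>\<open>\<phi> \<otimes> \<psi>\<close> is evaluated on \<open>F = \<Sum>\<^sub>i f\<^sub>i \<otimes> g\<^sub>i\<close> by contracting first the second and then the first
  tensor factor: \<open>\<psi> (\<lambda>b. F (a, b)) = \<Sum>\<^sub>i f\<^sub>i a * \<psi> g\<^sub>i\<close>, so that the result is
  \<open>\<Sum>\<^sub>i \<phi> f\<^sub>i * \<psi> g\<^sub>i\<close>.\<close>

definition tensor_pairing :: "(exponent \<times> exponent \<Rightarrow> rat) \<Rightarrow> functional \<Rightarrow> functional \<Rightarrow> rat" where
  "tensor_pairing F \<phi> \<psi> = \<langle>\<lambda>a. \<langle>\<lambda>b. F (a, b), \<psi>\<rangle>, \<phi>\<rangle>"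

definition nsym_mult :: "functional \<Rightarrow> functional \<Rightarrow> functional" (infixl \<open>\<star>\<close> 70) where
  "\<phi> \<star> \<psi> = (\<lambda>f. if f \<in> QSym then tensor_pairing (\<Delta> f) \<phi> \<psi> else 0)"

definition S_dual :: "nat list \<Rightarrow> functional" (\<open>S\<^sup>*\<close>) where
  "S\<^sup>* \<beta> = (THE \<phi>. \<phi> \<in> NSym \<and>
     (\<forall>\<alpha> \<in> Comp. \<langle>S \<alpha>, \<phi>\<rangle> = (if \<alpha> = \<beta> then 1 else 0)))"

end

theory Submission
  imports Defs
begin

text \<open>
  Each of the five conditions characterizes \<open>C\<close> as the family of coefficients in an expansion
  with respect to linearly independent elements, or as values of pairings that extract these
  coefficients. The theorem therefore amounts to one identity, \<open>\<Delta> S\<^bsub>\<gamma>\<^esub> = \<Sum> c\<^bsub>\<alpha>\<beta>\<^esub> S\<^bsub>\<alpha>\<^esub> \<otimes> S\<^bsub>\<beta>\<^esub>\<close>,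
  where \<open>c\<^bsub>\<alpha>\<beta>\<^esub>\<close> (below: \<open>lr_coeff \<gamma> \<alpha> \<beta>\<close>) is the number of standard tableaux of shape \<open>\<gamma>//\<beta>\<close>
  that rectify to \<open>U \<alpha>\<close>. It is proved by counting words.

  Tableaux as words. A tableau of shape \<open>\<gamma>//\<beta>\<close> is built from \<open>\<beta>\<close> by placing its entries from the
  largest to the smallest, equal ones from left to right. The shape reached so far and the
  column of the next entry determine the row of that entry: in the first column it starts a new
  top row, and in another column \<open>k\<close> it prolongs the topmost row of length \<open>k\<close>
  (\<open>bottom_ssct_add\<close>, \<open>bottom_ssct_remove\<close>). A tableau is therefore determined by the word \<open>e\<close>
  of the columns of its entries, listed by increasing entry, and the words that occur are those
  that lead from \<open>\<beta>\<close> to \<open>\<gamma>\<close>, \<open>run e \<beta> = Some \<gamma>\<close>, and decrease strictly on each block of equal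
  entries (\<open>ssct_words_bij\<close>).

  Rectification. The column word of the standard tableau with word \<open>e\<close> is \<open>reading e\<close>, and two
  reading words have the same insertion tableau iff they are Knuth equivalent
  (\<open>knuth_iff_insertion\<close>). In this case the two words of columns are said to lie in the same
  class (\<open>same_rect\<close>). Call a word straight if it leads from the empty composition to some
  composition. Every class contains exactly one straight word (\<open>yamanouchi_exists\<close>,
  \<open>same_rect_yamanouchi_unique\<close>), namely the word of the rectification. So \<open>lr_coeff \<gamma> \<alpha> \<beta>\<close>
  counts the words that lead from \<open>\<beta>\<close> to \<open>\<gamma>\<close> and lie in the class of the word of \<open>U \<alpha>\<close>
  (\<open>card_sct\<close>).

  The crucial point is that any other straight word \<open>c\<close> of shape \<open>\<alpha>\<close> gives the same number
  (\<open>card_fiber\<close>). Knuth moves on the letters of words act on the reading words as dual Knuth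
  moves (\<open>reading_elem_move\<close>), and these respect Knuth equivalence (\<open>dual_move_knuth\<close>). Two
  straight words of the same shape are related by a sequence of such moves (\<open>linked_same_mset\<close>),
  and this sequence maps the class of one bijectively to the class of the other. That it also
  preserves \<open>run d \<beta> = Some \<gamma>\<close> is not true for the single moves, which can change the shapes; it
  holds for the whole sequence because this leaves the shape \<open>\<alpha>\<close> of the rectification of \<open>d\<close>
  alone. To see this, append the word of \<open>U \<beta>\<close> to \<open>d\<close>, which makes it straight, and more
  generally append any letters to \<open>d\<close>, one at a time. When one letter is appended, the shape of
  the new rectification is a function of the shape of the old one and of the content
  (\<open>rect_shape_snoc\<close>). Indeed, the removal of the largest entry from a straight tableau,
  followed by a jeu de taquin slide into the hole, relates the two composition shape in a way
  that depends only on the column in which the slide ends (\<open>run_lowered\<close>).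

  Conclusion. The descents of a word can be read off from its class
  (\<open>block_decreasing_same_rect\<close>), so the words of skew semistandard tableaux can be sorted by
  classes: \<open>K\<^bsub>\<gamma>//\<beta>,\<delta>\<^esub> = \<Sum>\<^sub>\<alpha> c\<^bsub>\<alpha>\<beta>\<^esub> K\<^bsub>\<alpha>,\<delta>\<^esub>\<close> for the numbers \<open>K\<close> of tableaux of given content
  (\<open>kostka_expansion\<close>). Cutting a word in two computes the coefficients of \<open>\<Delta> S\<^bsub>\<gamma>\<^esub>\<close> from these
  numbers (\<open>kostka_append\<close>), which gives the identity (\<open>coproduct_S_apply\<close>). The numbers \<open>K\<close> are
  unitriangular (\<open>kostka_triangular\<close>), so the functions \<open>S\<^bsub>\<alpha>\<^esub>\<close> form a basis of \<open>QSym\<close>; the rest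
  is linear algebra.
\<close>

section \<open>Row insertion and Knuth equivalence\<close>

text \<open>Insertion can be performed one row at a time instead of one letter at a time: the second
  component is the word that the rows below receive.\<close>

fun row_word :: "nat list \<Rightarrow> nat list \<Rightarrow> nat list \<times> nat list" where
  "row_word [] r = (r, [])"
| "row_word (x # w) r =
     (case row_insert x r of
        (r', None) \<Rightarrow> row_word w r'
      | (r', Some y) \<Rightarrow> (fst (row_word w r'), y # snd (row_word w r')))"

lemma fold_insert_Cons:
  "fold insert_letter w (r # rs) =
     fst (row_word w r) # fold insert_letter (snd (row_word w r)) rs"
  by (induction w arbitrary: r rs) (auto split: prod.splits option.splits)

lemma fold_insert_Nil:
  assumes "w \<noteq> []"
  shows "fold insert_letter w [] =
     fst (row_word w []) # fold insert_letter (snd (row_word w [])) []"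
proof -
  obtain x w' where w: "w = x # w'" using assms by (cases w) auto
  show ?thesis unfolding w by (simp add: fold_insert_Cons)
qed

lemma row_word_append:
  "row_word (u @ v) r =
     (fst (row_word v (fst (row_word u r))), snd (row_word u r) @ snd (row_word v (fst (row_word u r))))"
  by (induction u arbitrary: r) (auto split: prod.splits option.splits)

lemma row_insert_pos:
  assumes "k = length (takeWhile (\<lambda>z. x \<le> z) r)"
  shows "row_insert x r = (if k < length r then (r[k := x], Some (r ! k)) else (r @ [x], None))"
  using assms by (induction r arbitrary: k) auto

lemma row_insert_mset:
  "row_insert x r = (r', b) \<Longrightarrow>
     mset r' + (case b of None \<Rightarrow> {#} | Some y \<Rightarrow> {#y#}) = add_mset x (mset r)"
  by (induction x r arbitrary: r' b rule: row_insert.induct)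
     (auto split: prod.splits option.splits if_splits)

lemma row_insert_set:
  "set (fst (row_insert x r)) \<subseteq> insert x (set r)"
  by (induction r) (auto split: prod.splits)

lemma row_insert_decr:
  "sorted_wrt (>) r \<Longrightarrow> x \<notin> set r \<Longrightarrow> sorted_wrt (>) (fst (row_insert x r))"
proof (induction r)
  case (Cons y ys)
  then show ?case using row_insert_set[of x ys] by (auto split: prod.splits) 
qed simp

lemma row_insert_bumped:
  "row_insert x r = (r', Some y) \<Longrightarrow> y < x \<and> y \<in> set r"
  by (induction r arbitrary: r') (auto split: prod.splits if_splits)

lemma row_word_mset: "mset (fst (row_word w r)) + mset (snd (row_word w r)) = mset w + mset r"
proof (induction w arbitrary: r)
  case (Cons x w)
  obtain r' b where rb: "row_insert x r = (r', b)" by fastforce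
  show ?case using Cons[of r'] row_insert_mset[OF rb] rb
    by (cases b) (auto simp: algebra_simps)
qed simp

lemma row_word_decr:
  "sorted_wrt (>) r \<Longrightarrow> distinct w \<Longrightarrow> set w \<inter> set r = {} \<Longrightarrow> sorted_wrt (>) (fst (row_word w r))"
proof (induction w arbitrary: r)
  case (Cons x w)
  obtain r' b where rb: "row_insert x r = (r', b)" by fastforce
  have "sorted_wrt (>) r'" using row_insert_decr[of r x] Cons.prems rb by auto
  moreover have "set w \<inter> set r' = {}" using row_insert_set[of x r] Cons.prems rb by auto
  ultimately show ?case using Cons rb by (cases b) auto
qed simp

text \<open>Reading words have distinct letters, hence the strict inequalities.\<close>

inductive knuth1 :: "nat list \<Rightarrow> nat list \<Rightarrow> bool" where
  left: "x < y \<Longrightarrow> y < z \<Longrightarrow> knuth1 (a @ [y, x, z] @ b) (a @ [y, z, x] @ b)"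
| right: "x < y \<Longrightarrow> y < z \<Longrightarrow> knuth1 (a @ [x, z, y] @ b) (a @ [z, x, y] @ b)"

definition knuth :: "nat list \<Rightarrow> nat list \<Rightarrow> bool" where
  "knuth = equivclp knuth1"

lemma knuth_refl: "knuth w w" and knuth_sym: "knuth v w \<Longrightarrow> knuth w v"
  and knuth_trans: "knuth u v \<Longrightarrow> knuth v w \<Longrightarrow> knuth u w"
  and knuth1_knuth: "knuth1 v w \<Longrightarrow> knuth v w"
  unfolding knuth_def
  by (simp, erule equivclp_sym, erule (1) equivclp_trans, erule r_into_equivclp)

lemma knuth_induct [consumes 1, case_names refl step inv]:
  assumes "knuth v w" "Q v"
    "\<And>u w. knuth v u \<Longrightarrow> Q u \<Longrightarrow> knuth1 u w \<Longrightarrow> Q w"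
    "\<And>u w. knuth v u \<Longrightarrow> Q u \<Longrightarrow> knuth1 w u \<Longrightarrow> Q w"
  shows "Q w"
proof -
  have "equivclp knuth1 v w" using assms(1) unfolding knuth_def .
  then show ?thesis
  proof (induction rule: equivclp_induct)
    case (step u w)
    then have "knuth v u" unfolding knuth_def by simp
    then show ?case using step assms(3,4) by blast
  qed (rule assms(2))
qed

lemma knuth1_context: "knuth1 v w \<Longrightarrow> knuth1 (a @ v @ b) (a @ w @ b)"
proof (induction rule: knuth1.induct)
  case (left x y z a' b')
  then show ?case using knuth1.left[of x y z "a @ a'" "b' @ b"] by simp
next
  case (right x y z a' b')
  then show ?case using knuth1.right[of x y z "a @ a'" "b' @ b"] by simp
qed

lemma knuth_context: "knuth v w \<Longrightarrow> knuth (a @ v @ b) (a @ w @ b)"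
proof (induction rule: knuth_induct)
  case (step u w)
  then show ?case using knuth1_context knuth1_knuth knuth_trans by blast
next
  case (inv u w)
  then show ?case using knuth1_context knuth1_knuth knuth_trans knuth_sym by blast
qed (rule knuth_refl)

lemma knuth1_mset: "knuth1 v w \<Longrightarrow> mset v = mset w"
  by (induction rule: knuth1.induct) auto

lemma knuth_mset: "knuth v w \<Longrightarrow> mset v = mset w"
  by (induction rule: knuth_induct) (auto dest: knuth1_mset)

text \<open>A smaller second letter stops to the right of the first one, where the entries are
  smaller.\<close>

lemma row_insert_two_decr:
  assumes "sorted_wrt (>) t" "x < y" "row_insert y t = (t1, p)" "row_insert x t1 = (t2, q)"
  shows "case p of None \<Rightarrow> q = None | Some p' \<Rightarrow> (case q of None \<Rightarrow> True | Some q' \<Rightarrow> q' < p')"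
  using assms
proof (induction t arbitrary: t1 t2 p q)
  case (Cons h t)
  obtain s b where sb: "row_insert y t = (s, b)" by fastforce
  obtain s' b' where sb': "row_insert x s = (s', b')" by fastforce
  obtain s2 b2 where sb2: "row_insert x t = (s2, b2)" by fastforce
  show ?case
  proof (cases "h < y")
    case True
    then show ?thesis using Cons.prems sb2 row_insert_bumped[of x t]
      by (auto split: option.splits)
  next
    case False
    have "b = p" "b' = q" using Cons.prems sb sb' False by (auto split: option.splits)
    then show ?thesis using Cons.IH[OF _ _ sb sb'] Cons.prems(1,2) by auto
  qed
qed auto

text \<open>A larger second letter stops no later than at the position of the first one, which is
  smaller, so it always bumps an entry, and a larger one than the first letter did.\<close>

lemma row_insert_two_incr:
  assumes "sorted_wrt (>) t" "x < y" "row_insert x t = (t1, p)" "row_insert y t1 = (t2, q)"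
  shows "\<exists>q'. q = Some q' \<and> (case p of None \<Rightarrow> True | Some p' \<Rightarrow> p' < q')"
  using assms
proof (induction t arbitrary: t1 t2 p q)
  case (Cons h t)
  obtain s b where sb: "row_insert x t = (s, b)" by fastforce
  obtain s' b' where sb': "row_insert y s = (s', b')" by fastforce
  show ?case
    using Cons.prems Cons.IH[OF _ _ sb sb'] sb sb' row_insert_bumped[of x t s]
    by (cases p) (auto split: option.splits if_splits)
qed auto

text \<open>Two words related by an elementary step may bump the same word from a row, so that nothing
  remains to be done in the rows below.\<close>

definition knuth01 :: "nat list \<Rightarrow> nat list \<Rightarrow> bool" where
  "knuth01 v w \<longleftrightarrow> v = w \<or> knuth1 v w \<or> knuth1 w v"

lemma knuth01_three:
  "x < y \<Longrightarrow> y < z \<Longrightarrow> knuth01 [y, x, z] [y, z, x]" "x < y \<Longrightarrow> y < z \<Longrightarrow> knuth01 [x, z, y] [z, x, y]"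
  "x < y \<Longrightarrow> y < z \<Longrightarrow> knuth01 [y, z, x] [y, x, z]" "x < y \<Longrightarrow> y < z \<Longrightarrow> knuth01 [z, x, y] [x, z, y]"
  "knuth01 v v"
  using knuth1.intros[of x y z "[]" "[]"] by (auto simp: knuth01_def)

lemma row_insert_head_smaller:
  assumes "\<forall>y\<in>set t. y < x"
  shows "row_insert x t = (if t = [] then ([x], None) else (x # tl t, Some (hd t)))"
  using assms by (cases t) auto

lemma row_word_below_head:
  "\<forall>x\<in>set w. x \<le> h \<Longrightarrow> row_word w (h # t) = (h # fst (row_word w t), snd (row_word w t))"
  by (induction w arbitrary: t) (auto split: prod.splits option.splits)

text \<open>Compare the head \<open>h\<close> of the row with the three letters. If it exceeds all of them, they
  pass it and the rest of the row decides; otherwise the place of \<open>h\<close> among them determines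
  which letters replace \<open>h\<close>, and the bumped words are equal or the two sides of a Knuth
  relation.\<close>

lemma row_word_knuth_left:
  assumes "sorted_wrt (>) r" "x < y" "y < z" "x \<notin> set r" "y \<notin> set r" "z \<notin> set r"
  shows "fst (row_word [y, x, z] r) = fst (row_word [y, z, x] r) \<and>
         knuth01 (snd (row_word [y, x, z] r)) (snd (row_word [y, z, x] r))"
  using assms
proof (induction r)
  case (Cons h t)
  have t: "\<forall>u\<in>set t. u < h" using Cons.prems by auto
  have neq: "h \<noteq> x" "h \<noteq> y" "h \<noteq> z" using Cons.prems by auto
  obtain t1 p where p: "row_insert y t = (t1, p)" by fastforce
  obtain t2 q where q: "row_insert x t1 = (t2, q)" by fastforce
  obtain t3 s where s: "row_insert x t = (t3, s)" by fastforce
  have two: "case p of None \<Rightarrow> q = None | Some p' \<Rightarrow> (case q of None \<Rightarrow> True | Some q' \<Rightarrow> q' < p')"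
    using row_insert_two_decr[OF _ _ p q] Cons.prems by simp
  have pt: "\<And>p'. p = Some p' \<Longrightarrow> p' < h" "\<And>s'. s = Some s' \<Longrightarrow> s' < h \<and> s' < x"
    using row_insert_bumped[of y t t1] row_insert_bumped[of x t t3] p s t by auto
  consider "z < h" | "y < h" "h < z" | "x < h" "h < y" | "h < x" using neq by linarith
  then show ?case
  proof cases
    case 1
    then have "row_word w (h # t) = (h # fst (row_word w t), snd (row_word w t))"
      if "set w = {x, y, z}" for w
      using that Cons.prems(2,3) by (intro row_word_below_head) auto
    then show ?thesis using Cons.IH Cons.prems by (simp add: insert_commute del: row_word.simps)
  next
    case 2
    then show ?thesis using Cons.prems p q two pt
      by (auto split: option.splits simp: knuth01_three)
  next
    case 3
    then show ?thesis using Cons.prems s pt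
      by (auto split: option.splits simp: knuth01_three)
  next
    case 4
    then have "row_insert x t = (if t = [] then ([x], None) else (x # tl t, Some (hd t)))"
      using t by (intro row_insert_head_smaller) auto
    moreover have "t \<noteq> [] \<Longrightarrow> hd t < h" using t by (cases t) auto
    ultimately show ?thesis using Cons.prems 4
      by (auto split: option.splits simp: knuth01_three)
  qed
qed (auto simp: knuth01_def)

text \<open>The same case distinction for the other relation.\<close>

lemma row_word_knuth_right:
  assumes "sorted_wrt (>) r" "x < y" "y < z" "x \<notin> set r" "y \<notin> set r" "z \<notin> set r"
  shows "fst (row_word [x, z, y] r) = fst (row_word [z, x, y] r) \<and>
         knuth01 (snd (row_word [x, z, y] r)) (snd (row_word [z, x, y] r))"
  using assms
proof (induction r)
  case (Cons h t)
  have t: "\<forall>u\<in>set t. u < h" using Cons.prems by auto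
  have neq: "h \<noteq> x" "h \<noteq> y" "h \<noteq> z" using Cons.prems by auto
  obtain t1 p where p: "row_insert x t = (t1, p)" by fastforce
  obtain t2 q where q: "row_insert y t1 = (t2, q)" by fastforce
  have two: "\<exists>q'. q = Some q' \<and> (case p of None \<Rightarrow> True | Some p' \<Rightarrow> p' < q')"
    using row_insert_two_incr[OF _ _ p q] Cons.prems by simp
  have t1: "x < h \<Longrightarrow> \<forall>u\<in>set t1. u < h" using row_insert_set[of x t] p t by auto
  have qt: "\<And>q'. x < h \<Longrightarrow> q = Some q' \<Longrightarrow> q' < h"
    using row_insert_bumped[of y t1 t2] q t1 by auto
  consider "z < h" | "y < h" "h < z" | "x < h" "h < y" | "h < x" using neq by linarith
  then show ?case
  proof cases
    case 1
    then have "row_word w (h # t) = (h # fst (row_word w t), snd (row_word w t))"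
      if "set w = {x, y, z}" for w
      using that Cons.prems(2,3) by (intro row_word_below_head) auto
    then show ?thesis using Cons.IH Cons.prems by (simp add: insert_commute del: row_word.simps)
  next
    case 2
    then show ?thesis using Cons.prems p q two qt
      by (auto split: option.splits simp: knuth01_three)
  next
    case 3
    then show ?thesis using Cons.prems p q two qt
      by (auto split: option.splits simp: knuth01_three)
  next
    case 4
    then have "row_insert x t = (if t = [] then ([x], None) else (x # tl t, Some (hd t)))"
      "row_insert y t = (if t = [] then ([y], None) else (y # tl t, Some (hd t)))"
      using t Cons.prems by (intro row_insert_head_smaller; force)+
    moreover have "t \<noteq> [] \<Longrightarrow> hd t < h" using t by (cases t) auto
    ultimately show ?thesis using Cons.prems 4
      by (auto split: option.splits simp: knuth01_three)
  qed
qed (auto simp: knuth01_def)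

lemma knuth01_context: "knuth01 v w \<Longrightarrow> knuth01 (a @ v @ b) (a @ w @ b)"
  unfolding knuth01_def using knuth1_context by blast

text \<open>The letters before the triple merely change the row that the triple meets.\<close>

lemma row_word_knuth1:
  assumes "knuth1 v w" "sorted_wrt (>) r" "distinct v" "set v \<inter> set r = {}"
  shows "fst (row_word v r) = fst (row_word w r) \<and> knuth01 (snd (row_word v r)) (snd (row_word w r))"
proof -
  have *: ?thesis if v: "v = a @ t @ b" "w = a @ t' @ b" and
    tt: "\<And>r. sorted_wrt (>) r \<Longrightarrow> set t \<inter> set r = {} \<Longrightarrow>
       fst (row_word t r) = fst (row_word t' r) \<and> knuth01 (snd (row_word t r)) (snd (row_word t' r))"
    for a b t t'
  proof -
    have "set (fst (row_word a r)) \<subseteq> set a \<union> set r"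
      using row_word_mset[of a r] by (metis Un_iff mset_subset_eq_add_left set_mset_mono set_mset_mset set_mset_union subsetI)
    then have "set t \<inter> set (fst (row_word a r)) = {}"
      using assms(3,4) v by auto
    moreover have "sorted_wrt (>) (fst (row_word a r))"
      using assms v by (intro row_word_decr) auto
    ultimately show ?thesis
      using tt[of "fst (row_word a r)"] v by (simp add: row_word_append knuth01_context)
  qed
  show ?thesis using assms(1)
  proof cases
    case (left x y z a b)
    show ?thesis by (rule *[OF left(1,2)]) (rule row_word_knuth_left; use left in simp)
  next
    case (right x y z a b)
    show ?thesis by (rule *[OF right(1,2)]) (rule row_word_knuth_right; use right in simp)
  qed
qed

lemma row_word_nonempty: "r \<noteq> [] \<or> w \<noteq> [] \<Longrightarrow> fst (row_word w r) \<noteq> []"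
proof (induction w arbitrary: r)
  case (Cons x w)
  obtain r' b where rb: "row_insert x r = (r', b)" by fastforce
  have "fst (row_insert x r) \<noteq> []" by (cases r) (auto split: prod.splits)
  then show ?case using Cons.IH[of r'] rb by (cases b) auto
qed simp

lemma bumped_shorter:
  assumes "w \<noteq> []"
  shows "length (snd (row_word w [])) < length w"
proof -
  have "length (fst (row_word w [])) + length (snd (row_word w [])) = length w"
    using arg_cong[OF row_word_mset[of w "[]"], of size] by simp
  then show ?thesis using row_word_nonempty[of "[]" w] assms by (cases "fst (row_word w [])") auto
qed

lemma bumped_distinct:
  assumes "distinct w"
  shows "distinct (snd (row_word w []))"
proof -
  have "mset (fst (row_word w []) @ snd (row_word w [])) = mset w"
    using row_word_mset[of w "[]"] by simp
  then have "distinct (fst (row_word w []) @ snd (row_word w []))"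
    using assms mset_eq_imp_distinct_iff by blast
  then show ?thesis by simp
qed

text \<open>The first rows agree, and the other rows are the insertion tableau of the bumped words,
  which are shorter and again related by at most one elementary step.\<close>

lemma knuth1_insertion:
  "knuth1 v w \<Longrightarrow> distinct v \<Longrightarrow> fold insert_letter v [] = fold insert_letter w []"
proof (induction "length v" arbitrary: v w rule: less_induct)
  case less
  have ne: "v \<noteq> []" "w \<noteq> []" using less.prems(1) by (auto elim: knuth1.cases)
  have len: "length w = length v" "distinct w"
    using knuth1_mset[OF less.prems(1)] less.prems(2) by (metis size_mset, metis mset_eq_imp_distinct_iff)
  let ?v = "snd (row_word v [])" and ?w = "snd (row_word w [])"
  have rw: "fst (row_word v []) = fst (row_word w [])" "knuth01 ?v ?w"
    using row_word_knuth1[OF less.prems(1), of "[]"] less.prems by auto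
  have "fold insert_letter ?v [] = fold insert_letter ?w []"
    using rw(2) less.hyps[of ?v ?w] less.hyps[of ?w ?v] bumped_shorter[OF ne(1)] bumped_shorter[OF ne(2)]
      bumped_distinct less.prems(2) len unfolding knuth01_def by metis
  then show ?case using fold_insert_Nil ne rw by metis
qed

lemma knuth_distinct: "knuth v w \<Longrightarrow> distinct v \<Longrightarrow> distinct w"
  using knuth_mset mset_eq_imp_distinct_iff by blast

lemma knuth_insertion:
  "knuth v w \<Longrightarrow> distinct v \<Longrightarrow> fold insert_letter v [] = fold insert_letter w []"
proof (induction rule: knuth_induct)
  case (step u w)
  then show ?case using knuth1_insertion knuth_distinct by metis
next
  case (inv u w)
  then have "distinct w" using knuth_distinct knuth1_knuth knuth_sym by metis
  then show ?case using inv knuth1_insertion by metis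
qed simp

section \<open>Insertion tableaux\<close>

text \<open>In a decreasing row a new letter \<open>x\<close> can move to the left past smaller entries as long as
  one more smaller entry, here \<open>h\<close>, precedes them.\<close>

lemma knuth_move_left:
  "sorted_wrt (>) (h # t) \<Longrightarrow> h < x \<Longrightarrow> knuth (h # t @ [x]) (h # x # t)"
proof (induction t arbitrary: h)
  case (Cons t1 t)
  have "knuth ([h] @ (t1 # t @ [x]) @ []) ([h] @ (t1 # x # t) @ [])"
    using Cons by (intro knuth_context Cons.IH) auto
  moreover have "knuth ([] @ [h, t1, x] @ t) ([] @ [h, x, t1] @ t)"
    using Cons.prems by (intro knuth1_knuth knuth1.left) auto
  ultimately show ?case using knuth_trans by fastforce
qed (simp add: knuth_refl)

text \<open>Row insertion decomposes into Knuth relations: the inserted letter moves left past the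
  smaller entries until it stands behind the entry to be bumped, and then that entry moves left
  past the larger ones to the front.\<close>

lemma row_insert_knuth:
  "sorted_wrt (>) r \<Longrightarrow> x \<notin> set r \<Longrightarrow> row_insert x r = (r', b) \<Longrightarrow>
     (case b of None \<Rightarrow> r' = r @ [x] | Some y \<Rightarrow> r' \<noteq> [] \<and> y < hd r' \<and> knuth (r @ [x]) (y # r'))"
proof (induction r arbitrary: r' b)
  case (Cons h t)
  obtain s c where s: "row_insert x t = (s, c)" by fastforce
  show ?case
  proof (cases "h < x")
    case True
    then show ?thesis using Cons.prems knuth_move_left[of h t x] by auto
  next
    case False
    show ?thesis
    proof (cases c)
      case None
      then show ?thesis using False Cons.prems Cons.IH[OF _ _ s] s by auto
    next
      case (Some y)
      then have s2: "s \<noteq> []" "y < hd s" "knuth (t @ [x]) (y # s)"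
        using Cons.prems Cons.IH[OF _ _ s] by auto
      obtain s1 s' where s1: "s = s1 # s'" using s2 by (cases s) auto
      have "s1 < h" using row_insert_set[of x t] s s1 Cons.prems False by force
      then have "knuth ([] @ [h, y, s1] @ s') ([] @ [y, h, s1] @ s')"
        using s2 s1 by (intro knuth_sym[OF knuth1_knuth] knuth1.right) auto
      moreover have "knuth ([h] @ (t @ [x]) @ []) ([h] @ (y # s) @ [])"
        using s2 by (intro knuth_context)
      ultimately have "knuth (h # t @ [x]) (y # h # s)"
        using s1 knuth_trans by fastforce
      moreover have "y < h" using \<open>s1 < h\<close> s2 s1 by simp
      ultimately show ?thesis using Some False Cons.prems s by auto
    qed
  qed
qed auto

lemma insert_letter_mset:
  "mset (concat (insert_letter x rs)) = add_mset x (mset (concat rs))"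
proof (induction x rs rule: insert_letter.induct)
  case (2 x r rs)
  obtain r' b where rb: "row_insert x r = (r', b)" by fastforce
  show ?case using 2[OF rb[symmetric]] row_insert_mset[OF rb] rb by (cases b) (auto simp: algebra_simps)
qed auto

text \<open>Read the rows from bottom to top: the bumped entry leaves the row at its front, which is
  where the word of the row below ends.\<close>

lemma insert_letter_knuth:
  "\<forall>r\<in>set rs. sorted_wrt (>) r \<Longrightarrow> distinct (concat rs) \<Longrightarrow> x \<notin> set (concat rs) \<Longrightarrow>
     knuth (concat (rev rs) @ [x]) (concat (rev (insert_letter x rs)))"
proof (induction x rs rule: insert_letter.induct)
  case (2 x r rs)
  obtain r' b where rb: "row_insert x r = (r', b)" by fastforce
  have *: "case b of None \<Rightarrow> r' = r @ [x] | Some y \<Rightarrow> r' \<noteq> [] \<and> y < hd r' \<and> knuth (r @ [x]) (y # r')"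
    using 2 rb by (intro row_insert_knuth) auto
  show ?case
  proof (cases b)
    case None
    then show ?thesis using * rb by (simp add: knuth_refl)
  next
    case (Some y)
    then have y: "y \<in> set r" using row_insert_bumped rb by blast
    have IH: "knuth (concat (rev rs) @ [y]) (concat (rev (insert_letter y rs)))"
      using "2.prems" y by (intro "2.IH"[OF rb[symmetric] Some]) auto
    have "knuth (concat (rev rs) @ (r @ [x]) @ []) (concat (rev rs) @ (y # r') @ [])"
      using * Some by (intro knuth_context) auto
    moreover have "knuth ([] @ (concat (rev rs) @ [y]) @ r') ([] @ concat (rev (insert_letter y rs)) @ r')"
      using IH by (rule knuth_context)
    ultimately show ?thesis using rb Some knuth_trans by fastforce
  qed
qed (simp add: knuth_refl)

definition dominates :: "nat list \<Rightarrow> nat list \<Rightarrow> bool" where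
  "dominates r s \<longleftrightarrow> length s \<le> length r \<and> (\<forall>k<length s. s ! k < r ! k)"

fun tableau :: "nat list list \<Rightarrow> bool" where
  "tableau [] = True"
| "tableau (r # rs) \<longleftrightarrow> r \<noteq> [] \<and> sorted_wrt (>) r \<and> (rs \<noteq> [] \<longrightarrow> dominates r (hd rs)) \<and> tableau rs"

definition slot :: "nat \<Rightarrow> nat list \<Rightarrow> nat" where
  "slot x r = length (takeWhile (\<lambda>z. x \<le> z) r)"

lemma row_insert_slot:
  "row_insert x r = (if slot x r < length r then (r[slot x r := x], Some (r ! slot x r)) else (r @ [x], None))"
  using row_insert_pos[of "slot x r"] by (simp add: slot_def)

lemma slot_le_length: "slot x r \<le> length r"
  by (simp add: slot_def length_takeWhile_le)

lemma slot_before: "k < slot x r \<Longrightarrow> x \<le> r ! k"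
  unfolding slot_def by (metis nth_mem set_takeWhileD takeWhile_nth)

lemma slot_le: "k < length r \<Longrightarrow> r ! k < x \<Longrightarrow> slot x r \<le> k"
  using slot_before[of k x r] by fastforce

text \<open>On its way down a bumped entry moves weakly to the left.\<close>

lemma slot_dominated:
  assumes "dominates r s" "k < length r"
  shows "slot (r ! k) s \<le> k"
  using assms slot_le[of k s "r ! k"] slot_le_length[of "r ! k" s]
  unfolding dominates_def by (cases "k < length s") auto

lemma hd_insert_letter: "hd (insert_letter x rs) = (if rs = [] then [x] else fst (row_insert x (hd rs)))"
  by (cases rs) (auto split: prod.splits option.splits)

lemma insert_letter_nonempty [simp]: "insert_letter x rs \<noteq> []"
  by (cases rs) (auto split: prod.splits option.splits)

text \<open>The bumped entry \<open>y\<close> meets the column condition in its new position since it moves weakly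
  to the left, to a place below an entry to the left of the old place of \<open>y\<close> or below \<open>x\<close>.\<close>

lemma dominates_insert:
  assumes r: "sorted_wrt (>) r" "x \<notin> set r" and k: "slot x r < length r"
    and y: "y = r ! slot x r" and s: "rs \<noteq> [] \<Longrightarrow> dominates r (hd rs)"
  shows "dominates (r[slot x r := x]) (hd (insert_letter y rs))"
proof -
  have yx: "y < x" using row_insert_bumped[of x r] row_insert_slot[of x r] k y by auto
  let ?k = "slot x r"
  show ?thesis
  proof (cases "rs = []")
    case True
    have "?k \<noteq> 0 \<Longrightarrow> y < r ! 0"
      using r(1) k y by (auto simp: sorted_wrt_iff_nth_less)
    then show ?thesis using True k yx by (auto simp: dominates_def nth_list_update)
  next
    case False
    define s where "s = hd rs"
    have d: "dominates r s" using assms(5) False s_def by simp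
    have le: "slot y s \<le> ?k" unfolding y by (rule slot_dominated[OF d k])
    have upd: "u ! i < r[?k := x] ! i" if "i < length r" "u ! i < r ! i" for u i
      using that yx y by (cases "i = ?k") auto
    have new: "y < r[?k := x] ! i" if "i \<le> ?k" for i
      using that r(1) k y yx by (auto simp: nth_list_update sorted_wrt_iff_nth_less)
    define r' where "r' = r[?k := x]"
    have r': "length r' = length r" "\<And>i. i < length s \<Longrightarrow> s ! i < r' ! i" "\<And>i. i \<le> ?k \<Longrightarrow> y < r' ! i"
      using d upd new by (auto simp: r'_def dominates_def)
    have "dominates r' (fst (row_insert y s))"
    proof (cases "slot y s < length s")
      case True
      then show ?thesis using d r' le
        by (auto simp: row_insert_slot dominates_def nth_list_update)
    next
      case False
      then have "slot y s = length s" using slot_le_length[of y s] by simp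
      then show ?thesis using d r' le k
        by (auto simp: row_insert_slot dominates_def nth_append less_Suc_eq)
    qed
    then show ?thesis using False by (simp add: hd_insert_letter s_def r'_def)
  qed
qed

lemma tableau_insert_letter:
  "tableau rs \<Longrightarrow> distinct (concat rs) \<Longrightarrow> x \<notin> set (concat rs) \<Longrightarrow> tableau (insert_letter x rs)"
proof (induction x rs rule: insert_letter.induct)
  case (2 x r rs)
  obtain r' b where rb: "row_insert x r = (r', b)" by fastforce
  have decr: "sorted_wrt (>) r'" using row_insert_decr[of r x] 2 rb by auto
  show ?case
  proof (cases b)
    case None
    then have "r' = r @ [x]" using row_insert_slot[of x r] rb by (auto split: if_splits)
    then show ?thesis using None 2 rb decr by (auto simp: dominates_def nth_append)
  next
    case (Some y)
    then have k: "slot x r < length r" "y = r ! slot x r" "r' = r[slot x r := x]"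
      using row_insert_slot[of x r] rb by (auto split: if_splits)
    have y: "y \<in> set r" using row_insert_bumped rb Some by blast
    have "tableau (insert_letter y rs)"
      using "2.prems" y by (intro "2.IH"[OF rb[symmetric] Some]) auto
    moreover have "dominates r' (hd (insert_letter y rs))"
      unfolding k(3) using "2.prems" k by (intro dominates_insert) auto
    moreover have "r' \<noteq> []" using k(1) unfolding k(3) by (metis length_list_update list.size(3) not_less0)
    ultimately show ?thesis using decr rb Some by simp
  qed
qed simp

lemma insertion_mset: "mset (concat (fold insert_letter w [])) = mset w"
  by (induction w rule: rev_induct) (auto simp: insert_letter_mset)

lemma insertion_distinct: "distinct w \<Longrightarrow> distinct (concat (fold insert_letter w []))"
  using insertion_mset mset_eq_imp_distinct_iff by blast

lemma insertion_set: "set (concat (fold insert_letter w [])) = set w"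
  using insertion_mset mset_eq_setD by blast

lemma insertion_tableau: "distinct w \<Longrightarrow> tableau (fold insert_letter w [])"
proof (induction w rule: rev_induct)
  case (snoc x w)
  then show ?case using insertion_distinct[of w] insertion_set[of w]
    by (auto intro!: tableau_insert_letter)
qed simp

lemma tableau_rows: "tableau rs \<Longrightarrow> r \<in> set rs \<Longrightarrow> sorted_wrt (>) r \<and> r \<noteq> []"
  by (induction rs) auto

text \<open>Inserting a letter is a sequence of Knuth relations. It follows that words with the same
  insertion tableau are Knuth equivalent.\<close>

lemma knuth_reading:
  "distinct w \<Longrightarrow> knuth w (concat (rev (fold insert_letter w [])))"
proof (induction w rule: rev_induct)
  case (snoc x w)
  let ?P = "fold insert_letter w []"
  have "knuth ([] @ w @ [x]) ([] @ concat (rev ?P) @ [x])"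
    using snoc by (intro knuth_context) auto
  moreover have "knuth (concat (rev ?P) @ [x]) (concat (rev (insert_letter x ?P)))"
    using snoc insertion_distinct[of w] insertion_set[of w] insertion_tableau[of w] tableau_rows
    by (intro insert_letter_knuth) auto
  ultimately show ?case using knuth_trans by simp
qed (simp add: knuth_refl)

lemma knuth_iff_insertion:
  assumes "distinct v" "distinct w"
  shows "knuth v w \<longleftrightarrow> fold insert_letter v [] = fold insert_letter w []"
  using assms knuth_insertion knuth_reading knuth_sym knuth_trans by metis

text \<open>In an increasing column every letter bumps its predecessor from the end of the row, and
  the last letter stays.\<close>

lemma row_word_column:
  assumes "us \<noteq> []" "sorted_wrt (<) us" "\<forall>x\<in>set r. last us < x"
  shows "row_word us r = (r @ [last us], butlast us)"
  using assms
proof (induction us rule: rev_nonempty_induct)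
  case (single x)
  then have "takeWhile (\<lambda>z. x \<le> z) r = r" by (intro takeWhile_eq_all_conv[THEN iffD2]) auto
  then have "slot x r = length r" by (simp only: slot_def)
  then show ?case by (simp add: row_insert_slot)
next
  case (snoc u vs)
  have "last vs < u" using snoc by (auto simp: sorted_wrt_append)
  then have *: "row_word vs r = (r @ [last vs], butlast vs)"
    using snoc.prems by (intro snoc.IH) (auto simp: sorted_wrt_append dest: order.strict_trans)
  have "slot u (r @ [last vs]) = length r"
    using snoc.prems \<open>last vs < u\<close> by (auto simp: slot_def takeWhile_append)
  then show ?case using * snoc.hyps by (simp add: row_word_append row_insert_slot)
qed

lemma row_word_columns:
  assumes "\<forall>us\<in>set cols. us \<noteq> [] \<and> sorted_wrt (<) us \<and> (\<forall>x\<in>set r. last us < x)"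
    "sorted_wrt (\<lambda>u v. last v < last u) cols"
  shows "row_word (concat cols) r = (r @ map last cols, concat (map butlast cols))"
  using assms
proof (induction cols arbitrary: r)
  case (Cons us cols)
  have "row_word us r = (r @ [last us], butlast us)"
    using Cons.prems by (intro row_word_column) auto
  moreover have "row_word (concat cols) (r @ [last us]) = ((r @ [last us]) @ map last cols, concat (map butlast cols))"
    using Cons.prems by (intro Cons.IH) auto
  ultimately show ?case by (simp add: row_word_append)
qed simp

definition column_before :: "nat list \<Rightarrow> nat list \<Rightarrow> bool" where
  "column_before u v \<longleftrightarrow> dominates (rev u) (rev v)"

lemma filling_of_rows_Cons:
  "filling_of_rows (r # rs) (0, k) = (if k < length r then r ! k else 0)"
  "filling_of_rows (r # rs) (Suc i, k) = filling_of_rows rs (i, k)"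
  by (auto simp: filling_of_rows_def)

lemma butlast_eq_Nil: "butlast us = [] \<longleftrightarrow> length us \<le> 1"
  by (cases us rule: rev_cases) auto

text \<open>A reverse tableau is the insertion tableau of its column word: the last entries of the
  columns form the first row, and the remaining entries of the columns are inserted into the
  rows below.\<close>

lemma insertion_columns:
  assumes "\<forall>us\<in>set cols. us \<noteq> [] \<and> sorted_wrt (<) us" "sorted_wrt column_before cols"
  shows "filling_of_rows (fold insert_letter (concat cols) []) (i, k) =
     (if k < length cols \<and> i < length (cols ! k) then rev (cols ! k) ! i else 0)"
  using assms
proof (induction "length (concat cols)" arbitrary: cols i rule: less_induct)
  case less
  show ?case
  proof (cases "cols = []")
    case True
    then show ?thesis by (simp add: filling_of_rows_def)
  next
    case False
    \<comment> \<open>The heights of the columns decrease weakly, so the columns that survive form an initial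
      segment.\<close>
    define cols' where "cols' = takeWhile (\<lambda>us. us \<noteq> []) (map butlast cols)"
    have last: "sorted_wrt (\<lambda>u v. last v < last u) cols"
      using less.prems(2)
    proof (rule sorted_wrt_mono_rel[rotated])
      fix u v assume "u \<in> set cols" "v \<in> set cols" "column_before u v"
      then show "last v < last u" using less.prems(1)
        by (auto simp: column_before_def dominates_def last_conv_nth rev_nth dest!: spec[of _ 0])
    qed
    have rw: "row_word (concat cols) [] = (map last cols, concat (map butlast cols))"
      using row_word_columns[of cols "[]"] last less.prems(1) by auto
    have mono: "length (cols ! l) \<le> length (cols ! k)" if "k \<le> l" "l < length cols" for k l
      using less.prems(2) that
      by (cases "k = l") (auto simp: sorted_wrt_iff_nth_less column_before_def dominates_def)
    have drop: "\<forall>us\<in>set (dropWhile (\<lambda>us. us \<noteq> []) (map butlast cols)). us = []"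
    proof (intro ballI)
      define m where "m = length cols'"
      fix us assume "us \<in> set (dropWhile (\<lambda>us. us \<noteq> []) (map butlast cols))"
      then obtain j where j: "j < length cols - m" "us = butlast (cols ! (m + j))"
        unfolding dropWhile_eq_drop cols'_def[symmetric] m_def[symmetric] by (auto simp: in_set_conv_nth)
      then have "m < length (map butlast cols)" by auto
      then have "butlast (cols ! m) = []"
        unfolding m_def cols'_def using nth_length_takeWhile[of "\<lambda>us. us \<noteq> []" "map butlast cols"] by auto
      moreover have "length (cols ! (m + j)) \<le> length (cols ! m)" using j by (intro mono) auto
      ultimately show "us = []" using j by (simp add: butlast_eq_Nil)
    qed
    have conc: "concat cols' = concat (map butlast cols)"
    proof -
      have "concat (dropWhile (\<lambda>us. us \<noteq> []) (map butlast cols)) = []"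
        using drop by (simp only: concat_eq_Nil_conv)
      moreover have "concat (map butlast cols) =
          concat cols' @ concat (dropWhile (\<lambda>us. us \<noteq> []) (map butlast cols))"
        unfolding cols'_def by (simp only: concat_append[symmetric] takeWhile_dropWhile_id)
      ultimately show ?thesis by (metis append_Nil2)
    qed
    have len': "k < length cols' \<longleftrightarrow> k < length cols \<and> 1 < length (cols ! k)" for k
    proof
      assume k: "k < length cols'"
      then have "cols' ! k \<noteq> []" 
        using nth_mem[OF k] set_takeWhileD[of "cols' ! k" "\<lambda>us. us \<noteq> []" "map butlast cols"]
        unfolding cols'_def by blast
      moreover have "k < length cols" using k length_takeWhile_le[of _ "map butlast cols"] unfolding cols'_def by (metis length_map order_less_le_trans)
      ultimately show "k < length cols \<and> 1 < length (cols ! k)"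
        using k unfolding cols'_def by (simp add: takeWhile_nth butlast_eq_Nil)
    next
      assume k: "k < length cols \<and> 1 < length (cols ! k)"
      show "k < length cols'"
      proof (rule ccontr)
        assume n: "\<not> k < length cols'"
        then have "map butlast cols ! length cols' = []"
          unfolding cols'_def using k nth_length_takeWhile[of "\<lambda>us. us \<noteq> []" "map butlast cols"] by auto
        then show False using n k mono[of "length cols'" k]
          by (auto simp: butlast_eq_Nil)
      qed
    qed
    have nth': "k < length cols' \<Longrightarrow> cols' ! k = butlast (cols ! k)" for k
      using len'[of k] unfolding cols'_def by (simp add: takeWhile_nth)
    have IH: "filling_of_rows (fold insert_letter (concat cols') []) (i, k) =
      (if k < length cols' \<and> i < length (cols' ! k) then rev (cols' ! k) ! i else 0)" for i
    proof (rule less.hyps)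
      have "length (concat (map butlast cols)) < length (concat cols)"
        using bumped_shorter[of "concat cols"] rw False less.prems(1) by (cases cols) auto
      then show "length (concat cols') < length (concat cols)" using conc by simp
      show "\<forall>us\<in>set cols'. us \<noteq> [] \<and> sorted_wrt (<) us"
      proof (intro ballI)
        fix us assume "us \<in> set cols'"
        then obtain j where j: "j < length cols'" "us = butlast (cols ! j)" using nth' by (metis in_set_conv_nth)
        then have "1 < length (cols ! j)" "cols ! j \<in> set cols" using len'[of j] by auto
        then show "us \<noteq> [] \<and> sorted_wrt (<) us" using less.prems(1) j(2)
          by (simp add: butlast_eq_Nil) (simp add: butlast_conv_take sorted_wrt_take)
      qed
      show "sorted_wrt column_before cols'"
        unfolding sorted_wrt_iff_nth_less
      proof (intro allI impI)
        fix a b assume ab: "a < b" "b < length cols'"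
        then have "column_before (cols ! a) (cols ! b)" using less.prems(2) len'[of b] by (auto simp: sorted_wrt_iff_nth_less)
        then show "column_before (cols' ! a) (cols' ! b)"
          using ab by (auto simp: nth' column_before_def dominates_def rev_nth nth_butlast)
      qed
    qed
    have ne: "concat cols \<noteq> []" using False less.prems(1) by (cases cols) auto
    have P: "fold insert_letter (concat cols) [] = map last cols # fold insert_letter (concat cols') []"
      using fold_insert_Nil[OF ne] rw conc by simp
    show ?thesis
    proof (cases i)
      case 0
      then show ?thesis using P less.prems(1) by (auto simp: filling_of_rows_Cons rev_nth last_conv_nth)
    next
      case (Suc j)
      then show ?thesis using P IH[of j] len'[of k] nth'[of k]
        by (auto simp: filling_of_rows_Cons rev_nth nth_butlast)
    qed
  qed
qed

section \<open>Words of columns and their reading words\<close>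

lemma sorted_wrt_unique:
  assumes "sorted_wrt R xs" "sorted_wrt R ys" "set xs = set ys" "\<And>x y. R x y \<Longrightarrow> \<not> R y x"
  shows "xs = ys"
  using assms(1-3)
proof (induction xs arbitrary: ys)
  case (Cons x xs)
  have irr: "\<not> R z z" for z using assms(4) by blast
  obtain y ys' where ys: "ys = y # ys'" using Cons.prems by (cases ys) auto
  have "x = y" using Cons.prems ys assms(4) by (metis list.set_intros(1) set_ConsD sorted_wrt.simps(2))
  moreover have "x \<notin> set xs" "y \<notin> set ys'" using Cons.prems ys irr by auto
  ultimately have "set xs = set ys'" using Cons.prems ys by auto
  then show ?case using Cons.IH[of ys'] Cons.prems ys \<open>x = y\<close> by auto
qed simp

text \<open>A standard filling is represented by the word \<open>e\<close> of the columns of its entries: the entry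
  \<open>i + 1\<close> lies in column \<open>e ! i\<close>.\<close>

definition col_values :: "nat list \<Rightarrow> nat \<Rightarrow> nat list" where
  "col_values e k = map Suc (filter (\<lambda>i. e ! i = k) [0..<length e])"

text \<open>The column word of the filling that is represented by \<open>e\<close>.\<close>

definition reading :: "nat list \<Rightarrow> nat list" where
  "reading e = concat (map (col_values e) (sorted_list_of_set (set e)))"

text \<open>The order in which the column word lists the entries \<open>u\<close> and \<open>v\<close>. A reading word is
  determined by being sorted in this way (\<open>reading_unique\<close>).\<close>

definition earlier :: "nat list \<Rightarrow> nat \<Rightarrow> nat \<Rightarrow> bool" where
  "earlier e u v \<longleftrightarrow> e ! (u - 1) < e ! (v - 1) \<or> e ! (u - 1) = e ! (v - 1) \<and> u < v"

lemma earlier_asym: "earlier e u v \<Longrightarrow> \<not> earlier e v u"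
  by (auto simp: earlier_def)

lemma set_col_values: "set (col_values e k) = {v. 1 \<le> v \<and> v \<le> length e \<and> e ! (v - 1) = k}"
proof -
  have "v \<in> Suc ` {i. i < length e \<and> e ! i = k}" if "1 \<le> v" "v \<le> length e" "e ! (v - 1) = k" for v
    using that by (intro image_eqI[of _ _ "v - 1"]) auto
  then show ?thesis by (auto simp: col_values_def)
qed

lemma sorted_col_values: "sorted_wrt (<) (col_values e k)"
  unfolding col_values_def sorted_wrt_map by (simp add: sorted_wrt_filter)

lemma set_reading: "set (reading e) = {1..length e}"
  unfolding reading_def by (auto simp: set_col_values in_set_conv_nth)
    (metis One_nat_def Suc_pred less_Suc_eq_le not_less_eq_eq Suc_le_lessD)

lemma sorted_wrt_concat_map:
  assumes "sorted_wrt (<) ks" "\<And>k. k \<in> set ks \<Longrightarrow> sorted_wrt R (f k)"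
    "\<And>k l x y. k < l \<Longrightarrow> x \<in> set (f k) \<Longrightarrow> y \<in> set (f l) \<Longrightarrow> R x y"
  shows "sorted_wrt R (concat (map f ks))"
  using assms(1,2) by (induction ks) (auto simp: sorted_wrt_append intro: assms(3))

lemma sorted_reading: "sorted_wrt (earlier e) (reading e)"
  unfolding reading_def
proof (rule sorted_wrt_concat_map)
  show "sorted_wrt (<) (sorted_list_of_set (set e))"
    by (rule strict_sorted_list_of_set)
  fix k
  show "sorted_wrt (earlier e) (col_values e k)"
    by (rule sorted_wrt_mono_rel[OF _ sorted_col_values]) (auto simp: earlier_def set_col_values)
qed (auto simp: set_col_values earlier_def)

lemma reading_unique:
  "sorted_wrt (earlier e) w \<Longrightarrow> set w = {1..length e} \<Longrightarrow> w = reading e"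
  by (rule sorted_wrt_unique[OF _ sorted_reading]) (auto simp: set_reading dest: earlier_asym)

lemma reading_filter:
  "sorted_wrt (earlier e) w \<Longrightarrow> set w = {v \<in> {1..length e}. Q v} \<Longrightarrow> filter Q (reading e) = w"
  by (rule sorted_wrt_unique[OF sorted_wrt_filter[OF sorted_reading]])
     (auto simp: set_reading dest: earlier_asym)

lemma distinct_reading: "distinct (reading e)"
proof -
  have "sorted_wrt (earlier e) w \<Longrightarrow> distinct w" for w
    by (induction w) (auto dest: earlier_asym)
  then show ?thesis using sorted_reading by blast
qed

lemma length_reading: "length (reading e) = length e"
  using distinct_card[OF distinct_reading[of e]] by (simp add: set_reading)

lemma reading_snoc: "filter (\<lambda>v. v \<le> length e) (reading (e @ [y])) = reading e"
proof (rule reading_filter)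
  show "sorted_wrt (earlier (e @ [y])) (reading e)"
    by (rule sorted_wrt_mono_rel[OF _ sorted_reading]) (auto simp: set_reading earlier_def nth_append)
qed (auto simp: set_reading)

section \<open>Elementary moves are dual Knuth moves\<close>

definition swap_values :: "nat \<Rightarrow> nat \<Rightarrow> nat" where
  "swap_values v x = (if x = v then Suc v else if x = Suc v then v else x)"

text \<open>The dual Knuth move on the values \<open>v\<close>, \<open>v + 1\<close> and \<open>v + 2\<close>. If these occur in a monotone
  order, nothing happens; otherwise the two values that are exchanged are consecutive ones that
  have the third between them.\<close>

definition dual_move :: "nat \<Rightarrow> nat list \<Rightarrow> nat list" where
  "dual_move v w =
     (let p = filter (\<lambda>x. x \<in> {v, v + 1, v + 2}) w in
      if p = [v, v + 2, v + 1] \<or> p = [v + 1, v + 2, v] then map (swap_values v) w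
      else if p = [v + 1, v, v + 2] \<or> p = [v + 2, v, v + 1] then map (swap_values (v + 1)) w
      else w)"

text \<open>The Knuth move on the letters at \<open>i\<close>, \<open>i + 1\<close> and \<open>i + 2\<close>. Letters may be equal, and equal
  letters count as increasing.\<close>

definition elem_move :: "nat \<Rightarrow> nat list \<Rightarrow> nat list" where
  "elem_move i e =
     (if i + 2 < length e then
        let p = e ! i; q = e ! (i + 1); r = e ! (i + 2) in
        if p \<le> q \<longleftrightarrow> q \<le> r then e
        else if p \<le> r \<and> r < q \<or> q \<le> r \<and> r < p then e[i := q, i + 1 := p]
        else e[i + 1 := r, i + 2 := q]
      else e)"

lemma length_elem_move [simp]: "length (elem_move i e) = length e"
  by (simp add: elem_move_def Let_def)

lemma elem_move_context:
  "i + 2 < length e \<Longrightarrow> elem_move (length a + i) (a @ e @ b) = a @ elem_move i e @ b"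
  by (auto simp: elem_move_def Let_def nth_append list_update_append add.assoc[symmetric])

lemma three_split:
  assumes "i + 2 < length e"
  obtains a p q r b where "e = a @ [p, q, r] @ b" "length a = i"
proof -
  have "e = take i e @ [e ! i, e ! (i + 1), e ! (i + 2)] @ drop (i + 3) e"
    using assms by (simp add: Cons_nth_drop_Suc numeral_3_eq_3)
  then show ?thesis using that[of "take i e"] assms by simp
qed

definition move3 :: "nat \<Rightarrow> nat \<Rightarrow> nat \<Rightarrow> nat list" where
  "move3 p q r =
     (if p \<le> q \<longleftrightarrow> q \<le> r then [p, q, r]
      else if p \<le> r \<and> r < q \<or> q \<le> r \<and> r < p then [q, p, r] else [p, r, q])"

text \<open>The six relative orders of three letters, equal ones counting as increasing: the two
  monotone ones, then the two for which a Knuth move exchanges the first two letters, then those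
  for which it exchanges the last two.\<close>

lemma three_orders:
  fixes p q r :: nat
  obtains "p \<le> q" "q \<le> r" | "q < p" "r < q" | "p \<le> r" "r < q" | "q \<le> r" "r < p"
    | "r < p" "p \<le> q" | "q < p" "p \<le> r"
  by (cases "p \<le> q"; cases "q \<le> r"; cases "p \<le> r") (simp_all add: not_le)

lemma elem_move_three: "elem_move (length a) (a @ [p, q, r] @ b) = a @ move3 p q r @ b"
proof -
  have "elem_move 0 [p, q, r] = move3 p q r" by (simp add: elem_move_def move3_def Let_def)
  then show ?thesis using elem_move_context[of 0 "[p, q, r]" a b] by simp
qed

lemma move3_cases:
  obtains (fixed) "move3 p q r = [p, q, r]"
  | (swap_left) "move3 p q r = [q, p, r]" "move3 q p r = [p, q, r]"
  | (swap_right) "move3 p q r = [p, r, q]" "move3 p r q = [p, q, r]"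
proof (rule three_orders[of p q r])
  assume "p \<le> q" "q \<le> r"
  then show thesis by (intro fixed) (simp add: move3_def)
next
  assume "q < p" "r < q"
  then show thesis by (intro fixed) (simp add: move3_def)
next
  assume "p \<le> r" "r < q"
  then show thesis by (intro swap_left) (simp_all add: move3_def)
next
  assume "q \<le> r" "r < p"
  then show thesis by (intro swap_left) (simp_all add: move3_def)
next
  assume "r < p" "p \<le> q"
  then show thesis by (intro swap_right) (simp_all add: move3_def)
next
  assume "q < p" "p \<le> r"
  then show thesis by (intro swap_right) (simp_all add: move3_def)
qed

lemma elem_move_involution [simp]: "elem_move i (elem_move i e) = e"
proof (cases "i + 2 < length e")
  case True
  then obtain a p q r b where e: "e = a @ [p, q, r] @ b" "length a = i" by (rule three_split)
  show ?thesis
    by (rule move3_cases[of p q r]) (simp_all only: e(1) e(2)[symmetric] elem_move_three)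
qed (simp add: elem_move_def)

lemma elem_move_mset: "mset (elem_move i e) = mset e"
proof (cases "i + 2 < length e")
  case True
  then obtain a p q r b where e: "e = a @ [p, q, r] @ b" "length a = i" by (rule three_split)
  show ?thesis
    by (rule move3_cases[of p q r]) (simp_all add: e(1) e(2)[symmetric] elem_move_three[simplified])
qed (simp add: elem_move_def)

text \<open>Exchanging two different adjacent letters of \<open>e\<close> exchanges two consecutive entries of the
  filling; these lie in different columns, so that the columns remain sorted.\<close>

lemma reading_swap:
  assumes "Suc j < length e" "e ! j \<noteq> e ! Suc j"
  shows "reading (e[j := e ! Suc j, Suc j := e ! j]) = map (swap_values (Suc j)) (reading e)"
proof (rule sym, rule reading_unique)
  let ?e = "e[j := e ! Suc j, Suc j := e ! j]"
  have sw: "?e ! (swap_values (Suc j) v - 1) = e ! (v - 1)" if "v \<in> {1..length e}" for v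
    using that assms by (cases v) (auto simp: swap_values_def nth_list_update)
  show "sorted_wrt (earlier ?e) (map (swap_values (Suc j)) (reading e))"
    unfolding sorted_wrt_map
  proof (rule sorted_wrt_mono_rel[OF _ sorted_reading])
    fix u v assume uv: "u \<in> set (reading e)" "v \<in> set (reading e)" "earlier e u v"
    have "swap_values (Suc j) u < swap_values (Suc j) v" if "u < v" "e ! (u - 1) = e ! (v - 1)"
      using that assms by (auto simp: swap_values_def)
    then show "earlier ?e (swap_values (Suc j) u) (swap_values (Suc j) v)"
      using uv sw[of u] sw[of v] by (auto simp: earlier_def set_reading)
  qed
  have "swap_values (Suc j) ` {1..length e} = {1..length e}"
    using assms by (force simp: swap_values_def image_iff)
  then show "set (map (swap_values (Suc j)) (reading e)) = {1..length ?e}"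
    by (simp add: set_reading)
qed

text \<open>Equal letters count as increasing, and in a column the smaller entry is read first. So the
  relative order of three adjacent letters is the order in which the corresponding entries are
  read, and this order is all that either move depends on.\<close>

lemma reading_elem_move:
  assumes "i + 2 < length e"
  shows "reading (elem_move i e) = dual_move (Suc i) (reading e)"
proof -
  define p q r where pqr: "p = e ! i" "q = e ! Suc i" "r = e ! Suc (Suc i)"
  let ?v = "Suc i"
  let ?F = "filter (\<lambda>x. x \<in> {?v, ?v + 1, ?v + 2}) (reading e)"
  have pat: "?F = w" if "sorted_wrt (earlier e) w" "set w = {?v, ?v + 1, ?v + 2}" for w
  proof (rule reading_filter[OF that(1)])
    have "v \<in> {1..length e}" if "v \<in> {?v, ?v + 1, ?v + 2}" for v using that assms by auto
    then show "set w = {v \<in> {1..length e}. v \<in> {?v, ?v + 1, ?v + 2}}" unfolding that(2) by blast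
  qed
  have ear: "earlier e ?v (?v + 1) \<longleftrightarrow> p \<le> q" "earlier e (?v + 1) ?v \<longleftrightarrow> q < p"
    "earlier e (?v + 1) (?v + 2) \<longleftrightarrow> q \<le> r" "earlier e (?v + 2) (?v + 1) \<longleftrightarrow> r < q"
    "earlier e ?v (?v + 2) \<longleftrightarrow> p \<le> r" "earlier e (?v + 2) ?v \<longleftrightarrow> r < p"
    by (auto simp: earlier_def pqr)
  have s1: "p \<noteq> q \<Longrightarrow> reading (e[i := q, Suc i := p]) = map (swap_values ?v) (reading e)"
    using reading_swap[of i e] assms pqr by simp
  have s2: "q \<noteq> r \<Longrightarrow> reading (e[Suc i := r, Suc (Suc i) := q]) = map (swap_values (?v + 1)) (reading e)"
    using reading_swap[of "Suc i" e] assms pqr by simp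
  have em: "elem_move i e = (if p \<le> q \<longleftrightarrow> q \<le> r then e
      else if p \<le> r \<and> r < q \<or> q \<le> r \<and> r < p then e[i := q, Suc i := p]
      else e[Suc i := r, Suc (Suc i) := q])"
    unfolding elem_move_def Let_def pqr using assms by simp
  show ?thesis
  proof (rule three_orders[of p q r])
    assume c: "p \<le> q" "q \<le> r"
    have F: "?F = [?v, ?v + 1, ?v + 2]" by (rule pat) (use c in \<open>auto simp only: sorted_wrt.simps list.set ear\<close>)
    have "elem_move i e = e" unfolding em using c by simp
    then show ?thesis using c unfolding dual_move_def Let_def F by simp
  next
    assume c: "q < p" "r < q"
    have F: "?F = [?v + 2, ?v + 1, ?v]" by (rule pat) (use c in \<open>auto simp only: sorted_wrt.simps list.set ear\<close>)
    have "elem_move i e = e" unfolding em using c by simp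
    then show ?thesis using c unfolding dual_move_def Let_def F by simp
  next
    assume c: "p \<le> r" "r < q"
    have F: "?F = [?v, ?v + 2, ?v + 1]" by (rule pat) (use c in \<open>auto simp only: sorted_wrt.simps list.set ear\<close>)
    have "elem_move i e = e[i := q, Suc i := p]" unfolding em using c by simp
    then show ?thesis using s1 c unfolding dual_move_def Let_def F by simp
  next
    assume c: "q \<le> r" "r < p"
    have F: "?F = [?v + 1, ?v + 2, ?v]" by (rule pat) (use c in \<open>auto simp only: sorted_wrt.simps list.set ear\<close>)
    have "elem_move i e = e[i := q, Suc i := p]" unfolding em using c by simp
    then show ?thesis using s1 c unfolding dual_move_def Let_def F by simp
  next
    assume c: "r < p" "p \<le> q"
    have F: "?F = [?v + 2, ?v, ?v + 1]" by (rule pat) (use c in \<open>auto simp only: sorted_wrt.simps list.set ear\<close>)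
    have "elem_move i e = e[Suc i := r, Suc (Suc i) := q]" unfolding em using c by simp
    then show ?thesis using s2 c unfolding dual_move_def Let_def F by simp
  next
    assume c: "q < p" "p \<le> r"
    have F: "?F = [?v + 1, ?v, ?v + 2]" by (rule pat) (use c in \<open>auto simp only: sorted_wrt.simps list.set ear\<close>)
    have "elem_move i e = e[Suc i := r, Suc (Suc i) := q]" unfolding em using c by simp
    then show ?thesis using s2 c unfolding dual_move_def Let_def F by simp
  qed
qed

lemma knuth_left: "x < y \<Longrightarrow> y < z \<Longrightarrow> knuth (a @ [y, x, z] @ b) (a @ [y, z, x] @ b)"
  by (rule knuth1_knuth[OF knuth1.left])

lemma knuth_right: "x < y \<Longrightarrow> y < z \<Longrightarrow> knuth (a @ [x, z, y] @ b) (a @ [z, x, y] @ b)"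
  by (rule knuth1_knuth[OF knuth1.right])

lemma swap_values_mono:
  "x < y \<Longrightarrow> \<not> (x = t \<and> y = Suc t) \<Longrightarrow> swap_values t x < swap_values t y"
  by (auto simp: swap_values_def)

lemma filter_swap_id: "filter (\<lambda>x. x \<in> {m, m + 1, m + 2}) a = [] \<Longrightarrow> t \<in> {m, m + 1} \<Longrightarrow> map (swap_values t) a = a"
  by (rule map_idI) (auto simp: swap_values_def filter_empty_conv)

text \<open>If the Knuth relation involves all of \<open>m\<close>, \<open>m + 1\<close> and \<open>m + 2\<close>, the dual move carries it
  to the other Knuth relation. Otherwise the three values occur in the same order on both sides,
  and the exchange of two values preserves the inequalities between the letters of the
  relation.\<close>

lemma dual_move_knuth1:
  assumes "knuth1 v w" "distinct v"
  shows "knuth (dual_move m v) (dual_move m w)"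
proof -
  let ?F = "filter (\<lambda>x. x \<in> {m, m + 1, m + 2})"
  have same: "knuth (dual_move m v) (dual_move m w)"
    if F: "?F v = ?F w" 
      and ids: "knuth v w"
      and sw: "\<And>t. t \<in> {m, m + 1} \<Longrightarrow>
        (t = m \<Longrightarrow> ?F v = [m, m + 2, m + 1] \<or> ?F v = [m + 1, m + 2, m]) \<Longrightarrow>
        (t = m + 1 \<Longrightarrow> ?F v = [m + 1, m, m + 2] \<or> ?F v = [m + 2, m, m + 1]) \<Longrightarrow>
        knuth (map (swap_values t) v) (map (swap_values t) w)"
    using F ids sw[of m] sw[of "m + 1"] unfolding dual_move_def Let_def by auto
  show ?thesis using assms(1)
  proof cases
    case (left x y z a b)
    show ?thesis
    proof (cases "x \<in> {m, m + 1, m + 2} \<and> z \<in> {m, m + 1, m + 2}")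
      case True
      then have xyz: "x = m" "y = m + 1" "z = m + 2" using left by auto
      have ab: "?F a = []" "?F b = []" using assms(2) left xyz by (auto simp: filter_empty_conv)
      have "dual_move m v = a @ [m + 2, m, m + 1] @ b" "dual_move m w = a @ [m, m + 2, m + 1] @ b"
        using ab left xyz filter_swap_id[OF ab(1)] filter_swap_id[OF ab(2)]
        by (auto simp: dual_move_def Let_def swap_values_def)
      then show ?thesis using knuth_right[of m "m + 1" "m + 2" a b] knuth_sym by simp
    next
      case False
      show ?thesis
      proof (rule same)
        show F: "?F v = ?F w" using False left by auto
        show "knuth v w" using assms(1) by (rule knuth1_knuth)
        fix t assume t: "t \<in> {m, m + 1}"
          "t = m \<Longrightarrow> ?F v = [m, m + 2, m + 1] \<or> ?F v = [m + 1, m + 2, m]"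
          "t = m + 1 \<Longrightarrow> ?F v = [m + 1, m, m + 2] \<or> ?F v = [m + 2, m, m + 1]"
        \<comment> \<open>In the order that makes the move exchange \<open>t\<close> and \<open>t + 1\<close>, the third value stands
          between them, whereas \<open>x\<close> and \<open>y\<close> are adjacent.\<close>
        have 1: "\<not> (x = t \<and> y = Suc t)"
        proof
          assume "x = t \<and> y = Suc t"
          moreover from this have "?F v = ?F a @ [y, x] @ ?F b" using False t(1) left by auto
          ultimately show False using t by (auto simp: append_eq_Cons_conv Cons_eq_append_conv)
        qed
        have 2: "\<not> (y = t \<and> z = Suc t)"
        proof
          assume "y = t \<and> z = Suc t"
          moreover from this have "?F v = ?F a @ [y, z] @ ?F b" using False t(1) left by auto
          ultimately show False using t by (auto simp: append_eq_Cons_conv Cons_eq_append_conv)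
        qed
        show "knuth (map (swap_values t) v) (map (swap_values t) w)"
          using knuth_left[OF swap_values_mono[OF left(3) 1] swap_values_mono[OF left(4) 2],
              of "map (swap_values t) a" "map (swap_values t) b"] left(1,2) by simp
      qed
    qed
  next
    case (right x y z a b)
    show ?thesis
    proof (cases "x \<in> {m, m + 1, m + 2} \<and> z \<in> {m, m + 1, m + 2}")
      case True
      then have xyz: "x = m" "y = m + 1" "z = m + 2" using right by auto
      have ab: "?F a = []" "?F b = []" using assms(2) right xyz by (auto simp: filter_empty_conv)
      have "dual_move m v = a @ [m + 1, m + 2, m] @ b" "dual_move m w = a @ [m + 1, m, m + 2] @ b"
        using ab right xyz filter_swap_id[OF ab(1)] filter_swap_id[OF ab(2)]
        by (auto simp: dual_move_def Let_def swap_values_def)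
      then show ?thesis using knuth_left[of m "m + 1" "m + 2" a b] knuth_sym by simp
    next
      case False
      show ?thesis
      proof (rule same)
        show F: "?F v = ?F w" using False right by auto
        show "knuth v w" using assms(1) by (rule knuth1_knuth)
        fix t assume t: "t \<in> {m, m + 1}"
          "t = m \<Longrightarrow> ?F v = [m, m + 2, m + 1] \<or> ?F v = [m + 1, m + 2, m]"
          "t = m + 1 \<Longrightarrow> ?F v = [m + 1, m, m + 2] \<or> ?F v = [m + 2, m, m + 1]"
        have 1: "\<not> (x = t \<and> y = Suc t)"
        proof
          assume "x = t \<and> y = Suc t"
          moreover from this have "?F v = ?F a @ [x, y] @ ?F b" using False t(1) right by auto
          ultimately show False using t by (auto simp: append_eq_Cons_conv Cons_eq_append_conv)
        qed
        have 2: "\<not> (y = t \<and> z = Suc t)"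
        proof
          assume "y = t \<and> z = Suc t"
          moreover from this have "?F v = ?F a @ [z, y] @ ?F b" using False t(1) right by auto
          ultimately show False using t by (auto simp: append_eq_Cons_conv Cons_eq_append_conv)
        qed
        show "knuth (map (swap_values t) v) (map (swap_values t) w)"
          using knuth_right[OF swap_values_mono[OF right(3) 1] swap_values_mono[OF right(4) 2],
              of "map (swap_values t) a" "map (swap_values t) b"] right(1,2) by simp
      qed
    qed
  qed
qed

lemma dual_move_knuth:
  "knuth v w \<Longrightarrow> distinct v \<Longrightarrow> knuth (dual_move m v) (dual_move m w)"
proof (induction rule: knuth_induct)
  case (step u w)
  then show ?case using dual_move_knuth1 knuth_trans knuth_distinct by blast
next
  case (inv u w)
  then have "distinct w" using knuth_distinct knuth1_knuth knuth_sym by blast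
  then show ?case using inv dual_move_knuth1 knuth_trans knuth_sym by blast
qed (rule knuth_refl)

text \<open>If a triple loses its largest letter, the two sides become equal, and if it loses more,
  too.\<close>

lemma knuth1_filter:
  "knuth1 v w \<Longrightarrow> knuth (filter (\<lambda>v. v \<le> (n::nat)) v) (filter (\<lambda>v. v \<le> n) w)"
proof (induction rule: knuth1.induct)
  case (left x y z a b)
  then show ?case
    by (cases "z \<le> n") (auto simp: knuth_refl intro: knuth_left[simplified])
next
  case (right x y z a b)
  then show ?case
    by (cases "z \<le> n") (auto simp: knuth_refl intro: knuth_right[simplified])
qed

lemma knuth_filter: "knuth v w \<Longrightarrow> knuth (filter (\<lambda>v. v \<le> (n::nat)) v) (filter (\<lambda>v. v \<le> n) w)"
proof (induction rule: knuth_induct)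
  case (step u w)
  then show ?case using knuth1_filter knuth_trans by blast
next
  case (inv u w)
  then show ?case using knuth1_filter knuth_trans knuth_sym by blast
qed (rule knuth_refl)

text \<open>By \<open>knuth_iff_insertion\<close> this means that the fillings represented by \<open>d\<close> and \<open>e\<close> have the
  same rectification.\<close>

definition same_rect :: "nat list \<Rightarrow> nat list \<Rightarrow> bool" where
  "same_rect d e \<longleftrightarrow> knuth (reading d) (reading e)"

lemma same_rect_refl: "same_rect e e" and same_rect_sym: "same_rect d e \<Longrightarrow> same_rect e d"
  and same_rect_trans: "same_rect c d \<Longrightarrow> same_rect d e \<Longrightarrow> same_rect c e"
  unfolding same_rect_def by (rule knuth_refl, erule knuth_sym, erule (1) knuth_trans)

lemma same_rect_length: "same_rect d e \<Longrightarrow> length d = length e"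
  unfolding same_rect_def by (metis knuth_mset length_reading size_mset)

lemma same_rect_elem_move:
  assumes "same_rect d e" shows "same_rect (elem_move i d) (elem_move i e)"
proof (cases "i + 2 < length d")
  case True
  then show ?thesis
    using assms same_rect_length[OF assms] dual_move_knuth[OF _ distinct_reading]
    by (simp add: same_rect_def reading_elem_move)
next
  case False
  then show ?thesis using assms same_rect_length[OF assms] by (simp add: elem_move_def)
qed

text \<open>Appending a letter adds a new largest entry, and Knuth equivalence survives the deletion
  of the largest letter.\<close>

lemma same_rect_snoc: "same_rect (d @ [y]) (e @ [z]) \<Longrightarrow> same_rect d e"
  using knuth_filter[of "reading (d @ [y])" "reading (e @ [z])" "length d"] same_rect_length[of "d @ [y]" "e @ [z]"]
  unfolding same_rect_def by (metis length_append_singleton nat.inject reading_snoc same_rect_def same_rect_length)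

section \<open>Growing compositions and straight words\<close>

fun grow :: "nat \<Rightarrow> nat list \<Rightarrow> nat list option" where
  "grow k [] = None"
| "grow k (a # \<alpha>) = (if a = k then Some (Suc k # \<alpha>) else map_option ((#) a) (grow k \<alpha>))"

text \<open>The growth of a composition when a new smallest entry is placed in column \<open>k\<close>, the columns
  being numbered from 0: there is only one row in which it can be placed (\<open>bottom_ssct_add\<close>,
  \<open>bottom_ssct_remove\<close>).\<close>

definition add_cell :: "nat \<Rightarrow> nat list \<Rightarrow> nat list option" where
  "add_cell k \<alpha> = (if k = 0 then Some (1 # \<alpha>) else grow k \<alpha>)"

text \<open>The largest entry comes first, and it corresponds to the last letter.\<close>

fun run :: "nat list \<Rightarrow> nat list \<Rightarrow> nat list option" where
  "run [] \<beta> = Some \<beta>"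
| "run (k # e) \<beta> = Option.bind (run e \<beta>) (add_cell k)"

lemma run_append: "run (d @ e) \<beta> = Option.bind (run e \<beta>) (run d)"
  by (induction d) (auto split: Option.bind_split)

lemma grow_None: "grow k \<alpha> = None \<longleftrightarrow> k \<notin> set \<alpha>"
  by (induction \<alpha>) auto

lemma grow_mset: "grow k \<alpha> = Some \<alpha>' \<Longrightarrow> k \<in> set \<alpha> \<and> add_mset k (mset \<alpha>') = add_mset (Suc k) (mset \<alpha>)"
  by (induction \<alpha> arbitrary: \<alpha>') (auto split: if_splits simp: add_mset_commute)

lemma add_cell_Comp: "add_cell k \<alpha> = Some \<alpha>' \<Longrightarrow> \<alpha> \<in> Comp \<Longrightarrow> \<alpha>' \<in> Comp"
proof (cases "k = 0")
  case False
  assume "add_cell k \<alpha> = Some \<alpha>'" "\<alpha> \<in> Comp"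
  then have "add_mset k (mset \<alpha>') = add_mset (Suc k) (mset \<alpha>)" "\<forall>a\<in>set \<alpha>. 0 < a"
    using False grow_mset by (auto simp: add_cell_def Comp_def)
  then have "\<forall>a\<in># add_mset k (mset \<alpha>'). 0 < a" using False by simp
  then show ?thesis by (simp add: Comp_def)
qed (auto simp: add_cell_def Comp_def)

lemma run_Comp: "run e \<beta> = Some \<gamma> \<Longrightarrow> \<beta> \<in> Comp \<Longrightarrow> \<gamma> \<in> Comp"
proof (induction e arbitrary: \<gamma>)
  case (Cons k e)
  then show ?case using add_cell_Comp by (auto split: Option.bind_splits)
qed simp

lemma add_cell_sum: "add_cell k \<alpha> = Some \<alpha>' \<Longrightarrow> sum_list \<alpha>' = Suc (sum_list \<alpha>) \<and> k \<le> sum_list \<alpha>"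
proof (cases "k = 0")
  case False
  assume "add_cell k \<alpha> = Some \<alpha>'"
  then have *: "add_mset k (mset \<alpha>') = add_mset (Suc k) (mset \<alpha>)" "k \<in> set \<alpha>"
    using False grow_mset by (auto simp: add_cell_def)
  from arg_cong[OF *(1), of sum_mset] show ?thesis
    using member_le_sum_list[OF *(2)] by (simp add: sum_mset_sum_list)
qed (auto simp: add_cell_def)

lemma run_sum: "run e \<beta> = Some \<gamma> \<Longrightarrow> sum_list \<gamma> = sum_list \<beta> + length e \<and> set e \<subseteq> {..<sum_list \<gamma>}"
proof (induction e arbitrary: \<gamma>)
  case (Cons k e)
  then obtain \<alpha> where \<alpha>: "run e \<beta> = Some \<alpha>" "add_cell k \<alpha> = Some \<gamma>" by (auto split: Option.bind_splits)
  then show ?case using Cons.IH[of \<alpha>] add_cell_sum[of k \<alpha> \<gamma>] by auto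
qed simp

text \<open>The lattice condition: read from the right, the word never puts more cells into column \<open>k\<close>
  than into column \<open>k - 1\<close>.\<close>

fun yamanouchi :: "nat list \<Rightarrow> bool" where
  "yamanouchi [] = True"
| "yamanouchi (k # e) \<longleftrightarrow> yamanouchi e \<and> (k = 0 \<or> count_list e k < count_list e (k - 1))"

lemma length_filter_mset: "length (filter P xs) = size (filter_mset P (mset xs))"
  by (metis mset_filter size_mset)

text \<open>The rows longer than \<open>i\<close> are those that have a cell in column \<open>i\<close>.\<close>

lemma run_count:
  "run e [] = Some \<alpha> \<Longrightarrow> length (filter (\<lambda>a. i < a) \<alpha>) = count_list e i"
proof (induction e arbitrary: \<alpha>)
  case (Cons k e)
  then obtain \<alpha>' where \<alpha>': "run e [] = Some \<alpha>'" "add_cell k \<alpha>' = Some \<alpha>" by (auto split: Option.bind_splits)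
  have "length (filter (\<lambda>a. i < a) \<alpha>) = length (filter (\<lambda>a. i < a) \<alpha>') + (if i = k then 1 else 0)"
  proof (cases "k = 0")
    case False
    then have "add_mset k (mset \<alpha>) = add_mset (Suc k) (mset \<alpha>')"
      using \<alpha>' grow_mset by (auto simp: add_cell_def)
    from arg_cong[OF this, of "\<lambda>M. size (filter_mset (\<lambda>a. i < a) M)"]
    show ?thesis by (cases "i = k") (auto simp: length_filter_mset split: if_splits)
  qed (use \<alpha>' in \<open>auto simp: add_cell_def\<close>)
  then show ?case using Cons.IH[OF \<alpha>'(1)] by simp
qed simp

lemma part_count:
  assumes "run e [] = Some \<alpha>" "0 < k"
  shows "count_list e (k - 1) = count_list e k + count_list \<alpha> k"
proof -
  have "length (filter (\<lambda>a. k - 1 < a) \<alpha>) = length (filter (\<lambda>a. k < a) \<alpha>) + count_list \<alpha> k"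
    using assms(2) by (induction \<alpha>) auto
  then show ?thesis using run_count[OF assms(1)] by simp
qed

lemma part_iff_count:
  assumes "run e [] = Some \<alpha>" "0 < k"
  shows "k \<in> set \<alpha> \<longleftrightarrow> count_list e k < count_list e (k - 1)"
  using part_count[OF assms] count_list_0_iff[of \<alpha> k] by auto

text \<open>There is a row of length \<open>k > 0\<close> iff column \<open>k\<close> has fewer cells than column \<open>k - 1\<close>.\<close>

lemma yamanouchi_iff_run: "yamanouchi e \<longleftrightarrow> run e [] \<noteq> None"
proof (induction e)
  case (Cons k e)
  show ?case
  proof (cases "run e []")
    case (Some \<alpha>)
    then show ?thesis using Cons part_iff_count[OF Some, of k] grow_None[of k \<alpha>]
      by (auto simp: add_cell_def)
  qed (use Cons in auto)
qed simp

lemma count_list_mset_eq: "mset d = mset e \<Longrightarrow> count_list d k = count_list e k"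
  by (metis count_mset)

lemma yamanouchi_append_cong: "mset d = mset e \<Longrightarrow> yamanouchi d = yamanouchi e \<Longrightarrow> yamanouchi (a @ d) = yamanouchi (a @ e)"
proof (induction a)
  case (Cons k a)
  have "mset (a @ d) = mset (a @ e)" using Cons.prems by simp
  then have "count_list (a @ d) j = count_list (a @ e) j" for j by (rule count_list_mset_eq)
  then show ?case using Cons by (simp del: count_list_append)
qed simp

lemma yamanouchi_count: "yamanouchi e \<Longrightarrow> count_list e (Suc i) \<le> count_list e i"
  by (induction e) (auto simp: Suc_le_eq)

text \<open>The order of \<open>p\<close> and \<open>q\<close> matters only for \<open>q = p + 1\<close>. In this case \<open>r = p\<close>, and this
  letter, read before the two, already provides the cell in column \<open>p\<close> that \<open>q\<close> needs.\<close>

lemma yamanouchi_swap_left: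
  assumes "p \<le> r" "r < q" shows "yamanouchi (p # q # r # b) \<longleftrightarrow> yamanouchi (q # p # r # b)"
proof (cases "q = Suc p")
  case True
  then show ?thesis using assms yamanouchi_count[of b p] by auto
next
  case False
  then show ?thesis using assms by auto
qed

lemma yamanouchi_swap_right:
  assumes "r < p" "p \<le> q" shows "yamanouchi (p # q # r # b) \<longleftrightarrow> yamanouchi (p # r # q # b)"
  using assms by (auto split: if_splits)

lemma yamanouchi_move3: "yamanouchi (move3 p q r @ b) \<longleftrightarrow> yamanouchi ([p, q, r] @ b)"
  unfolding move3_def using yamanouchi_swap_left[of p r q b] yamanouchi_swap_left[of q r p b]
    yamanouchi_swap_right[of r p q b] yamanouchi_swap_right[of q p r b] 
  by (auto simp del: yamanouchi.simps)

lemma yamanouchi_elem_move: "yamanouchi (elem_move i e) \<longleftrightarrow> yamanouchi e"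
proof (cases "i + 2 < length e")
  case True
  then obtain a p q r b where e: "e = a @ [p, q, r] @ b" "length a = i" by (rule three_split)
  have "mset (move3 p q r) = mset [p, q, r]" by (simp add: move3_def)
  then have "yamanouchi (a @ move3 p q r @ b) = yamanouchi (a @ [p, q, r] @ b)"
    by (intro yamanouchi_append_cong yamanouchi_move3) simp
  then show ?thesis using e elem_move_three[of a p q r b] by simp
qed (simp add: elem_move_def)

definition moves :: "nat list \<Rightarrow> nat list \<Rightarrow> nat list" where
  "moves s e = fold elem_move s e"

lemma length_moves [simp]: "length (moves s e) = length e"
  by (induction s arbitrary: e) (auto simp: moves_def)

lemma mset_moves [simp]: "mset (moves s e) = mset e"
  by (induction s arbitrary: e) (auto simp: moves_def elem_move_mset)

lemma yamanouchi_moves [simp]: "yamanouchi (moves s e) \<longleftrightarrow> yamanouchi e"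
  by (induction s arbitrary: e) (auto simp: moves_def yamanouchi_elem_move)

lemma moves_rev [simp]: "moves (rev s) (moves s e) = e"
  by (induction s arbitrary: e) (auto simp: moves_def)

lemma same_rect_moves: "same_rect d e \<Longrightarrow> same_rect (moves s d) (moves s e)"
  by (induction s arbitrary: d e) (auto simp: moves_def same_rect_elem_move)

lemma moves_context:
  "\<forall>i\<in>set s. i + 2 < length e \<Longrightarrow> moves (map ((+) (length a)) s) (a @ e @ b) = a @ moves s e @ b"
  by (induction s arbitrary: e) (auto simp: moves_def elem_move_context)

lemma moves_prefix: "\<forall>i\<in>set s. i + 2 < length e \<Longrightarrow> moves s (e @ b) = moves s e @ b"
  using moves_context[of s e "[]" b] by (simp add: map_idI)

text \<open>All moves take place inside the word, so they can also be carried out on any word that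
  contains it (\<open>linked_context\<close>).\<close>

definition linked :: "nat list \<Rightarrow> nat list \<Rightarrow> bool" where
  "linked c d \<longleftrightarrow> (\<exists>s. (\<forall>i\<in>set s. i + 2 < length c) \<and> d = moves s c)"

lemma linked_refl: "linked c c"
  unfolding linked_def by (rule exI[of _ "[]"]) (simp add: moves_def)

lemma linked_trans:
  assumes "linked b c" "linked c d" shows "linked b d"
proof -
  obtain s t where "\<forall>i\<in>set s. i + 2 < length b" "c = moves s b" "\<forall>i\<in>set t. i + 2 < length c" "d = moves t c"
    using assms by (auto simp: linked_def)
  moreover from this have "moves (s @ t) b = d" by (simp add: moves_def)
  ultimately show ?thesis unfolding linked_def by (intro exI[of _ "s @ t"]) auto
qed

lemma linked_sym: "linked c d \<Longrightarrow> linked d c"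
  unfolding linked_def by (metis length_moves moves_rev set_rev)

lemma linked_context: "linked c d \<Longrightarrow> linked (a @ c @ b) (a @ d @ b)"
  unfolding linked_def
proof (elim exE conjE)
  fix s assume s: "\<forall>i\<in>set s. i + 2 < length c" "d = moves s c"
  show "\<exists>s. (\<forall>i\<in>set s. i + 2 < length (a @ c @ b)) \<and> a @ d @ b = moves s (a @ c @ b)"
    using s moves_context[of s c a b] by (intro exI[of _ "map ((+) (length a)) s"]) auto
qed

lemma linked_three:
  "x \<le> y \<Longrightarrow> y < z \<Longrightarrow> linked (a @ [x, z, y] @ b) (a @ [z, x, y] @ b)"
  "x < y \<Longrightarrow> y \<le> z \<Longrightarrow> linked (a @ [y, z, x] @ b) (a @ [y, x, z] @ b)"
proof -
  have "linked [p, q, r] (move3 p q r)" for p q r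
    unfolding linked_def using elem_move_three[of "[]" p q r "[]"]
    by (intro exI[of _ "[0]"]) (simp add: moves_def)
  moreover have "x \<le> y \<Longrightarrow> y < z \<Longrightarrow> move3 x z y = [z, x, y]" "x < y \<Longrightarrow> y \<le> z \<Longrightarrow> move3 y z x = [y, x, z]"
    by (auto simp: move3_def)
  ultimately show "x \<le> y \<Longrightarrow> y < z \<Longrightarrow> linked (a @ [x, z, y] @ b) (a @ [z, x, y] @ b)"
    "x < y \<Longrightarrow> y \<le> z \<Longrightarrow> linked (a @ [y, z, x] @ b) (a @ [y, x, z] @ b)"
    by (metis linked_context)+
qed

section \<open>Moves between straight words of the same shape\<close>

text \<open>The word of \<open>U \<alpha>\<close>: by increasing entry, its cells are listed row by row from the top, each
  row from right to left.\<close>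

definition U_word :: "nat list \<Rightarrow> nat list" where
  "U_word \<alpha> = concat (map (\<lambda>b. rev [0..<b]) \<alpha>)"

lemma U_word_simps [simp]: "U_word [] = []" "U_word (a # \<alpha>) = rev [0..<a] @ U_word \<alpha>"
  by (simp_all add: U_word_def)

lemma run_row: "0 < b \<Longrightarrow> run (rev [0..<b]) \<beta> = Some (b # \<beta>)"
proof (induction b)
  case (Suc b)
  then show ?case by (cases "b = 0") (auto simp: add_cell_def)
qed simp

lemma run_U_word: "\<alpha> \<in> Comp \<Longrightarrow> run (U_word \<alpha>) \<beta> = Some (\<alpha> @ \<beta>)"
  by (induction \<alpha>) (auto simp: run_append run_row Comp_def)

text \<open>The letter \<open>k\<close> passes the larger letters of a row up to the letter \<open>k\<close> of that row, by
  relations that have a letter between the two (or equal to the smaller one) on their right.\<close>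

lemma link_rise: "\<forall>h\<in>set H. k < h \<Longrightarrow> sorted_wrt (>) H \<Longrightarrow> linked (k # H @ [k]) (H @ [k, k])"
proof (induction H)
  case (Cons h H)
  obtain y w where y: "H @ [k] = y # w" "k \<le> y" "y < h" using Cons.prems by (cases H) auto
  have "linked ([] @ [k, h, y] @ w) ([] @ [h, k, y] @ w)" using y by (intro linked_three(1))
  moreover have "linked ([h] @ (k # H @ [k]) @ []) ([h] @ (H @ [k, k]) @ [])"
    using Cons by (intro linked_context) auto
  ultimately show ?case using y linked_trans by fastforce
qed (simp add: linked_refl)

text \<open>Beyond the letter \<open>k\<close> of the row it passes the smaller letters, by relations that have a
  letter between the two (or equal to the larger one) on their left.\<close>

lemma link_fall: "sorted_wrt (>) (y # R) \<Longrightarrow> y \<le> k \<Longrightarrow> linked (y # k # R) (y # R @ [k])"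
proof (induction R arbitrary: y)
  case (Cons r R)
  have "linked ([] @ [y, k, r] @ R) ([] @ [y, r, k] @ R)" using Cons.prems by (intro linked_three(2)) auto
  moreover have "linked ([y] @ (r # k # R) @ []) ([y] @ (r # R @ [k]) @ [])"
    using Cons by (intro linked_context) auto
  ultimately show ?case using linked_trans by fastforce
qed (simp add: linked_refl)

lemma link_pass: "k < a \<Longrightarrow> linked (k # rev [0..<a]) (rev [0..<a] @ [k])"
proof -
  assume ka: "k < a"
  \<comment> \<open>The row is cut at its letter \<open>k\<close>; a second \<open>k\<close> then continues behind it.\<close>
  define H where "H = rev [Suc k..<a]"
  have "[0..<a] = [0..<k] @ k # [Suc k..<a]" using ka upt_add_eq_append[of 0 k "a - k"] by (simp add: upt_conv_Cons)
  then have split: "rev [0..<a] = H @ k # rev [0..<k]" by (simp add: H_def)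
  have "linked ([] @ (k # H @ [k]) @ rev [0..<k]) ([] @ (H @ [k, k]) @ rev [0..<k])"
    by (intro linked_context link_rise) (auto simp: H_def sorted_wrt_rev)
  moreover have "linked (H @ (k # k # rev [0..<k]) @ []) (H @ (k # rev [0..<k] @ [k]) @ [])"
    by (intro linked_context link_fall) (auto simp: sorted_wrt_rev)
  ultimately show ?thesis using split linked_trans by fastforce
qed

text \<open>Adding a cell to a partition at the corner in column \<open>k\<close>; for \<open>k = 0\<close> this is a new last
  row.\<close>

fun add_sorted :: "nat \<Rightarrow> nat list \<Rightarrow> nat list" where
  "add_sorted k [] = [Suc k]"
| "add_sorted k (a # \<alpha>) = (if a = k then Suc k # \<alpha> else a # add_sorted k \<alpha>)"

text \<open>The letter \<open>k\<close> moves to the right through the words of all rows longer than \<open>k\<close> and then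
  becomes the new last cell of the first row of length \<open>k\<close>, or a new last row if \<open>k = 0\<close>.\<close>

lemma link_add_sorted:
  "sorted_wrt (\<ge>) \<alpha> \<Longrightarrow> \<forall>a\<in>set \<alpha>. 0 < a \<Longrightarrow> k = 0 \<or> k \<in> set \<alpha> \<Longrightarrow>
     linked (k # U_word \<alpha>) (U_word (add_sorted k \<alpha>)) \<and> sorted_wrt (\<ge>) (add_sorted k \<alpha>) \<and>
     (\<forall>b\<in>set (add_sorted k \<alpha>). \<exists>a\<in>insert (Suc k) (set \<alpha>). b = a) \<and>
     (if k = 0 then mset (add_sorted k \<alpha>) = add_mset 1 (mset \<alpha>)
      else add_mset k (mset (add_sorted k \<alpha>)) = add_mset (Suc k) (mset \<alpha>))"
proof (induction \<alpha>)
  case (Cons a \<alpha>)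
  show ?case
  proof (cases "a = k")
    case True
    then show ?thesis using Cons.prems by (auto simp: linked_refl)
  next
    case False
    then have ka: "k < a" using Cons.prems by auto
    have IH: "linked (k # U_word \<alpha>) (U_word (add_sorted k \<alpha>))" "sorted_wrt (\<ge>) (add_sorted k \<alpha>)"
      "\<forall>b\<in>set (add_sorted k \<alpha>). \<exists>a\<in>insert (Suc k) (set \<alpha>). b = a"
      "if k = 0 then mset (add_sorted k \<alpha>) = add_mset 1 (mset \<alpha>)
      else add_mset k (mset (add_sorted k \<alpha>)) = add_mset (Suc k) (mset \<alpha>)"
      using Cons False by auto
    have "linked ([] @ (k # rev [0..<a]) @ U_word \<alpha>) ([] @ (rev [0..<a] @ [k]) @ U_word \<alpha>)"
      using link_pass[OF ka] by (rule linked_context)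
    moreover have "linked (rev [0..<a] @ (k # U_word \<alpha>) @ []) (rev [0..<a] @ U_word (add_sorted k \<alpha>) @ [])"
      using IH(1) by (rule linked_context)
    ultimately have "linked (k # U_word (a # \<alpha>)) (U_word (add_sorted k (a # \<alpha>)))"
      using False linked_trans by fastforce
    then show ?thesis using IH(2,3,4) Cons.prems False ka
      by (auto simp: add_mset_commute split: if_splits)
  qed
qed (auto simp: linked_refl)

text \<open>The rows of the shape can be sorted: a straight word is linked to the word of \<open>U l\<close> for a
  partition \<open>l\<close>.\<close>

lemma linked_sorted:
  "run c [] = Some \<alpha> \<Longrightarrow> \<exists>l. sorted_wrt (\<ge>) l \<and> mset l = mset \<alpha> \<and> linked c (U_word l)"
proof (induction c arbitrary: \<alpha>)
  case (Cons k c)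
  then obtain \<alpha>' where \<alpha>': "run c [] = Some \<alpha>'" "add_cell k \<alpha>' = Some \<alpha>" by (auto split: Option.bind_splits)
  then obtain l where l: "sorted_wrt (\<ge>) l" "mset l = mset \<alpha>'" "linked c (U_word l)" using Cons.IH by blast
  have "\<alpha>' \<in> Comp" using run_Comp[OF \<alpha>'(1)] by (simp add: Comp_def)
  then have pos: "\<forall>a\<in>set l. 0 < a" using mset_eq_setD[OF l(2)] by (simp add: Comp_def)
  have k: "k = 0 \<or> k \<in> set l" using \<alpha>'(2) grow_mset mset_eq_setD[OF l(2)] by (auto simp: add_cell_def split: if_splits)
  have *: "if k = 0 then mset \<alpha> = add_mset 1 (mset \<alpha>') else add_mset k (mset \<alpha>) = add_mset (Suc k) (mset \<alpha>')"
    using \<alpha>'(2) grow_mset by (auto simp: add_cell_def)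
  have "linked ([k] @ c @ []) ([k] @ U_word l @ [])" using l(3) by (rule linked_context)
  then have "linked (k # c) (U_word (add_sorted k l))"
    using link_add_sorted[OF l(1) pos k] linked_trans by fastforce
  moreover have "mset (add_sorted k l) = mset \<alpha>"
    using link_add_sorted[OF l(1) pos k] * l(2) by (metis add_mset_add_mset_same_iff)
  ultimately show ?case using link_add_sorted[OF l(1) pos k] by blast
qed (auto intro!: exI[of _ "[]"] simp: linked_refl)

lemma linked_same_mset:
  assumes "run c [] = Some \<alpha>" "run d [] = Some \<beta>" "mset \<alpha> = mset \<beta>"
  shows "linked c d"
proof -
  obtain l m where lm: "sorted_wrt (\<ge>) l" "mset l = mset \<alpha>" "linked c (U_word l)"
    "sorted_wrt (\<ge>) m" "mset m = mset \<beta>" "linked d (U_word m)"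
    using linked_sorted[OF assms(1)] linked_sorted[OF assms(2)] by blast
  have "sorted (rev l)" "sorted (rev m)" using lm by (simp_all add: sorted_wrt_rev)
  then have "rev l = rev m" using lm assms(3) by (metis mset_rev properties_for_sort)
  then show ?thesis using lm linked_sym linked_trans by (metis rev_rev_ident)
qed

section \<open>Lowering a letter\<close>

lemma count_ge_iff:
  "sorted_wrt (>) r \<Longrightarrow> k < length r \<Longrightarrow> k < length (filter (\<lambda>x. t \<le> x) r) \<longleftrightarrow> t \<le> r ! (k::nat)" for t :: nat
proof (induction r arbitrary: k)
  case (Cons a r)
  show ?case
  proof (cases "t \<le> a")
    case True
    then show ?thesis using Cons by (cases k) auto
  next
    case False
    then have "filter (\<lambda>x. t \<le> x) r = []" using Cons.prems by (auto simp: filter_empty_conv)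
    moreover have "(a # r) ! k \<le> a" using Cons.prems by (cases k) (auto simp: less_imp_le)
    ultimately show ?thesis using False by auto
  qed
qed simp

text \<open>For decreasing sequences the entrywise comparison amounts to comparing the numbers of
  entries above each threshold, which for columns of fillings are letter counts in suffixes of
  words.\<close>

lemma dominates_if_counts:
  assumes "sorted_wrt (>) r" "sorted_wrt (>) s" "set r \<inter> set s = {}"
    "\<And>t. length (filter (\<lambda>x. t \<le> x) s) \<le> length (filter (\<lambda>x. t \<le> x) r)"
  shows "dominates r s"
  unfolding dominates_def
proof (intro conjI allI impI)
  show len: "length s \<le> length r" using assms(4)[of 0] by simp
  fix k assume k: "k < length s"
  have "k < length (filter (\<lambda>x. s ! k \<le> x) s)" using count_ge_iff[OF assms(2) k] by blast
  then have "s ! k \<le> r ! k" using assms(4)[of "s ! k"] count_ge_iff[OF assms(1)] k len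
    by (meson order_less_le_trans)
  moreover have "r ! k \<in> set r" "s ! k \<in> set s" using k len by auto
  then have "s ! k \<noteq> r ! k" using assms(3) by auto
  ultimately show "s ! k < r ! k" by simp
qed

lemma dominates_Cons:
  "dominates (x # r) (y # s) \<longleftrightarrow> y < x \<and> dominates r s"
  by (auto simp: dominates_def All_less_Suc2)

lemma dominates_Nil_left: "dominates [] s \<longleftrightarrow> s = []"
  by (auto simp: dominates_def)

lemma row_word_two_columns:
  assumes "sorted_wrt (<) (u @ [x])" "sorted_wrt (<) (v @ [y])" "y < x"
  shows "row_word ((u @ [x]) @ v @ [y]) [] = ([x, y], u @ v)"
  using row_word_columns[of "[u @ [x], v @ [y]]" "[]"] assms by simp

text \<open>Two columns, the second of which gives its entry \<open>v\<close> to the first. Compare the insertions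
  row by row. As long as \<open>A\<close> and \<open>A'\<close> are not empty, their last entries form the first row in
  both cases. Afterwards \<open>v\<close> is the largest entry and goes to the first row in both cases,
  together with the last entry of \<open>B'\<close>; then the last entry \<open>x\<close> of \<open>B\<close> takes over the role of
  \<open>v\<close>, since in the first word it is bumped by \<open>v\<close>.\<close>

lemma two_columns_insertion:
  assumes "sorted_wrt (<) (B @ [v] @ A)" "sorted_wrt (<) (B' @ [v] @ A')" "length A' = length A"
    "dominates (rev A) (rev A')" "dominates (rev B) (rev B')"
  shows "fold insert_letter (B @ A @ B' @ [v] @ A') [] = fold insert_letter (B @ [v] @ A @ B' @ A') []"
  using assms
proof (induction "length A + length B" arbitrary: A A' B B' v rule: less_induct)
  case less
  show ?case
  proof (cases A rule: rev_cases)
    case (snoc A1 x)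
    then obtain A1' y where A': "A' = A1' @ [y]" using less.prems(3) by (cases A' rule: rev_cases) auto
    have yx: "y < x" "dominates (rev A1) (rev A1')" using less.prems(4) snoc A' by (auto simp: dominates_Cons)
    have "row_word (((B @ A1) @ [x]) @ (B' @ [v] @ A1') @ [y]) [] = ([x, y], (B @ A1) @ B' @ [v] @ A1')"
      using less.prems snoc A' yx by (intro row_word_two_columns) (auto simp: sorted_wrt_append)
    then have 1: "row_word (B @ A @ B' @ [v] @ A') [] = ([x, y], B @ A1 @ B' @ [v] @ A1')"
      using snoc A' by simp
    have "row_word (((B @ [v] @ A1) @ [x]) @ (B' @ A1') @ [y]) [] = ([x, y], (B @ [v] @ A1) @ B' @ A1')"
      using less.prems snoc A' yx by (intro row_word_two_columns) (auto simp: sorted_wrt_append)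
    then have 2: "row_word (B @ [v] @ A @ B' @ A') [] = ([x, y], B @ [v] @ A1 @ B' @ A1')"
      using snoc A' by simp
    have "fold insert_letter (B @ A1 @ B' @ [v] @ A1') [] = fold insert_letter (B @ [v] @ A1 @ B' @ A1') []"
      using less.prems snoc A' yx by (intro less.hyps) (auto simp: sorted_wrt_append)
    then show ?thesis
      using fold_insert_Nil[of "B @ A @ B' @ [v] @ A'"] fold_insert_Nil[of "B @ [v] @ A @ B' @ A'"] 1 2 by simp
  next
    case Nil
    then have A': "A' = []" using less.prems(3) by simp
    show ?thesis
    proof (cases B' rule: rev_cases)
      case B'_Nil: Nil
      then show ?thesis using Nil A' by simp
    next
      case (snoc B1' y)
      then obtain B1 x where B: "B = B1 @ [x]" using less.prems(5) by (cases B rule: rev_cases) (auto simp: dominates_Nil_left)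
      have yx: "y < x" "dominates (rev B1) (rev B1')" using less.prems(5) snoc B by (auto simp: dominates_Cons)
      have xv: "x < v" using less.prems(1) B by (auto simp: sorted_wrt_append)
      have "row_word ((B1 @ [x]) @ B1' @ [y]) [] = ([x, y], B1 @ B1')"
        using less.prems B snoc yx by (intro row_word_two_columns) (auto simp: sorted_wrt_append)
      then have 1: "row_word (B @ A @ B' @ [v] @ A') [] = ([v, y], B1 @ B1' @ [x])"
        using row_word_append[of "B @ B'" "[v]" "[]"] B snoc Nil A' xv by simp
      have "row_word (((B1 @ [x]) @ [v]) @ B1' @ [y]) [] = ([v, y], (B1 @ [x]) @ B1')"
        using less.prems B snoc yx xv by (intro row_word_two_columns) (auto simp: sorted_wrt_append)
      then have 2: "row_word (B @ [v] @ A @ B' @ A') [] = ([v, y], B1 @ [x] @ B1')"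
        using B snoc Nil A' by simp
      have "fold insert_letter (B1 @ [] @ B1' @ [x] @ []) [] = fold insert_letter (B1 @ [x] @ [] @ B1' @ []) []"
        using less.prems Nil A' B snoc yx by (intro less.hyps) (auto simp: sorted_wrt_append dest: order.strict_trans)
      then show ?thesis
        using fold_insert_Nil[of "B @ A @ B' @ [v] @ A'"] fold_insert_Nil[of "B @ [v] @ A @ B' @ A'"] 1 2 by simp
    qed
  qed
qed

lemma reading_columns:
  assumes "\<forall>k\<in>set e. k < m"
  shows "reading e = concat (map (col_values e) [0..<m])"
proof (rule sym, rule reading_unique)
  show "sorted_wrt (earlier e) (concat (map (col_values e) [0..<m]))"
  proof (rule sorted_wrt_concat_map)
    show "sorted_wrt (earlier e) (col_values e k)" for k
      by (rule sorted_wrt_mono_rel[OF _ sorted_col_values]) (auto simp: earlier_def set_col_values)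
  qed (auto simp: set_col_values earlier_def)
  have "v \<in> set (concat (map (col_values e) [0..<m]))" if "v \<in> {1..length e}" for v
    using that assms by (auto simp: set_col_values)
  then show "set (concat (map (col_values e) [0..<m])) = {1..length e}"
    by (auto simp: set_col_values)
qed

text \<open>Suffixes of the word correspond to the sets of large entries.\<close>

lemma count_col_values: "length (filter (\<lambda>v. t < v) (col_values e k)) = count_list (drop t e) k"
proof (induction e arbitrary: t)
  case Nil
  then show ?case by (simp add: col_values_def)
next
  case (Cons x e)
  have shift: "col_values (x # e) k = (if x = k then [1] else []) @ map Suc (col_values e k)"
    by (simp add: col_values_def upt_conv_Cons map_Suc_upt[symmetric] filter_map comp_def del: upt_Suc)
  show ?case
  proof (cases t)
    case 0
    have "filter (\<lambda>v. 0 < v) (col_values e k) = col_values e k"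
      by (auto intro!: filter_True simp: set_col_values)
    then show ?thesis using Cons[of 0] 0 by (simp add: shift filter_map comp_def)
  next
    case (Suc t')
    then show ?thesis using Cons[of t'] by (simp add: shift filter_map comp_def)
  qed
qed

text \<open>Lowering a letter \<open>Suc a\<close> moves one entry from column \<open>Suc a\<close> to column \<open>a\<close> of the
  filling. The conditions on the suffixes say that above this entry both columns have equally
  many entries, and that the parts of column \<open>a\<close> above and below it dominate those of column
  \<open>Suc a\<close>, as \<open>two_columns_insertion\<close> requires; the other columns are not affected.\<close>

lemma lower_letter:
  assumes p: "p < length e" "e ! p = Suc a"
    and bal: "count_list (drop (Suc p) e) (Suc a) = count_list (drop (Suc p) e) a"
    and after: "\<And>m. p < m \<Longrightarrow> count_list (drop m e) (Suc a) \<le> count_list (drop m e) a"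
    and before: "\<And>m. m \<le> p \<Longrightarrow> count_list (drop m e) (Suc a) \<le> Suc (count_list (drop m e) a)"
  shows "same_rect e (e[p := a])"
proof -
  define n where "n = length e"
  define f where "f k xs = map Suc (filter (\<lambda>i. e ! i = k) xs)" for k xs
  have up: "[0..<n] = [0..<p] @ p # [Suc p..<n]"
    using p(1) upt_add_eq_append[of 0 p "n - p"] by (simp add: n_def upt_conv_Cons)
  \<comment> \<open>The entries larger than \<open>p + 1\<close> in the columns \<open>a\<close> and \<open>Suc a\<close> are \<open>A\<close> and \<open>A'\<close>, the
    smaller ones \<open>B\<close> and \<open>B'\<close>.\<close>
  define A where "A = f a [Suc p..<n]"
  define B where "B = f a [0..<p]"
  define A' where "A' = f (Suc a) [Suc p..<n]"
  define B' where "B' = f (Suc a) [0..<p]"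
  let ?e = "e[p := a]" and ?v = "Suc p"
  have col: "col_values e a = B @ A" "col_values e (Suc a) = B' @ [?v] @ A'"
    using p(2) by (simp_all add: col_values_def n_def[symmetric] up f_def A_def B_def A'_def B'_def)
  have same: "filter (\<lambda>i. ?e ! i = k) xs = filter (\<lambda>i. e ! i = k) xs" if "p \<notin> set xs" for k xs
    using that by (intro filter_cong) (metis nth_list_update_neq)+
  have col': "col_values ?e a = B @ [?v] @ A" "col_values ?e (Suc a) = B' @ A'"
    using p by (simp_all add: col_values_def n_def[symmetric] up f_def A_def B_def A'_def B'_def same)
  have other: "col_values ?e k = col_values e k" if "k \<noteq> a" "k \<noteq> Suc a" for k
    using that p by (auto simp: col_values_def nth_list_update intro!: filter_cong)
  obtain m where m: "\<forall>k\<in>set e. k < m" "Suc a < m"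
    by (rule that[of "Suc (Max (insert (Suc a) (set e)))"]) (auto simp: less_Suc_eq_le)
  have m': "\<forall>k\<in>set ?e. k < m" using m set_update_subset_insert[of e p a] by auto
  have upm: "[0..<m] = [0..<a] @ [a, Suc a] @ [Suc (Suc a)..<m]"
    using m(2) upt_add_eq_append[of 0 a "m - a"] by (simp add: upt_conv_Cons)
  define L R where "L = concat (map (col_values e) [0..<a])" "R = concat (map (col_values e) [Suc (Suc a)..<m])"
  have L': "concat (map (col_values ?e) [0..<a]) = L" "concat (map (col_values ?e) [Suc (Suc a)..<m]) = R"
    unfolding L_R_def by (auto intro!: arg_cong[of _ _ concat] simp: other)
  have r: "reading e = L @ (B @ A @ B' @ [?v] @ A') @ R"
    unfolding reading_columns[OF m(1)] upm by (simp add: col L_R_def)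
  have r': "reading ?e = L @ (B @ [?v] @ A @ B' @ A') @ R"
    unfolding reading_columns[OF m'] upm using L' by (simp add: col')
  have len: "length (f k [Suc p..<n]) = count_list (drop (Suc p) e) k" for k
  proof -
    have "filter (\<lambda>v. Suc p < v) (col_values e k) = f k [Suc p..<n]"
      by (simp add: col_values_def n_def[symmetric] up f_def filter_map comp_def)
        (auto intro!: filter_cong)
    then show ?thesis using count_col_values[of "Suc p" e k] by simp
  qed
  have sor: "sorted_wrt (<) (B @ [?v] @ A)" "sorted_wrt (<) (B' @ [?v] @ A')"
    using sorted_col_values[of ?e a] sorted_col_values[of e "Suc a"] col col' by simp_all
  have "set (B @ A) \<inter> set (B' @ [?v] @ A') = {}"
    unfolding col[symmetric] set_col_values by auto
  then have disj: "(set B \<union> set A) \<inter> (set B' \<union> set A') = {}" by auto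
  have AA: "length A' = length A" using bal len by (simp add: A_def A'_def)
  have cnt: "length (filter (\<lambda>v. t < v) B) + length (filter (\<lambda>v. t < v) A) = count_list (drop t e) a"
    "length (filter (\<lambda>v. t < v) B') + (if t < ?v then 1 else 0) + length (filter (\<lambda>v. t < v) A') = count_list (drop t e) (Suc a)" for t
    using count_col_values[of t e a] count_col_values[of t e "Suc a"] by (auto simp: col split: if_splits)
  have B: "filter (\<lambda>v. t < v) B = []" "filter (\<lambda>v. t < v) B' = []" if "p \<le> t" for t
    using that sor by (auto simp: sorted_wrt_append filter_empty_conv)
  have A: "filter (\<lambda>v. t < v) A = A" "filter (\<lambda>v. t < v) A' = A'" if "t \<le> ?v" for t
    using that sor by (force simp: sorted_wrt_append intro!: filter_True)+
  have cA: "length (filter (\<lambda>v. t < v) A') \<le> length (filter (\<lambda>v. t < v) A)" for t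
    using cnt[of t] B[of t] A[of t] AA after[of t] by (cases "t \<le> ?v") auto
  have cB: "length (filter (\<lambda>v. t < v) B') \<le> length (filter (\<lambda>v. t < v) B)" for t
    using cnt[of t] B[of t] A[of t] AA before[of t] by (cases "t \<le> p") auto
  have le: "length (filter (\<lambda>v. t \<le> v) X) \<le> length (filter (\<lambda>v. t \<le> v) Y)"
    if "\<And>t. length (filter (\<lambda>v. t < v) X) \<le> length (filter (\<lambda>v. t < v) Y)" "0 \<notin> set X \<union> set Y" for t and X Y :: "nat list"
  proof (cases t)
    case 0
    have "filter (\<lambda>v. 0 < v) Z = Z" if "0 \<notin> set Z" for Z :: "nat list"
      using that by (auto intro!: filter_True) (metis gr0I)
    then show ?thesis using that(1)[of 0] that(2) 0 by auto
  next
    case (Suc t')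
    then show ?thesis using that(1)[of t'] by (simp add: Suc_le_eq)
  qed
  have dA: "dominates (rev A) (rev A')" "dominates (rev B) (rev B')"
  proof -
    have "length (filter (\<lambda>v. t \<le> v) A') \<le> length (filter (\<lambda>v. t \<le> v) A)" for t
      by (rule le[OF cA]) (auto simp: A_def A'_def f_def)
    then show "dominates (rev A) (rev A')"
      using sor disj by (intro dominates_if_counts) (auto simp: sorted_wrt_append sorted_wrt_rev rev_filter[symmetric])
    have "length (filter (\<lambda>v. t \<le> v) B') \<le> length (filter (\<lambda>v. t \<le> v) B)" for t
      by (rule le[OF cB]) (auto simp: B_def B'_def f_def)
    then show "dominates (rev B) (rev B')"
      using sor disj by (intro dominates_if_counts) (auto simp: sorted_wrt_append sorted_wrt_rev rev_filter[symmetric])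
  qed
  have d: "distinct (B @ A @ B' @ [?v] @ A')" "distinct (B @ [?v] @ A @ B' @ A')"
    using distinct_reading[of e] distinct_reading[of ?e] r r' by (simp_all del: append_assoc)
  have "knuth (B @ A @ B' @ [?v] @ A') (B @ [?v] @ A @ B' @ A')"
    using knuth_iff_insertion[OF d] two_columns_insertion[OF sor AA dA] by simp
  then show ?thesis unfolding same_rect_def r r' by (rule knuth_context)
qed

section \<open>The slide after removing the largest entry\<close>

text \<open>In a straight word \<open>x @ [0]\<close> the last letter belongs to the largest entry, which lies in
  the first column. Its removal leaves a hole, and \<open>passes x\<close> is the column that the hole has
  reached when the other entries have been considered by decreasing size. The hole moves from
  column \<open>K\<close> to column \<open>K + 1\<close>, exchanging places with the new entry, if this entry lies in
  column \<open>K + 1\<close> and makes the two columns (with the hole) equally high.\<close>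

fun passes :: "nat list \<Rightarrow> nat" where
  "passes [] = 0"
| "passes (y # x) =
     (if y = Suc (passes x) \<and>
         count_list (x @ [0]) (passes x) = Suc (count_list (x @ [0]) (Suc (passes x)))
      then Suc (passes x) else passes x)"

text \<open>The word after the slide that stops when the hole has reached column \<open>j\<close>. The entries that
  have exchanged places with the hole have moved one column to the left. The intermediate stops
  serve to perform the slide one letter at a time; for \<open>passes x \<le> j\<close> the slide is complete.\<close>

fun lowered :: "nat \<Rightarrow> nat list \<Rightarrow> nat list" where
  "lowered j [] = []"
| "lowered j (y # x) =
     (if passes (y # x) \<noteq> passes x \<and> passes x < j then passes x else y) # lowered j x"

lemma length_lowered [simp]: "length (lowered j x) = length x"
  by (induction x) auto

lemma lowered_0 [simp]: "lowered 0 x = x"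
  by (induction x) auto

lemma drop_lowered: "drop m (lowered j x) = lowered j (drop m x)"
proof (induction x arbitrary: m)
  case (Cons y x)
  then show ?case by (cases m) simp_all
qed simp

lemma passes_le_length: "passes x \<le> length x"
  by (induction x) auto

lemma passes_drop_mono: "m \<le> n \<Longrightarrow> passes (drop n x) \<le> passes (drop m x)"
proof (induction x arbitrary: m n)
  case (Cons y x)
  show ?case
  proof (cases n)
    case (Suc n')
    show ?thesis
    proof (cases m)
      case 0
      then show ?thesis using Cons.IH[of 0 n'] Suc by auto
    next
      case (Suc m')
      then show ?thesis using Cons \<open>n = Suc n'\<close> by simp
    qed
  qed (use Cons.prems in simp)
qed simp

text \<open>The slide takes away a cell in the column where the hole ends.\<close>

lemma count_lowered:
  "count_list (lowered j x) i + (if i = min j (passes x) then 1 else 0) = count_list (x @ [0]) i"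
proof (induction x)
  case (Cons y x)
  show ?case
  proof (cases "passes (y # x) = passes x")
    case True
    then show ?thesis using Cons by simp
  next
    case False
    then have y: "y = Suc (passes x)" "passes (y # x) = Suc (passes x)" by (auto split: if_splits)
    show ?thesis
    proof (cases "passes x < j")
      case True
      then have "lowered j (y # x) = passes x # lowered j x" using False by simp
      then show ?thesis using Cons True y by (auto simp: min_def simp del: passes.simps lowered.simps split: if_splits)
    next
      case False
      then have "lowered j (y # x) = y # lowered j x" by simp
      then show ?thesis using Cons False y by (auto simp: min_def simp del: passes.simps lowered.simps split: if_splits)
    qed
  qed
qed auto

lemma yamanouchi_drop: "yamanouchi e \<Longrightarrow> yamanouchi (drop m e)"
proof (induction e arbitrary: m)
  case (Cons k e)
  then show ?case by (cases m) simp_all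
qed simp

lemma passes_count:
  "yamanouchi (x @ [0]) \<Longrightarrow> count_list (x @ [0]) (Suc (passes x)) < count_list (x @ [0]) (passes x)"
proof (induction x)
  case (Cons y x)
  then have IH: "count_list (x @ [0]) (Suc (passes x)) < count_list (x @ [0]) (passes x)"
    and y: "yamanouchi (x @ [0])" by auto
  show ?case using IH yamanouchi_count[OF y, of "Suc (passes x)"] by auto
qed simp

lemma lowered_beyond: "passes x \<le> j \<Longrightarrow> lowered (Suc j) x = lowered j x"
  by (induction x) (auto split: if_splits)

text \<open>Two successive stops differ in a single letter.\<close>

lemma lowered_step:
  assumes "j < passes x"
  obtains p where "p < length x" "x ! p = Suc j" "lowered j x ! p = Suc j"
    "lowered (Suc j) x = (lowered j x)[p := j]"
    "passes (drop (Suc p) x) = j" "passes (drop p x) = Suc j"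
proof -
  have "\<exists>p. p < length x \<and> x ! p = Suc j \<and> lowered j x ! p = Suc j \<and>
    lowered (Suc j) x = (lowered j x)[p := j] \<and> passes (drop (Suc p) x) = j \<and> passes (drop p x) = Suc j"
    using assms
  proof (induction x)
    case (Cons y x)
    show ?case
    proof (cases "j < passes x")
      case True
      then obtain p where p: "p < length x" "x ! p = Suc j" "lowered j x ! p = Suc j"
        "lowered (Suc j) x = (lowered j x)[p := j]" "passes (drop (Suc p) x) = j" "passes (drop p x) = Suc j"
        using Cons.IH by blast
      then show ?thesis using True by (intro exI[of _ "Suc p"]) auto
    next
      case False
      then have *: "passes x = j" "passes (y # x) = Suc j" "y = Suc j" using Cons.prems by (auto split: if_splits)
      then show ?thesis using lowered_beyond[of x j]
        by (intro exI[of _ 0]) (auto simp del: passes.simps)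
    qed
  qed simp
  then show ?thesis using that by blast
qed

text \<open>Each stop is reached from the previous one by \<open>lower_letter\<close>. Its hypotheses compare
  letter counts in suffixes of the partially slid word, and these differ from the counts in
  \<open>x @ [0]\<close>, which satisfy the lattice condition, only by the hole (\<open>count_lowered\<close>).\<close>

lemma same_rect_lowered:
  assumes "yamanouchi (x @ [0])"
  shows "same_rect x (lowered j x)"
proof (induction j)
  case (Suc j)
  show ?case
  proof (cases "j < passes x")
    case False
    then show ?thesis using Suc lowered_beyond[of x j] by simp
  next
    case True
    then obtain p where p: "p < length x" "x ! p = Suc j" "lowered j x ! p = Suc j"
      "lowered (Suc j) x = (lowered j x)[p := j]" "passes (drop (Suc p) x) = j" "passes (drop p x) = Suc j"
      by (rule lowered_step)
    \<comment> \<open>Counts with the hole; \<open>cnt\<close> compares them with the counts without it.\<close>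
    define N where "N m i = count_list (drop m x @ [0]) i" for m i
    have yamanouchi: "yamanouchi (drop m x @ [0])" if "m \<le> length x" for m
      using yamanouchi_drop[OF assms, of m] that by simp
    have N: "N m (Suc i) \<le> N m i" "N m (Suc (passes (drop m x))) < N m (passes (drop m x))" if "m \<le> length x" for m i
      using yamanouchi_count[OF yamanouchi[OF that]] passes_count[OF yamanouchi[OF that]] unfolding N_def by auto
    have cnt: "count_list (drop m (lowered j x)) i + (if i = min j (passes (drop m x)) then 1 else 0) = N m i" for m i
      unfolding drop_lowered N_def by (rule count_lowered)
    have pass: "N (Suc p) j = Suc (N (Suc p) (Suc j))"
    proof -
      have "drop p x = x ! p # drop (Suc p) x" using p(1) by (simp add: Cons_nth_drop_Suc)
      then show ?thesis using p(5,6) by (auto simp: N_def split: if_splits)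
    qed
    have "same_rect (lowered j x) ((lowered j x)[p := j])"
    proof (rule lower_letter)
      show "count_list (drop (Suc p) (lowered j x)) (Suc j) = count_list (drop (Suc p) (lowered j x)) j"
        using cnt[of "Suc p" j] cnt[of "Suc p" "Suc j"] pass p(5) by auto
      fix m
      show "count_list (drop m (lowered j x)) (Suc j) \<le> count_list (drop m (lowered j x)) j" if "p < m"
      proof (cases "m \<le> length x")
        case True
        have "passes (drop m x) \<le> j" using passes_drop_mono[of "Suc p" m x] p(5) that by simp
        then show ?thesis using cnt[of m j] cnt[of m "Suc j"] N(1)[OF True, of j] N(2)[OF True]
          by (auto simp: min_def split: if_splits)
      qed simp
      show "count_list (drop m (lowered j x)) (Suc j) \<le> Suc (count_list (drop m (lowered j x)) j)" if "m \<le> p"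
      proof -
        have "m \<le> length x" using that p(1) by simp
        then show ?thesis using cnt[of m j] cnt[of m "Suc j"] N(1)[of m j]
          by (auto simp: min_def split: if_splits)
      qed
    qed (use p in auto)
    then show ?thesis using Suc p(4) same_rect_trans by simp
  qed
qed (simp add: same_rect_refl)

section \<open>The effect of the slide on the composition shape\<close>

text \<open>The slide removes the first part equal to \<open>c\<close>, and the largest part \<open>b \<le> c\<close> below it takes
  its place, being removed from the remaining parts in the same manner. In a partition this
  merely deletes \<open>c\<close>; in a composition the cascade reflects that a cell is always added to the
  topmost row of its length.\<close>

fun remove_part :: "nat \<Rightarrow> nat list \<Rightarrow> nat list" where
  "remove_part c [] = []"
| "remove_part c (a # \<alpha>) =
     (if a \<noteq> c then a # remove_part c \<alpha>
      else if \<exists>b\<in>set \<alpha>. b \<le> c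
        then Max {b \<in> set \<alpha>. b \<le> c} # remove_part (Max {b \<in> set \<alpha>. b \<le> c}) \<alpha>
      else \<alpha>)"

lemma Max_eqI': "finite A \<Longrightarrow> (m::nat) \<in> A \<Longrightarrow> \<forall>b\<in>A. b \<le> m \<Longrightarrow> Max A = m"
  by (simp add: Max_eqI)

lemma remove_part_replace:
  assumes "b \<in> set \<alpha>" "b \<le> c" "\<forall>d\<in>set \<alpha>. d \<le> c \<longrightarrow> d \<le> b"
  shows "remove_part c (c # \<alpha>) = b # remove_part b \<alpha>"
proof -
  have "Max {b \<in> set \<alpha>. b \<le> c} = b" using assms by (intro Max_eqI') auto
  then show ?thesis using assms by auto
qed

lemma remove_part_last: "\<forall>d\<in>set \<alpha>. c < d \<Longrightarrow> remove_part c (c # \<alpha>) = \<alpha>"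
  by (auto simp: not_le)

lemma remove_part_cases:
  obtains (last) "\<forall>d\<in>set \<alpha>. c < (d::nat)"
  | (replace) b where "b \<in> set \<alpha>" "b \<le> c" "\<forall>d\<in>set \<alpha>. d \<le> c \<longrightarrow> d \<le> b"
proof (cases "\<exists>b\<in>set \<alpha>. b \<le> c")
  case True
  let ?B = "{b \<in> set \<alpha>. b \<le> c}"
  have "Max ?B \<in> ?B" using True by (intro Max_in) auto
  then show ?thesis by (intro replace[of "Max ?B"]) auto
next
  case False
  then show ?thesis by (intro last) auto
qed

lemma remove_part_mset: "c \<in> set \<alpha> \<Longrightarrow> mset \<alpha> = add_mset c (mset (remove_part c \<alpha>))"
proof (induction \<alpha> arbitrary: c)
  case (Cons a \<alpha>)
  show ?case
  proof (cases "a = c")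
    case False
    then show ?thesis using Cons by (auto simp: add_mset_commute)
  next
    case True
    show ?thesis
    proof (cases rule: remove_part_cases[of \<alpha> c])
      case last
      then show ?thesis using remove_part_last True by simp
    next
      case (replace b)
      then show ?thesis using remove_part_replace[OF replace] True Cons.IH[OF replace(1)] by simp
    qed
  qed
qed simp

lemma remove_part_one: "c \<in> set \<alpha> \<Longrightarrow> 0 < c \<Longrightarrow> remove_part c (1 # \<alpha>) = 1 # remove_part c \<alpha>"
  using remove_part_replace[of 1 \<alpha> 1] by (cases "c = 1") auto

text \<open>The part that grows is the one that would be removed.\<close>

lemma remove_part_grow_next:
  "c \<in> set \<alpha> \<Longrightarrow> Suc c \<notin> set \<alpha> \<Longrightarrow> grow c \<alpha> = Some \<alpha>' \<Longrightarrow> remove_part (Suc c) \<alpha>' = remove_part c \<alpha>"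
proof (induction \<alpha> arbitrary: \<alpha>')
  case (Cons a \<alpha>)
  show ?case
  proof (cases "a = c")
    case False
    then show ?thesis using Cons by auto
  next
    case True
    then have \<alpha>': "\<alpha>' = Suc c # \<alpha>" using Cons.prems by simp
    show ?thesis
    proof (cases rule: remove_part_cases[of \<alpha> c])
      case last
      then have "\<forall>d\<in>set \<alpha>. Suc c < d" using Cons.prems by (metis Suc_lessI list.set_intros(2))
      then show ?thesis using remove_part_last last True \<alpha>' by metis
    next
      case (replace b)
      then have "\<forall>d\<in>set \<alpha>. d \<le> Suc c \<longrightarrow> d \<le> b" using Cons.prems by (metis le_SucE list.set_intros(2))
      then show ?thesis using remove_part_replace[OF replace] remove_part_replace[of b \<alpha> "Suc c"] replace True \<alpha>' by simp
    qed
  qed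
qed simp

lemma grow_set: "grow y \<alpha> = Some \<alpha>' \<Longrightarrow> set \<alpha>' \<subseteq> insert (Suc y) (set \<alpha>) \<and> set \<alpha> \<subseteq> insert y (set \<alpha>') \<and> Suc y \<in> set \<alpha>'"
  by (induction \<alpha> arbitrary: \<alpha>') (auto split: if_splits)

text \<open>Growth commutes with removal. If the growing part \<open>b\<close> had moved up into the place of \<open>c\<close>,
  then in \<open>\<alpha>\<close> it grows in its own place and moves up afterwards (\<open>remove_part_grow_next\<close>).\<close>

lemma remove_part_grow:
  "c \<in> set \<alpha> \<Longrightarrow> grow y (remove_part c \<alpha>) = Some \<delta> \<Longrightarrow> \<exists>\<alpha>'. grow y \<alpha> = Some \<alpha>' \<and> c \<in> set \<alpha>' \<and> remove_part c \<alpha>' = \<delta>"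
proof (induction \<alpha> arbitrary: c \<delta>)
  case (Cons a \<alpha>)
  show ?case
  proof (cases "a = c")
    case ac: False
    then have c: "c \<in> set \<alpha>" using Cons.prems by simp
    show ?thesis
    proof (cases "a = y")
      case True
      then have \<delta>: "\<delta> = Suc a # remove_part c \<alpha>" using ac Cons.prems by simp
      have "remove_part c (Suc a # \<alpha>) = Suc a # remove_part c \<alpha>"
        using remove_part_replace[of c \<alpha> c] c by (cases "Suc a = c") auto
      then show ?thesis using True \<delta> c by auto
    next
      case False
      then obtain \<delta>' where \<delta>': "grow y (remove_part c \<alpha>) = Some \<delta>'" "\<delta> = a # \<delta>'" using ac Cons.prems by auto
      then obtain \<alpha>' where "grow y \<alpha> = Some \<alpha>'" "c \<in> set \<alpha>'" "remove_part c \<alpha>' = \<delta>'" using Cons.IH[OF c] by blast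
      then show ?thesis using \<delta>' ac False by auto
    qed
  next
    case ac: True
    show ?thesis
    proof (cases rule: remove_part_cases[of \<alpha> c])
      case last
      then have d: "grow y \<alpha> = Some \<delta>" using Cons.prems remove_part_last ac by metis
      then have "y \<in> set \<alpha>" using grow_mset by blast
      then have yc: "c < y" using last by simp
      then have "\<forall>d\<in>set \<delta>. c < d" using grow_set[OF d] last by auto
      then show ?thesis using d yc ac remove_part_last[of \<delta> c] by auto
    next
      case (replace b)
      have d: "grow y (b # remove_part b \<alpha>) = Some \<delta>" using Cons.prems remove_part_replace[OF replace] ac by simp
      show ?thesis
      proof (cases "y = c")
        case True
        then have "c \<in> set \<alpha>" using d grow_mset[OF d] replace remove_part_mset[of b \<alpha>]
          by (metis insert_iff list.simps(15) mset.simps(2) set_mset_mset)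
        then have "b = c" using replace by (simp add: antisym)
        then have \<delta>: "\<delta> = Suc c # remove_part c \<alpha>" using d True by simp
        then show ?thesis using ac True \<open>c \<in> set \<alpha>\<close> by auto
      next
        case yc: False
        show ?thesis
        proof (cases "y = b")
          case True
          then have bc: "b < c" using yc replace(2) by simp
          have \<delta>: "\<delta> = Suc b # remove_part b \<alpha>" using d True by simp
          have n: "Suc b \<notin> set \<alpha>" using replace(3) bc by force
          obtain \<alpha>1 where \<alpha>1: "grow b \<alpha> = Some \<alpha>1" using grow_None[of b \<alpha>] replace(1) by auto
          have "remove_part (Suc b) \<alpha>1 = remove_part b \<alpha>" using remove_part_grow_next[OF replace(1) n \<alpha>1] .
          moreover have "remove_part c (c # \<alpha>1) = Suc b # remove_part (Suc b) \<alpha>1"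
            using grow_set[OF \<alpha>1] replace(3) bc by (intro remove_part_replace) auto
          ultimately show ?thesis using \<alpha>1 \<delta> ac yc True by auto
        next
          case False
          then obtain \<delta>' where \<delta>': "grow y (remove_part b \<alpha>) = Some \<delta>'" "\<delta> = b # \<delta>'" using d by auto
          then obtain \<alpha>' where \<alpha>': "grow y \<alpha> = Some \<alpha>'" "b \<in> set \<alpha>'" "remove_part b \<alpha>' = \<delta>'"
            using Cons.IH[OF replace(1)] by blast
          have "y \<in> set \<alpha>" using \<alpha>'(1) grow_mset by blast
          then have "\<forall>d\<in>set \<alpha>'. d \<le> c \<longrightarrow> d \<le> b"
            using grow_set[OF \<alpha>'(1)] replace(3) False yc by (auto simp: subset_iff) (metis Suc_leD Suc_leI le_neq_implies_less)
          then have "remove_part c (c # \<alpha>') = b # remove_part b \<alpha>'" using \<alpha>'(2) replace(2) by (intro remove_part_replace) auto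
          then show ?thesis using \<alpha>' \<delta>' ac yc by auto
        qed
      qed
    qed
  qed
qed simp

lemma grow_append: "grow k (\<alpha> @ \<beta>) = (case grow k \<alpha> of Some \<alpha>' \<Rightarrow> Some (\<alpha>' @ \<beta>) | None \<Rightarrow> map_option ((@) \<alpha>) (grow k \<beta>))"
  by (induction \<alpha>; cases "grow k \<beta>") (auto split: option.splits)

text \<open>Both words grow in parallel from the right. In \<open>x @ [0]\<close> the row started by the last
  letter stays at the bottom and has length \<open>passes x + 1\<close>. A letter that moves the hole
  prolongs this row, and the lowered letter prolongs a row of length \<open>passes x\<close> instead, which
  changes the part to be removed accordingly; for any other letter growth commutes with
  removal.\<close>

lemma run_lowered:
  "yamanouchi (x @ [0]) \<Longrightarrow> passes x \<le> j \<Longrightarrow> \<exists>\<gamma> \<alpha>. run (x @ [0]) [] = Some (\<gamma> @ [Suc (passes x)]) \<and>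
     run (lowered j x) [] = Some \<alpha> \<and>
     (if passes x = 0 then \<gamma> = \<alpha> else passes x \<in> set \<alpha> \<and> \<gamma> = remove_part (passes x) \<alpha>)"
proof (induction x)
  case Nil
  then show ?case by (simp add: add_cell_def)
next
  case (Cons y x)
  define K where "K = passes x"
  have mono: "passes x \<le> passes (y # x)" by simp
  then obtain \<gamma> \<alpha> where IH: "run (x @ [0]) [] = Some (\<gamma> @ [Suc K])" "run (lowered j x) [] = Some \<alpha>"
    "if K = 0 then \<gamma> = \<alpha> else K \<in> set \<alpha> \<and> \<gamma> = remove_part K \<alpha>"
    using Cons unfolding K_def by (metis append_Cons le_trans yamanouchi.simps(2))
  have pos: "0 \<notin> set \<gamma>" "0 \<notin> set \<alpha>" using run_Comp[OF IH(1)] run_Comp[OF IH(2)] by (auto simp: Comp_def)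
  have cnt: "count_list (x @ [0]) K = count_list (x @ [0]) (Suc K) + count_list \<gamma> (Suc K) + 1"
    using part_count[OF IH(1), of "Suc K"] by simp
  have pass: "passes (y # x) = (if y = Suc K \<and> Suc K \<notin> set \<gamma> then Suc K else K)"
    using cnt count_list_0_iff[of \<gamma> "Suc K"] by (auto simp: K_def[symmetric])
  have low: "lowered j (y # x) = (if y = Suc K \<and> Suc K \<notin> set \<gamma> then K else y) # lowered j x"
    using Cons.prems(2) pass by (auto simp: K_def[symmetric] simp del: passes.simps split: if_splits)
  have "run (y # x @ [0]) [] \<noteq> None" using Cons.prems(1) yamanouchi_iff_run[of "y # x @ [0]"] by simp
  then have def: "add_cell y (\<gamma> @ [Suc K]) \<noteq> None" using IH(1) by simp
  consider "y = 0" | "0 < y" "y \<in> set \<gamma>" | "0 < y" "y \<notin> set \<gamma>" by blast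
  then show ?case
  proof cases
    case 1
    then show ?thesis using IH pass low remove_part_one[of K \<alpha>]
      by (auto simp: add_cell_def simp del: passes.simps lowered.simps remove_part.simps split: if_splits)
  next
    case 2
    then obtain \<gamma>' where g: "grow y \<gamma> = Some \<gamma>'" using grow_None[of y \<gamma>] by auto
    have "\<exists>\<alpha>'. grow y \<alpha> = Some \<alpha>' \<and> (if K = 0 then \<gamma>' = \<alpha>' else K \<in> set \<alpha>' \<and> \<gamma>' = remove_part K \<alpha>')"
    proof (cases "K = 0")
      case False
      then show ?thesis using IH(3) remove_part_grow[of K \<alpha> y \<gamma>'] g by auto
    qed (use IH(3) g in auto)
    then show ?thesis using 2 IH(1,2) g pass low
      by (auto simp: add_cell_def grow_append simp del: passes.simps lowered.simps remove_part.simps)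
  next
    case 3
    then have g: "grow y \<gamma> = None" using grow_None by blast
    then have y: "y = Suc K" using def 3 by (auto simp: add_cell_def grow_append split: if_splits)
    have "\<exists>\<alpha>'. add_cell K \<alpha> = Some \<alpha>' \<and> Suc K \<in> set \<alpha>' \<and> \<gamma> = remove_part (Suc K) \<alpha>'"
    proof (cases "K = 0")
      case True
      have "\<forall>d\<in>set \<gamma>. 1 < d" using 3 y True pos(1) by (metis One_nat_def Suc_lessI gr0I)
      then show ?thesis using True IH(3) remove_part_last[of \<gamma> 1] by (auto simp: add_cell_def simp del: remove_part.simps)
    next
      case False
      then obtain \<alpha>' where \<alpha>': "grow K \<alpha> = Some \<alpha>'" using IH(3) grow_None[of K \<alpha>] by auto
      have "Suc K \<notin> set \<alpha>" using False IH(3) remove_part_mset[of K \<alpha>] 3 y by (metis add_mset_remove_trivial_eq insert_noteq_member n_not_Suc_n set_mset_mset)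
      then show ?thesis using remove_part_grow_next[of K \<alpha> \<alpha>'] grow_set[OF \<alpha>'] False IH(3) \<alpha>' by (auto simp: add_cell_def)
    qed
    then show ?thesis using 3 y g IH(1,2) pass low
      by (auto simp: add_cell_def[of "Suc K"] grow_append simp del: passes.simps lowered.simps remove_part.simps)
  qed
qed

section \<open>The straight word of a class\<close>

definition entry :: "nat list \<Rightarrow> nat \<Rightarrow> nat" where
  "entry xs i = (if i < length xs then xs ! i else 0)"

lemma entry_simps [simp]: "entry [] i = 0" "entry (x # xs) 0 = x" "entry (x # xs) (Suc i) = entry xs i"
  by (simp_all add: entry_def)

lemma entry_inject:
  "(\<And>i. entry xs i = entry ys i) \<Longrightarrow> 0 \<notin> set xs \<Longrightarrow> 0 \<notin> set ys \<Longrightarrow> xs = ys"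
proof (induction xs arbitrary: ys)
  case Nil
  then show ?case using Nil.prems(1)[of 0] by (cases ys) auto
next
  case (Cons x xs)
  then obtain y ys' where ys: "ys = y # ys'" using Cons.prems(1)[of 0] by (cases ys) auto
  have "entry xs i = entry ys' i" for i using Cons.prems(1)[of "Suc i"] ys by simp
  then show ?case using Cons.IH[of ys'] Cons.prems(1)[of 0] Cons.prems ys by auto
qed

lemma filling_of_rows_entry:
  "filling_of_rows (r # rs) (0, k) = entry r k"
  "filling_of_rows (r # rs) (Suc i, k) = filling_of_rows rs (i, k)"
  "filling_of_rows [] c = 0"
  by (auto simp: filling_of_rows_def entry_def split: prod.splits)

lemma filling_of_rows_inject:
  "filling_of_rows rs = filling_of_rows rs' \<Longrightarrow> \<forall>r\<in>set rs. r \<noteq> [] \<and> 0 \<notin> set r \<Longrightarrow>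
   \<forall>r\<in>set rs'. r \<noteq> [] \<and> 0 \<notin> set r \<Longrightarrow> rs = rs'"
proof (induction rs arbitrary: rs')
  case Nil
  have "rs' = []"
  proof (rule ccontr)
    assume "rs' \<noteq> []"
    then obtain x r rs'' where "rs' = (x # r) # rs''" using Nil.prems by (metis list.set_intros(1) neq_Nil_conv)
    then show False using Nil.prems fun_cong[OF Nil.prems(1), of "(0, 0)"] by (simp add: filling_of_rows_entry)
  qed
  then show ?case by simp
next
  case (Cons r rs)
  then have "entry r 0 \<noteq> 0" by (cases r) auto
  then obtain r' rs'' where rs': "rs' = r' # rs''"
    using fun_cong[OF Cons.prems(1), of "(0, 0)"] by (cases rs') (auto simp: filling_of_rows_entry)
  have "entry r k = entry r' k" for k
    using fun_cong[OF Cons.prems(1), of "(0, k)"] rs' by (simp add: filling_of_rows_entry)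
  then have "r = r'" using Cons.prems rs' by (intro entry_inject) auto
  moreover have "filling_of_rows rs (i, k) = filling_of_rows rs'' (i, k)" for i k
    using fun_cong[OF Cons.prems(1), of "(Suc i, k)"] rs' by (simp add: filling_of_rows_entry)
  then have "filling_of_rows rs = filling_of_rows rs''" by (intro ext) (metis surj_pair)
  ultimately show ?case using Cons rs' by auto
qed

lemma insertion_rows: "\<forall>r\<in>set (fold insert_letter (reading e) []). r \<noteq> [] \<and> 0 \<notin> set r"
proof (intro ballI conjI)
  fix r assume r: "r \<in> set (fold insert_letter (reading e) [])"
  show "r \<noteq> []" using tableau_rows[OF insertion_tableau[OF distinct_reading] r] by simp
  have "set r \<subseteq> {1..length e}"
    using r insertion_set[of "reading e"] unfolding set_reading set_concat by blast
  then show "0 \<notin> set r" by auto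
qed

lemma same_rect_iff_P_tab: "same_rect d e \<longleftrightarrow> P_tab (reading d) = P_tab (reading e)"
  unfolding same_rect_def knuth_iff_insertion[OF distinct_reading distinct_reading] P_tab_def
  using filling_of_rows_inject[OF _ insertion_rows insertion_rows] by auto

lemma yamanouchi_letters: "yamanouchi e \<Longrightarrow> \<exists>m. set e = {..<m}"
proof (induction e)
  case (Cons k e)
  then obtain m where m: "set e = {..<m}" by auto
  have "k \<le> m"
  proof (cases "k = 0")
    case False
    then have "k - 1 \<in> set e" using Cons.prems count_list_0_iff[of e "k - 1"] by auto
    then show ?thesis using m by auto
  qed simp
  then consider "k = m" | "k < m" by linarith
  then show ?case
  proof cases
    case 1
    then have "set (k # e) = {..<Suc m}" using m by (simp add: lessThan_Suc)
    then show ?thesis ..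
  next
    case 2
    then have "set (k # e) = {..<m}" using m by (simp add: insert_absorb)
    then show ?thesis ..
  qed
qed (auto intro: exI[of _ 0])

lemma yamanouchi_count_mono:
  assumes "yamanouchi e" "k \<le> l"
  shows "count_list e l \<le> count_list e k"
  using assms(2)
proof (induction l rule: dec_induct)
  case (step l)
  then show ?case using yamanouchi_count[OF assms(1), of l] by simp
qed simp

text \<open>The lattice condition compares the numbers of large entries in two columns.\<close>

lemma yamanouchi_column_before:
  assumes "yamanouchi e" "k < l"
  shows "column_before (col_values e k) (col_values e l)"
  unfolding column_before_def
proof (rule dominates_if_counts)
  show "sorted_wrt (>) (rev (col_values e k))" "sorted_wrt (>) (rev (col_values e l))"
    using sorted_col_values by (simp_all add: sorted_wrt_rev)
  show "set (rev (col_values e k)) \<inter> set (rev (col_values e l)) = {}"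
    using assms(2) by (auto simp: set_col_values)
  fix t
  have "length (filter (\<lambda>x. t \<le> x) (rev (col_values e j))) = count_list (drop (t - 1) e) j" for j
  proof -
    have "filter (\<lambda>x. t \<le> x) (col_values e j) = filter (\<lambda>x. t - 1 < x) (col_values e j)"
      by (rule filter_cong) (auto simp: set_col_values)
    then show ?thesis by (simp add: count_col_values rev_filter[symmetric])
  qed
  moreover have "count_list (drop (t - 1) e) l \<le> count_list (drop (t - 1) e) k"
    using assms(2) yamanouchi_count_mono[OF yamanouchi_drop[OF assms(1)]] by simp
  ultimately show "length (filter (\<lambda>x. t \<le> x) (rev (col_values e l)))
      \<le> length (filter (\<lambda>x. t \<le> x) (rev (col_values e k)))" by simp
qed

text \<open>Sorted columns of a straight filling form a reverse tableau, which is the insertion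
  tableau of its column word.\<close>

lemma P_tab_yamanouchi:
  assumes "yamanouchi e"
  shows "P_tab (reading e) (i, k) = entry (rev (col_values e k)) i"
proof -
  obtain m where m: "set e = {..<m}" using yamanouchi_letters[OF assms] by blast
  have ks: "sorted_list_of_set (set e) = [0..<m]" unfolding m by (simp add: lessThan_atLeast0)
  have ne: "col_values e k \<noteq> []" if "k < m" for k
  proof -
    have "k \<in> set e" using m that by simp
    then obtain i where "i < length e" "e ! i = k" by (auto simp: in_set_conv_nth)
    then have "Suc i \<in> set (col_values e k)" by (simp add: set_col_values)
    then show ?thesis by auto
  qed
  have empty: "col_values e k = []" if "\<not> k < m"
  proof -
    have "k \<notin> set e" using that m by simp
    then have "\<not> (1 \<le> v \<and> v \<le> length e \<and> e ! (v - 1) = k)" for v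
      using nth_mem[of "v - 1" e] by auto
    then have "set (col_values e k) = {}" unfolding set_col_values by blast
    then show ?thesis by simp
  qed
  have "filling_of_rows (fold insert_letter (concat (map (col_values e) [0..<m])) []) (i, k) =
     (if k < length (map (col_values e) [0..<m]) \<and> i < length (map (col_values e) [0..<m] ! k)
      then rev (map (col_values e) [0..<m] ! k) ! i else 0)"
  proof (rule insertion_columns)
    show "\<forall>us\<in>set (map (col_values e) [0..<m]). us \<noteq> [] \<and> sorted_wrt (<) us"
      using ne sorted_col_values by auto
    show "sorted_wrt column_before (map (col_values e) [0..<m])"
      unfolding sorted_wrt_map
      by (rule sorted_wrt_mono_rel[of _ "(<)"]) (auto intro: yamanouchi_column_before[OF assms])
  qed
  then show ?thesis using empty by (auto simp: P_tab_def reading_def ks entry_def)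
qed

text \<open>The word can be recovered from the columns of the insertion tableau.\<close>

lemma same_rect_yamanouchi_unique:
  assumes "yamanouchi c" "yamanouchi d" "same_rect c d" shows "c = d"
proof -
  have len: "length c = length d" using assms(3) by (rule same_rect_length)
  have col: "col_values c k = col_values d k" for k
  proof -
    have "entry (rev (col_values c k)) i = entry (rev (col_values d k)) i" for i
      using assms P_tab_yamanouchi same_rect_iff_P_tab by metis
    then have "rev (col_values c k) = rev (col_values d k)"
      by (intro entry_inject) (auto simp: set_col_values)
    then show ?thesis by simp
  qed
  show ?thesis
  proof (rule nth_equalityI[OF len])
    fix i assume i: "i < length c"
    then have "Suc i \<in> set (col_values c (c ! i))" by (simp add: set_col_values)
    then show "c ! i = d ! i" unfolding col by (simp add: set_col_values)
  qed
qed

definition tab_column :: "nat \<Rightarrow> nat list list \<Rightarrow> nat list" where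
  "tab_column k rs = map (\<lambda>r. r ! k) (filter (\<lambda>r. k < length r) rs)"

lemma tab_column_simps [simp]:
  "tab_column k [] = []"
  "tab_column k (r # rs) = (if k < length r then r ! k # tab_column k rs else tab_column k rs)"
  by (simp_all add: tab_column_def)

lemma set_tab_column: "set (tab_column k rs) \<subseteq> set (concat rs)"
  by (induction rs) auto

lemma tab_column_empty: "tableau (r # rs) \<Longrightarrow> \<not> k < length r \<Longrightarrow> tab_column k rs = []"
proof (induction rs arbitrary: r)
  case (Cons s rs)
  then have "\<not> k < length s" by (auto simp: dominates_def)
  then show ?case using Cons.IH[of s] Cons.prems by auto
qed simp

lemma tab_column_decr: "tableau rs \<Longrightarrow> sorted_wrt (>) (tab_column k rs) \<and>
    (rs \<noteq> [] \<and> k < length (hd rs) \<longrightarrow> (\<forall>v\<in>set (tab_column k rs). v \<le> hd rs ! k))"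
proof (induction rs)
  case (Cons r rs)
  show ?case
  proof (cases "k < length r")
    case True
    have "v < r ! k" if v: "v \<in> set (tab_column k rs)" for v
    proof (cases rs)
      case (Cons s rs')
      then have d: "dominates r s" using Cons.prems by simp
      show ?thesis
      proof (cases "k < length s")
        case True
        then have "v \<le> s ! k" using Cons.IH Cons.prems v Cons by auto
        then show ?thesis using d True by (auto simp: dominates_def)
      next
        case False
        then show ?thesis using tab_column_empty[of s rs' k] Cons.prems v Cons by auto
      qed
    qed (use v in simp)
    then show ?thesis using True Cons by (auto simp: less_imp_le)
  next
    case False
    then show ?thesis using tab_column_empty[OF Cons.prems] by simp
  qed
qed simp

lemma filling_tab_column: "tableau rs \<Longrightarrow> filling_of_rows rs (i, k) = entry (tab_column k rs) i"
proof (induction rs arbitrary: i)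
  case (Cons r rs)
  show ?case
  proof (cases i)
    case 0
    then show ?thesis using tab_column_empty[OF Cons.prems, of k]
      by (auto simp: filling_of_rows_entry) (auto simp: entry_def)
  next
    case (Suc j)
    then show ?thesis using Cons tab_column_empty[OF Cons.prems, of k] by (auto simp: filling_of_rows_entry)
  qed
qed (simp add: filling_of_rows_entry)

lemma tab_column_unique:
  "distinct (concat rs) \<Longrightarrow> v \<in> set (tab_column k rs) \<Longrightarrow> v \<in> set (tab_column l rs) \<Longrightarrow> k = l"
proof (induction rs)
  case (Cons r rs)
  show ?case
  proof (cases "v \<in> set r")
    case True
    then have "v \<notin> set (concat rs)" using Cons.prems(1) by auto
    then have "v \<notin> set (tab_column k rs)" "v \<notin> set (tab_column l rs)" using set_tab_column by blast+
    then have "k < length r" "r ! k = v" "l < length r" "r ! l = v" using Cons.prems(2,3) by (auto split: if_splits)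
    then show ?thesis using Cons.prems(1) nth_eq_iff_index_eq[of r k l] by simp
  next
    case False
    then have "v \<in> set (tab_column k rs)" "v \<in> set (tab_column l rs)"
      using Cons.prems(2,3) by (auto split: if_splits)
    then show ?thesis using Cons.IH Cons.prems(1) by simp
  qed
qed simp

lemma tab_column_exists: "v \<in> set (concat rs) \<Longrightarrow> \<exists>k. v \<in> set (tab_column k rs)"
proof (induction rs)
  case (Cons r rs)
  show ?case
  proof (cases "v \<in> set r")
    case True
    then obtain k where "k < length r" "r ! k = v" by (auto simp: in_set_conv_nth)
    then show ?thesis by (intro exI[of _ k]) simp
  next
    case False
    then obtain k where "v \<in> set (tab_column k rs)" using Cons by auto
    then show ?thesis by (intro exI[of _ k]) simp
  qed
qed simp

lemma tab_column_count:
  "tableau rs \<Longrightarrow> length (filter (\<lambda>v. t < v) (tab_column (Suc k) rs)) \<le> length (filter (\<lambda>v. t < v) (tab_column k rs))"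
proof (induction rs)
  case (Cons r rs)
  have "r ! Suc k < r ! k" if "Suc k < length r" using that Cons.prems by (auto simp: sorted_wrt_iff_nth_less)
  then show ?case using Cons by auto
qed simp

lemma yamanouchi_if_counts:
  "(\<And>m i. count_list (drop m e) (Suc i) \<le> count_list (drop m e) i) \<Longrightarrow> yamanouchi e"
proof (induction e)
  case (Cons k e)
  have "yamanouchi e" by (rule Cons.IH) (use Cons.prems[of "Suc _"] in simp)
  moreover have "k = 0 \<or> count_list e k < count_list e (k - 1)"
    using Cons.prems[of 0 "k - 1"] by (cases k) auto
  ultimately show ?case by simp
qed simp

text \<open>Take the word of the columns of the insertion tableau. The lattice condition follows from
  the strict decrease of the rows.\<close>

lemma yamanouchi_exists: "\<exists>c. yamanouchi c \<and> same_rect c e"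
proof -
  define rs where "rs = fold insert_letter (reading e) []"
  define n where "n = length e"
  have rs: "tableau rs" "distinct (concat rs)" "set (concat rs) = {1..n}"
    unfolding rs_def n_def
    using insertion_tableau[OF distinct_reading] insertion_distinct[OF distinct_reading] insertion_set set_reading by auto
  \<comment> \<open>The letter of an entry is its column in the insertion tableau.\<close>
  define c where "c = map (\<lambda>v. THE k. v \<in> set (tab_column k rs)) [1..<Suc n]"
  have len: "length c = n" by (simp add: c_def)
  have c: "c ! (v - 1) = k \<longleftrightarrow> v \<in> set (tab_column k rs)" if v: "v \<in> {1..n}" for v k
  proof -
    obtain l where l: "v \<in> set (tab_column l rs)" using tab_column_exists rs(3) v by blast
    then have "(THE k. v \<in> set (tab_column k rs)) = l" using tab_column_unique[OF rs(2)] by blast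
    moreover have "c ! (v - 1) = (THE k. v \<in> set (tab_column k rs))"
      unfolding c_def using v by (subst nth_map) (auto simp del: upt_Suc)
    ultimately show ?thesis using l tab_column_unique[OF rs(2)] by auto
  qed
  have col: "rev (col_values c k) = tab_column k rs" for k
  proof (rule sorted_wrt_unique)
    show "sorted_wrt (>) (rev (col_values c k))" using sorted_col_values by (simp add: sorted_wrt_rev)
    show "sorted_wrt (>) (tab_column k rs)" using tab_column_decr[OF rs(1)] by blast
    show "set (rev (col_values c k)) = set (tab_column k rs)"
      using c set_tab_column[of k rs] rs(3) by (auto simp: set_col_values len)
  qed auto
  have "yamanouchi c"
  proof (rule yamanouchi_if_counts)
    fix m i
    have "count_list (drop m c) k = length (filter (\<lambda>v. m < v) (tab_column k rs))" for k
      unfolding col[symmetric] by (simp add: count_col_values rev_filter[symmetric])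
    then show "count_list (drop m c) (Suc i) \<le> count_list (drop m c) i"
      using tab_column_count[OF rs(1)] by simp
  qed
  moreover have "P_tab (reading c) (i, k) = P_tab (reading e) (i, k)" for i k
    using P_tab_yamanouchi[OF \<open>yamanouchi c\<close>, of i k] filling_tab_column[OF rs(1), of i k] col[of k]
    by (simp add: P_tab_def rs_def)
  then have "P_tab (reading c) = P_tab (reading e)" by (intro ext) (metis surj_pair)
  ultimately show ?thesis using same_rect_iff_P_tab by blast
qed

section \<open>The shape of the rectification\<close>

definition rect_shape :: "nat list \<Rightarrow> nat list \<Rightarrow> bool" where
  "rect_shape e \<alpha> \<longleftrightarrow> (\<exists>c. run c [] = Some \<alpha> \<and> same_rect c e)"

lemma rect_shape_exists: "\<exists>\<alpha>. rect_shape e \<alpha>"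
  using yamanouchi_exists[of e] yamanouchi_iff_run unfolding rect_shape_def by (metis not_None_eq)

lemma rect_shape_unique: "rect_shape e \<alpha> \<Longrightarrow> rect_shape e \<beta> \<Longrightarrow> \<alpha> = \<beta>"
proof -
  assume "rect_shape e \<alpha>" "rect_shape e \<beta>"
  then obtain c d where cd: "run c [] = Some \<alpha>" "same_rect c e" "run d [] = Some \<beta>" "same_rect d e"
    unfolding rect_shape_def by blast
  then have "c = d"
    using same_rect_yamanouchi_unique[of c d] yamanouchi_iff_run same_rect_sym same_rect_trans by (metis option.distinct(1))
  then show "\<alpha> = \<beta>" using cd by simp
qed

lemma rect_shape_run: "run c [] = Some \<alpha> \<Longrightarrow> rect_shape c \<alpha>"
  unfolding rect_shape_def using same_rect_refl by blast

lemma rect_shape_cong: "same_rect d e \<Longrightarrow> rect_shape d \<alpha> \<Longrightarrow> rect_shape e \<alpha>"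
  unfolding rect_shape_def using same_rect_trans by blast

text \<open>The content of a straight word gives the column lengths of its shape, hence the shape up
  to the order of the rows.\<close>

lemma run_mset_cong:
  assumes "run c [] = Some \<alpha>" "run d [] = Some \<beta>" "mset c = mset d"
  shows "mset \<alpha> = mset \<beta>"
proof (rule multiset_eqI)
  fix k
  show "count (mset \<alpha>) k = count (mset \<beta>) k"
  proof (cases "k = 0")
    case True
    have "\<alpha> \<in> Comp" "\<beta> \<in> Comp" using assms run_Comp by (auto simp: Comp_def)
    then have "0 \<notin># mset \<alpha>" "0 \<notin># mset \<beta>" by (auto simp: Comp_def)
    then have "count (mset \<alpha>) 0 = 0" "count (mset \<beta>) 0 = 0" unfolding not_in_iff .
    then show ?thesis using True by metis
  next
    case False
    then show ?thesis using part_count[OF assms(1), of k] part_count[OF assms(2), of k] count_list_mset_eq[OF assms(3)]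
      by (simp add: count_mset)
  qed
qed

text \<open>Let \<open>c = x @ [0]\<close> be the straight word in the class of \<open>d @ [y]\<close>. Then \<open>x\<close> lies in the
  class of \<open>d\<close>, so the complete slide turns \<open>x\<close> into a straight word of shape \<open>\<alpha>\<close>. By
  \<open>run_lowered\<close> the shape of \<open>c\<close> is obtained from \<open>\<alpha>\<close> by removing a part \<open>K\<close> and appending
  \<open>K + 1\<close>, where \<open>K\<close> is the number of passes, and \<open>K\<close> is determined by the content. The same
  holds for the images under the moves \<open>s\<close>, and the content is the same.\<close>

lemma rect_shape_snoc:
  assumes s: "\<forall>i\<in>set s. i + 2 < length d"
    and \<alpha>: "rect_shape d \<alpha>" "rect_shape (moves s d) \<alpha>"
    and \<gamma>: "rect_shape (d @ [y]) \<gamma>"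
  shows "rect_shape (moves s d @ [y]) \<gamma>"
proof -
  obtain c where c: "run c [] = Some \<gamma>" "same_rect c (d @ [y])" using \<gamma> by (auto simp: rect_shape_def)
  have "length c = Suc (length d)" using same_rect_length[OF c(2)] by simp
  then obtain x z where xz: "c = x @ [z]" by (metis length_Suc_conv_rev)
  \<comment> \<open>The first cell of a straight shape lies in the first column.\<close>
  have "yamanouchi (drop (length x) c)" using c yamanouchi_iff_run by (intro yamanouchi_drop) simp
  then have z: "z = 0" using xz by simp
  have lx: "length x = length d" using \<open>length c = Suc (length d)\<close> xz by simp
  have mv: "moves s (d @ [y]) = moves s d @ [y]" "moves s c = moves s x @ [0]"
    using moves_prefix[of s d "[y]"] moves_prefix[of s x "[0]"] s xz z lx by auto
  have sr: "same_rect (moves s x @ [0]) (moves s d @ [y])"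
    using same_rect_moves[OF c(2), of s] mv by simp
  have yx: "yamanouchi (x @ [0])" "yamanouchi (moves s x @ [0])"
    using c yamanouchi_iff_run[of c] yamanouchi_moves[of s c] mv(2) xz z by (simp_all del: yamanouchi_moves)
  obtain \<gamma>\<^sub>1 \<alpha>\<^sub>1 where 1: "run (x @ [0]) [] = Some (\<gamma>\<^sub>1 @ [Suc (passes x)])"
      "run (lowered (length x) x) [] = Some \<alpha>\<^sub>1"
      "if passes x = 0 then \<gamma>\<^sub>1 = \<alpha>\<^sub>1 else passes x \<in> set \<alpha>\<^sub>1 \<and> \<gamma>\<^sub>1 = remove_part (passes x) \<alpha>\<^sub>1"
    using run_lowered[OF yx(1) passes_le_length] by blast
  let ?x = "moves s x"
  obtain \<gamma>\<^sub>2 \<alpha>\<^sub>2 where 2: "run (?x @ [0]) [] = Some (\<gamma>\<^sub>2 @ [Suc (passes ?x)])"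
      "run (lowered (length ?x) ?x) [] = Some \<alpha>\<^sub>2"
      "if passes ?x = 0 then \<gamma>\<^sub>2 = \<alpha>\<^sub>2 else passes ?x \<in> set \<alpha>\<^sub>2 \<and> \<gamma>\<^sub>2 = remove_part (passes ?x) \<alpha>\<^sub>2"
    using run_lowered[OF yx(2) passes_le_length] by blast
  have "rect_shape d \<alpha>\<^sub>1"
    using rect_shape_run[OF 1(2)] same_rect_lowered[OF yx(1)] same_rect_snoc[of x 0 d y] c(2) xz z
    by (metis rect_shape_cong same_rect_sym)
  then have a1: "\<alpha>\<^sub>1 = \<alpha>" using \<alpha>(1) rect_shape_unique by blast
  have "rect_shape (moves s d) \<alpha>\<^sub>2"
    using rect_shape_run[OF 2(2)] same_rect_lowered[OF yx(2)] same_rect_snoc[OF sr]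
    by (metis rect_shape_cong same_rect_sym)
  then have a2: "\<alpha>\<^sub>2 = \<alpha>" using \<alpha>(2) rect_shape_unique by blast
  have "mset (\<gamma>\<^sub>1 @ [Suc (passes x)]) = mset (\<gamma>\<^sub>2 @ [Suc (passes ?x)])"
    by (rule run_mset_cong[OF 1(1) 2(1)]) simp
  \<comment> \<open>Replacing a part \<open>K\<close> by \<open>K + 1\<close> raises the sum of squares of the parts by \<open>2 * K + 1\<close>, so
    that the multiset of parts determines the number of passes.\<close>
  define sq where "sq M = (\<Sum>a\<in>#M. a * a)" for M :: "nat multiset"
  have sq: "sq (mset (\<gamma> @ [Suc K])) = sq (mset \<alpha>) + 2 * K + 1"
    if "if K = 0 then \<gamma> = \<alpha> else K \<in> set \<alpha> \<and> \<gamma> = remove_part K \<alpha>" for K \<gamma>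
    using that remove_part_mset[of K \<alpha>] by (cases "K = 0") (auto simp: sq_def)
  have "passes x = passes ?x"
    using sq[OF 1(3)[unfolded a1]] sq[OF 2(3)[unfolded a2]] \<open>mset _ = mset _\<close> by simp
  then have "\<gamma>\<^sub>1 @ [Suc (passes x)] = \<gamma>\<^sub>2 @ [Suc (passes ?x)]"
    using 1(3) 2(3) a1 a2 by (auto split: if_splits)
  then have "run (?x @ [0]) [] = Some \<gamma>" using 1(1) 2(1) c(1) xz z by simp
  then show ?thesis using rect_shape_run rect_shape_cong[OF sr] by blast
qed

text \<open>The induction needs the shapes of the rectifications of \<open>d @ u\<close> and \<open>moves s d @ u\<close> to
  agree for each prefix \<open>u\<close>, and this is what it proves.\<close>

lemma rect_shape_append:
  assumes "\<forall>i\<in>set s. i + 2 < length d" "rect_shape d \<alpha>" "rect_shape (moves s d) \<alpha>"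
  shows "rect_shape (d @ u) \<gamma> \<Longrightarrow> rect_shape (moves s d @ u) \<gamma>"
proof (induction u arbitrary: \<gamma> rule: rev_induct)
  case Nil
  then show ?case using assms rect_shape_unique by fastforce
next
  case (snoc y u)
  obtain \<delta> where \<delta>: "rect_shape (d @ u) \<delta>" using rect_shape_exists by blast
  have mv: "moves s (d @ u) = moves s d @ u" using moves_prefix[OF assms(1)] .
  have "rect_shape (moves s (d @ u) @ [y]) \<gamma>"
    using assms(1) \<delta> snoc by (intro rect_shape_snoc[of s "d @ u" \<delta>]) (auto simp: mv)
  then show ?case by (simp add: mv)
qed

text \<open>Appending the word of \<open>U \<beta>\<close> to \<open>d\<close> yields a straight word of shape \<open>\<gamma>\<close>. The moves keep it
  straight because they preserve the lattice condition, and they keep its shape by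
  \<open>rect_shape_append\<close>.\<close>

lemma run_moves:
  assumes s: "\<forall>i\<in>set s. i + 2 < length d" "rect_shape d \<alpha>" "rect_shape (moves s d) \<alpha>"
    and \<beta>: "\<beta> \<in> Comp" and d: "run d \<beta> = Some \<gamma>"
  shows "run (moves s d) \<beta> = Some \<gamma>"
proof -
  have u: "run (U_word \<beta>) [] = Some \<beta>" using run_U_word[OF \<beta>, of "[]"] by simp
  have full: "run (d @ U_word \<beta>) [] = Some \<gamma>" using u d by (simp add: run_append)
  have mv: "moves s (d @ U_word \<beta>) = moves s d @ U_word \<beta>" using moves_prefix[OF s(1)] .
  have "yamanouchi (moves s d @ U_word \<beta>)" using full yamanouchi_iff_run yamanouchi_moves mv by (metis option.distinct(1))
  then obtain \<delta> where \<delta>: "run (moves s d @ U_word \<beta>) [] = Some \<delta>" using yamanouchi_iff_run by blast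
  have "\<delta> = \<gamma>"
    using rect_shape_append[OF s rect_shape_run[OF full]] rect_shape_run[OF \<delta>] rect_shape_unique by blast
  then show ?thesis using \<delta> u by (simp add: run_append)
qed

definition fiber :: "nat list \<Rightarrow> nat list \<Rightarrow> nat list \<Rightarrow> nat list set" where
  "fiber \<beta> \<gamma> c = {d. run d \<beta> = Some \<gamma> \<and> same_rect d c}"

text \<open>A sequence of moves that links \<open>c\<close> to \<open>c'\<close> maps the one set bijectively to the other.\<close>

theorem card_fiber:
  assumes "run c [] = Some \<alpha>" "run c' [] = Some \<alpha>" "\<beta> \<in> Comp"
  shows "card (fiber \<beta> \<gamma> c) = card (fiber \<beta> \<gamma> c')"
proof -
  obtain s where s: "\<forall>i\<in>set s. i + 2 < length c" "c' = moves s c"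
    using linked_same_mset[OF assms(1,2)] by (auto simp: linked_def)
  have into: "moves t d \<in> fiber \<beta> \<gamma> (moves t b)"
    if "d \<in> fiber \<beta> \<gamma> b" "run b [] = Some \<alpha>" "run (moves t b) [] = Some \<alpha>" "\<forall>i\<in>set t. i + 2 < length b" for t d b
  proof -
    have d: "run d \<beta> = Some \<gamma>" "same_rect d b" using that(1) by (auto simp: fiber_def)
    have sr: "same_rect (moves t d) (moves t b)" using d(2) by (rule same_rect_moves)
    have "rect_shape d \<alpha>" "rect_shape (moves t d) \<alpha>"
      using rect_shape_run that(2,3) d(2) sr rect_shape_cong same_rect_sym by blast+
    moreover have "\<forall>i\<in>set t. i + 2 < length d" using that(4) same_rect_length[OF d(2)] by simp
    ultimately show ?thesis using run_moves[OF _ _ _ assms(3) d(1)] sr by (auto simp: fiber_def)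
  qed
  have "bij_betw (moves s) (fiber \<beta> \<gamma> c) (fiber \<beta> \<gamma> c')"
  proof (rule bij_betw_byWitness[where f' = "moves (rev s)"])
    show "\<forall>d\<in>fiber \<beta> \<gamma> c. moves (rev s) (moves s d) = d" by simp
    show "\<forall>d\<in>fiber \<beta> \<gamma> c'. moves s (moves (rev s) d) = d" using moves_rev[of "rev s"] by simp
    show "moves s ` fiber \<beta> \<gamma> c \<subseteq> fiber \<beta> \<gamma> c'" using into assms(1,2) s by auto
    have "moves (rev s) c' = c" using s(2) by simp
    then show "moves (rev s) ` fiber \<beta> \<gamma> c' \<subseteq> fiber \<beta> \<gamma> c"
      using into[of _ c' "rev s"] assms(1,2) s by auto
  qed
  then show ?thesis by (rule bij_betw_same_card)
qed

section \<open>Kostka numbers and their expansion\<close>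

text \<open>In the word of a tableau with \<open>bs ! i\<close> entries equal to the \<open>i\<close>th value, the letters that
  belong to equal entries form a block, in which the columns decrease.\<close>

fun block_decreasing :: "nat list \<Rightarrow> nat list \<Rightarrow> bool" where
  "block_decreasing [] e \<longleftrightarrow> e = []"
| "block_decreasing (b # bs) e \<longleftrightarrow> b \<le> length e \<and> sorted_wrt (>) (take b e) \<and> block_decreasing bs (drop b e)"

lemma block_decreasing_length: "block_decreasing bs e \<Longrightarrow> length e = sum_list bs"
  by (induction bs arbitrary: e) force+

lemma block_decreasing_append: "block_decreasing (as @ bs) e \<longleftrightarrow> (\<exists>d d'. e = d @ d' \<and> block_decreasing as d \<and> block_decreasing bs d')"
proof (induction as arbitrary: e)
  case (Cons a as)
  show ?case (is "?L \<longleftrightarrow> ?R")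
  proof
    assume ?L
    then obtain d d' where d: "drop a e = d @ d'" "block_decreasing as d" "block_decreasing bs d'" "a \<le> length e" "sorted_wrt (>) (take a e)"
      using Cons by auto
    then have "e = (take a e @ d) @ d'" by (metis append.assoc append_take_drop_id)
    moreover have "block_decreasing (a # as) (take a e @ d)" using d by simp
    ultimately show ?R using d(3) by blast
  next
    assume ?R
    then obtain d d' where d: "e = d @ d'" "block_decreasing (a # as) d" "block_decreasing bs d'" by blast
    then have "block_decreasing (as @ bs) (drop a d @ d')" using Cons.IH[of "drop a d @ d'"] by auto
    then show ?L using d by simp
  qed
qed simp

lemma block_decreasing_cong:
  "length c = length e \<Longrightarrow> (\<And>i. Suc i < length e \<Longrightarrow> e ! Suc i < e ! i \<longleftrightarrow> c ! Suc i < c ! i) \<Longrightarrow>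
   block_decreasing bs e \<longleftrightarrow> block_decreasing bs c"
proof (induction bs arbitrary: e c)
  case Nil
  then show ?case by (metis block_decreasing.simps(1) length_0_conv)
next
  case (Cons b bs)
  have dec: "sorted_wrt (>) xs \<longleftrightarrow> (\<forall>i. Suc i < length xs \<longrightarrow> xs ! Suc i < xs ! i)" for xs :: "nat list"
    by (intro sorted_wrt_iff_nth_Suc_transp) (auto intro: transpI)
  have "block_decreasing bs (drop b e) \<longleftrightarrow> block_decreasing bs (drop b c)"
    using Cons.prems by (intro Cons.IH) (auto simp: add.commute)
  moreover have "sorted_wrt (>) (take b e) \<longleftrightarrow> sorted_wrt (>) (take b c)"
    unfolding dec using Cons.prems by auto
  ultimately show ?case using Cons.prems(1) by simp
qed

text \<open>A Knuth relation exchanges two letters that have a third one strictly between them.\<close>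

lemma knuth_filter_consecutive:
  "knuth v w \<Longrightarrow> filter (\<lambda>x. x \<in> {m, Suc m}) v = filter (\<lambda>x. x \<in> {m, Suc m}) w"
proof (induction rule: knuth_induct)
  case (step u w)
  have "filter (\<lambda>x. x \<in> {m, Suc m}) u = filter (\<lambda>x. x \<in> {m, Suc m}) w"
    using step(2) by (induction rule: knuth1.induct) auto
  then show ?case using step(3) by simp
next
  case (inv u w)
  have "filter (\<lambda>x. x \<in> {m, Suc m}) w = filter (\<lambda>x. x \<in> {m, Suc m}) u"
    using inv(2) by (induction rule: knuth1.induct) auto
  then show ?case using inv(3) by simp
qed simp

lemma descent_iff_reading:
  assumes "Suc i < length e"
  shows "e ! Suc i < e ! i \<longleftrightarrow> filter (\<lambda>x. x \<in> {Suc i, Suc (Suc i)}) (reading e) = [Suc (Suc i), Suc i]"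
proof -
  have sub: "w' = filter (\<lambda>x. x \<in> {Suc i, Suc (Suc i)}) (reading e)"
    if "sorted_wrt (earlier e) w'" "set w' = {Suc i, Suc (Suc i)}" for w'
  proof (rule reading_filter[OF that(1), symmetric])
    have "v \<in> {1..length e}" if "v \<in> {Suc i, Suc (Suc i)}" for v using that assms by auto
    then show "set w' = {v \<in> {1..length e}. v \<in> {Suc i, Suc (Suc i)}}" unfolding that(2) by blast
  qed
  show ?thesis
  proof (cases "e ! Suc i < e ! i")
    case True
    have "[Suc (Suc i), Suc i] = filter (\<lambda>x. x \<in> {Suc i, Suc (Suc i)}) (reading e)"
      by (rule sub) (use True in \<open>auto simp: earlier_def\<close>)
    then show ?thesis using True by simp
  next
    case False
    have "[Suc i, Suc (Suc i)] = filter (\<lambda>x. x \<in> {Suc i, Suc (Suc i)}) (reading e)"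
      by (rule sub) (use False in \<open>auto simp: earlier_def\<close>)
    then show ?thesis using False by (metis list.inject n_not_Suc_n)
  qed
qed

text \<open>A descent of the word means that the second of two consecutive values is read first, which
  is the same in Knuth equivalent reading words.\<close>

lemma block_decreasing_same_rect: "same_rect d e \<Longrightarrow> block_decreasing bs d \<longleftrightarrow> block_decreasing bs e"
  using block_decreasing_cong[of d e bs] descent_iff_reading[of _ d] descent_iff_reading[of _ e]
    knuth_filter_consecutive[of "reading d" "reading e"] same_rect_length[of d e]
  unfolding same_rect_def by auto

lemma finite_run: "finite {e. run e \<beta> = Some \<gamma>}"
proof (rule finite_subset)
  show "{e. run e \<beta> = Some \<gamma>} \<subseteq> {e. set e \<subseteq> {..<sum_list \<gamma>} \<and> length e = sum_list \<gamma> - sum_list \<beta>}"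
    using run_sum by fastforce
qed (simp add: finite_lists_length_eq)

definition Comps :: "nat \<Rightarrow> nat list set" where
  "Comps n = {\<alpha> \<in> Comp. sum_list \<alpha> = n}"

lemma finite_Comps: "finite (Comps n)"
proof (rule finite_subset)
  have "length \<alpha> \<le> sum_list \<alpha>" if "\<alpha> \<in> Comp" for \<alpha>
    using that by (induction \<alpha>) (auto simp: Comp_def)
  then show "Comps n \<subseteq> {\<alpha>. set \<alpha> \<subseteq> {..n} \<and> length \<alpha> \<le> n}"
    using member_le_sum_list by (fastforce simp: Comps_def)
qed (simp add: finite_lists_length_le)

text \<open>The number of semistandard tableaux of shape \<open>\<gamma>//\<beta>\<close> with content \<open>bs\<close>.\<close>

definition kostka :: "nat list \<Rightarrow> nat list \<Rightarrow> nat list \<Rightarrow> nat" where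
  "kostka \<beta> \<gamma> bs = card {e. run e \<beta> = Some \<gamma> \<and> block_decreasing bs e}"

text \<open>The number of standard tableaux of shape \<open>\<gamma>//\<beta>\<close> that rectify to \<open>U \<alpha>\<close>, see \<open>card_sct\<close>.\<close>

definition lr_coeff :: "nat list \<Rightarrow> nat list \<Rightarrow> nat list \<Rightarrow> nat" where
  "lr_coeff \<gamma> \<alpha> \<beta> = card (fiber \<beta> \<gamma> (U_word \<alpha>))"

lemma run_Comps: "run e [] = Some \<alpha> \<Longrightarrow> \<alpha> \<in> Comps (length e)"
  using run_Comp[of e "[]" \<alpha>] run_sum[of e "[]" \<alpha>] by (simp add: Comps_def Comp_def)

text \<open>Sort the words by their classes. Being decreasing on blocks depends only on the straight
  word \<open>c\<close> of the class, and by \<open>card_fiber\<close> the number of words in the class that lead from \<open>\<beta>\<close>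
  to \<open>\<gamma>\<close> depends only on the shape of \<open>c\<close>.\<close>

theorem kostka_expansion:
  assumes "\<beta> \<in> Comp"
  shows "kostka \<beta> \<gamma> bs = (\<Sum>\<alpha>\<in>Comps (sum_list bs). lr_coeff \<gamma> \<alpha> \<beta> * kostka [] \<alpha> bs)"
proof -
  \<comment> \<open>The straight words of shape \<open>\<alpha>\<close> with content \<open>bs\<close>.\<close>
  define C where "C \<alpha> = {c. run c [] = Some \<alpha> \<and> block_decreasing bs c}" for \<alpha>
  have fin: "finite (C \<alpha>)" for \<alpha> unfolding C_def by (rule finite_subset[OF _ finite_run[of "[]" \<alpha>]]) auto
  have finf: "finite (fiber \<beta> \<gamma> c)" for c
    unfolding fiber_def by (rule finite_subset[OF _ finite_run[of \<beta> \<gamma>]]) auto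
  have disj: "c = c'" if "d \<in> fiber \<beta> \<gamma> c" "d \<in> fiber \<beta> \<gamma> c'" "c \<in> C \<alpha>" "c' \<in> C \<alpha>'" for c c' d \<alpha> \<alpha>'
  proof (rule same_rect_yamanouchi_unique)
    show "yamanouchi c" "yamanouchi c'" using that yamanouchi_iff_run by (auto simp: C_def)
    show "same_rect c c'" using same_rect_trans[OF same_rect_sym, of d c c'] that(1,2) by (simp add: fiber_def)
  qed
  have "{e. run e \<beta> = Some \<gamma> \<and> block_decreasing bs e} = (\<Union>\<alpha>\<in>Comps (sum_list bs). \<Union>c\<in>C \<alpha>. fiber \<beta> \<gamma> c)"
  proof (intro equalityI subsetI)
    fix e assume e: "e \<in> {e. run e \<beta> = Some \<gamma> \<and> block_decreasing bs e}"
    obtain c where c: "yamanouchi c" "same_rect c e" using yamanouchi_exists by blast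
    then obtain \<alpha> where \<alpha>: "run c [] = Some \<alpha>" using yamanouchi_iff_run by blast
    have "block_decreasing bs c" using e block_decreasing_same_rect[OF c(2)] by simp
    then have "c \<in> C \<alpha>" "\<alpha> \<in> Comps (sum_list bs)"
      using \<alpha> run_Comps[OF \<alpha>] block_decreasing_length by (auto simp: C_def)
    moreover have "e \<in> fiber \<beta> \<gamma> c" using e same_rect_sym[OF c(2)] by (simp add: fiber_def)
    ultimately show "e \<in> (\<Union>\<alpha>\<in>Comps (sum_list bs). \<Union>c\<in>C \<alpha>. fiber \<beta> \<gamma> c)" by blast
  qed (auto simp: fiber_def C_def dest: block_decreasing_same_rect[of _ _ bs])
  then have "kostka \<beta> \<gamma> bs = card (\<Union>\<alpha>\<in>Comps (sum_list bs). \<Union>c\<in>C \<alpha>. fiber \<beta> \<gamma> c)"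
    by (simp add: kostka_def)
  also have "\<dots> = (\<Sum>\<alpha>\<in>Comps (sum_list bs). card (\<Union>c\<in>C \<alpha>. fiber \<beta> \<gamma> c))"
  proof (rule card_UN_disjoint)
    show "\<forall>\<alpha>\<in>Comps (sum_list bs). \<forall>\<alpha>'\<in>Comps (sum_list bs). \<alpha> \<noteq> \<alpha>' \<longrightarrow>
        (\<Union>c\<in>C \<alpha>. fiber \<beta> \<gamma> c) \<inter> (\<Union>c\<in>C \<alpha>'. fiber \<beta> \<gamma> c) = {}"
      using disj by (fastforce simp: C_def)
  qed (use finite_Comps fin finf in auto)
  also have "\<dots> = (\<Sum>\<alpha>\<in>Comps (sum_list bs). lr_coeff \<gamma> \<alpha> \<beta> * kostka [] \<alpha> bs)"
  proof (rule sum.cong[OF refl])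
    fix \<alpha> assume "\<alpha> \<in> Comps (sum_list bs)"
    then have U: "run (U_word \<alpha>) [] = Some \<alpha>" using run_U_word[of \<alpha> "[]"] by (simp add: Comps_def)
    have "card (\<Union>c\<in>C \<alpha>. fiber \<beta> \<gamma> c) = (\<Sum>c\<in>C \<alpha>. card (fiber \<beta> \<gamma> c))"
      by (rule card_UN_disjoint) (use fin finf disj in blast)+
    also have "\<dots> = (\<Sum>c\<in>C \<alpha>. lr_coeff \<gamma> \<alpha> \<beta>)"
      unfolding lr_coeff_def by (rule sum.cong[OF refl], rule card_fiber[OF _ U assms]) (simp add: C_def)
    finally show "card (\<Union>c\<in>C \<alpha>. fiber \<beta> \<gamma> c) = lr_coeff \<gamma> \<alpha> \<beta> * kostka [] \<alpha> bs"
      by (simp add: kostka_def C_def)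
  qed
  finally show ?thesis .
qed

text \<open>Cut the words in two and sort by the intermediate composition.\<close>

lemma kostka_append:
  "kostka [] \<gamma> (as @ bs) = (\<Sum>\<beta>\<in>Comps (sum_list bs). kostka \<beta> \<gamma> as * kostka [] \<beta> bs)"
proof -
  define X where "X \<beta> = {d. run d \<beta> = Some \<gamma> \<and> block_decreasing as d}" for \<beta>
  define Y where "Y \<beta> = {d. run d [] = Some \<beta> \<and> block_decreasing bs d}" for \<beta>
  have fin: "finite (X \<beta>)" "finite (Y \<beta>)" for \<beta>
    unfolding X_def Y_def by (rule finite_subset[OF _ finite_run]; blast)+
  have inj: "inj_on (\<lambda>(d, d'). d @ d') (\<Union>\<beta>\<in>Comps (sum_list bs). X \<beta> \<times> Y \<beta>)"
    by (rule inj_onI) (auto simp: X_def Y_def dest!: block_decreasing_length)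
  have "{e. run e [] = Some \<gamma> \<and> block_decreasing (as @ bs) e} = (\<lambda>(d, d'). d @ d') ` (\<Union>\<beta>\<in>Comps (sum_list bs). X \<beta> \<times> Y \<beta>)"
  proof (intro equalityI subsetI)
    fix e assume "e \<in> {e. run e [] = Some \<gamma> \<and> block_decreasing (as @ bs) e}"
    then obtain d d' where d: "e = d @ d'" "block_decreasing as d" "block_decreasing bs d'" "run (d @ d') [] = Some \<gamma>"
      by (auto simp: block_decreasing_append)
    then obtain \<beta> where \<beta>: "run d' [] = Some \<beta>" "run d \<beta> = Some \<gamma>"
      by (auto simp: run_append split: Option.bind_splits)
    have "\<beta> \<in> Comps (sum_list bs)" using run_Comps[OF \<beta>(1)] block_decreasing_length[OF d(3)] by simp
    then show "e \<in> (\<lambda>(d, d'). d @ d') ` (\<Union>\<beta>\<in>Comps (sum_list bs). X \<beta> \<times> Y \<beta>)"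
      using d \<beta> by (auto simp: X_def Y_def)
  qed (auto simp: X_def Y_def run_append block_decreasing_append)
  then have "kostka [] \<gamma> (as @ bs) = card (\<Union>\<beta>\<in>Comps (sum_list bs). X \<beta> \<times> Y \<beta>)"
    by (simp add: kostka_def card_image[OF inj])
  also have "\<dots> = (\<Sum>\<beta>\<in>Comps (sum_list bs). card (X \<beta> \<times> Y \<beta>))"
  proof (rule card_UN_disjoint)
    show "\<forall>\<beta>\<in>Comps (sum_list bs). finite (X \<beta> \<times> Y \<beta>)" using fin by simp
    show "\<forall>\<beta>\<in>Comps (sum_list bs). \<forall>\<beta>'\<in>Comps (sum_list bs). \<beta> \<noteq> \<beta>' \<longrightarrow>
        (X \<beta> \<times> Y \<beta>) \<inter> (X \<beta>' \<times> Y \<beta>') = {}" by (auto simp: Y_def)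
  qed (rule finite_Comps)
  finally show ?thesis by (simp add: card_cartesian_product kostka_def X_def Y_def)
qed

section \<open>Unitriangularity of the Kostka numbers\<close>

text \<open>The sum of the columns of all cells in the diagram of \<open>\<alpha>\<close>.\<close>

definition level :: "nat list \<Rightarrow> nat" where
  "level \<alpha> = sum_list (map (\<lambda>a. \<Sum>{..<a}) \<alpha>)"

lemma level_run: "run e [] = Some \<alpha> \<Longrightarrow> sum_list e = level \<alpha>"
proof (induction e arbitrary: \<alpha>)
  case (Cons k e)
  then obtain \<alpha>' where \<alpha>': "run e [] = Some \<alpha>'" "add_cell k \<alpha>' = Some \<alpha>" by (auto split: Option.bind_splits)
  have "grow k \<delta> = Some \<delta>' \<Longrightarrow> level \<delta>' = level \<delta> + k" for \<delta> \<delta>'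
    by (induction \<delta> arbitrary: \<delta>') (auto simp: level_def lessThan_Suc split: if_splits)
  then have "level \<alpha> = level \<alpha>' + k" using \<alpha>'(2) by (auto simp: add_cell_def level_def split: if_splits)
  then show ?case using Cons.IH[OF \<alpha>'(1)] by simp
qed (simp add: level_def)

lemma decreasing_head: "sorted_wrt (>) (x # xs) \<Longrightarrow> length xs \<le> (x :: nat)"
proof (induction xs arbitrary: x)
  case (Cons y xs)
  have "length xs \<le> y" using Cons.prems by (intro Cons.IH) simp
  then show ?case using Cons.prems by simp
qed simp

lemma decreasing_sum:
  "sorted_wrt (>) (xs :: nat list) \<Longrightarrow> \<Sum>{..<length xs} \<le> sum_list xs \<and>
     (sum_list xs = \<Sum>{..<length xs} \<longrightarrow> xs = rev [0..<length xs])"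
proof (induction xs)
  case (Cons x xs)
  have "length xs \<le> x" using Cons.prems by (rule decreasing_head)
  then show ?case using Cons by (auto simp: lessThan_Suc)
qed simp

text \<open>A decreasing block of length \<open>b\<close> has at least the sum of the block \<open>b - 1, ..., 0\<close>, with
  equality for this block only.\<close>

lemma block_decreasing_sum: "block_decreasing bs e \<Longrightarrow> level bs \<le> sum_list e \<and> (sum_list e = level bs \<longrightarrow> e = U_word bs)"
proof (induction bs arbitrary: e)
  case (Cons b bs)
  have IH: "level bs \<le> sum_list (drop b e)" "sum_list (drop b e) = level bs \<longrightarrow> drop b e = U_word bs"
    using Cons by auto
  have "length (take b e) = b" "sorted_wrt (>) (take b e)" using Cons.prems by auto
  then have b: "\<Sum>{..<b} \<le> sum_list (take b e)" "sum_list (take b e) = \<Sum>{..<b} \<longrightarrow> take b e = rev [0..<b]"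
    using decreasing_sum[of "take b e"] by metis+
  have "sum_list e = sum_list (take b e) + sum_list (drop b e)"
    by (metis append_take_drop_id sum_list_append)
  moreover have "level (b # bs) = \<Sum>{..<b} + level bs" by (simp add: level_def)
  ultimately show ?case using IH b append_take_drop_id[of b e] by auto
qed (simp add: level_def)

text \<open>The sum of the letters of a word is determined by the shape, and the content bounds it
  from below, with equality for the word of \<open>U bs\<close> only.\<close>

lemma kostka_triangular: "kostka [] \<alpha> bs \<noteq> 0 \<Longrightarrow> \<alpha> = bs \<or> level bs < level \<alpha>" if "bs \<in> Comp"
proof -
  assume "kostka [] \<alpha> bs \<noteq> 0"
  then have "{e. run e [] = Some \<alpha> \<and> block_decreasing bs e} \<noteq> {}"
    unfolding kostka_def by (metis card.empty)
  then obtain e where e: "run e [] = Some \<alpha>" "block_decreasing bs e" by blast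
  show ?thesis
  proof (cases "level bs < level \<alpha>")
    case False
    then have "e = U_word bs" using block_decreasing_sum[OF e(2)] level_run[OF e(1)] by simp
    then show ?thesis using e(1) run_U_word[OF that, of "[]"] by simp
  qed simp
qed

lemma block_decreasing_U_word: "block_decreasing bs (U_word bs)"
  by (induction bs) (auto simp: sorted_wrt_rev)

lemma kostka_diagonal: "bs \<in> Comp \<Longrightarrow> kostka [] bs bs = 1"
proof -
  assume bs: "bs \<in> Comp"
  have "{e. run e [] = Some bs \<and> block_decreasing bs e} = {U_word bs}"
    using block_decreasing_sum level_run run_U_word[OF bs, of "[]"] block_decreasing_U_word by fastforce
  then show ?thesis by (simp add: kostka_def)
qed

lemma kostka_sum: "kostka \<beta> \<gamma> bs \<noteq> 0 \<Longrightarrow> sum_list \<gamma> = sum_list \<beta> + sum_list bs"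
proof -
  assume "kostka \<beta> \<gamma> bs \<noteq> 0"
  then have "{e. run e \<beta> = Some \<gamma> \<and> block_decreasing bs e} \<noteq> {}"
    unfolding kostka_def by (metis card.empty)
  then show ?thesis using run_sum block_decreasing_length by fastforce
qed

lemma lr_coeff_sum: "lr_coeff \<gamma> \<alpha> \<beta> \<noteq> 0 \<Longrightarrow> sum_list \<gamma> = sum_list \<alpha> + sum_list \<beta>"
proof -
  assume "lr_coeff \<gamma> \<alpha> \<beta> \<noteq> 0"
  then have "fiber \<beta> \<gamma> (U_word \<alpha>) \<noteq> {}" by (auto simp: lr_coeff_def)
  then obtain d where "run d \<beta> = Some \<gamma>" "same_rect d (U_word \<alpha>)" by (auto simp: fiber_def)
  then show ?thesis using run_sum[of d \<beta> \<gamma>] same_rect_length[of d] block_decreasing_length[OF block_decreasing_U_word, of \<alpha>] by simp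
qed

section \<open>Placing and removing the smallest entry of a tableau\<close>

text \<open>Rows are now counted from the bottom, and row lengths are continued by zeros. Then the
  diagram of the inner shape need not be shifted.\<close>

definition part :: "nat list \<Rightarrow> nat \<Rightarrow> nat" where
  "part \<alpha> r = (if r < length \<alpha> then \<alpha> ! (length \<alpha> - 1 - r) else 0)"

lemma part_Nil [simp]: "part [] = (\<lambda>_. 0)"
  by (simp add: part_def fun_eq_iff)

lemma part_Cons: "part (a # \<alpha>) = (part \<alpha>)(length \<alpha> := a)"
proof
  fix r
  show "part (a # \<alpha>) r = ((part \<alpha>)(length \<alpha> := a)) r"
  proof (cases "r < length \<alpha>")
    case True
    then have "length (a # \<alpha>) - 1 - r = Suc (length \<alpha> - 1 - r)" by simp
    then show ?thesis using True by (simp add: part_def)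
  qed (auto simp: part_def)
qed

lemma part_nonzero: "\<alpha> \<in> Comp \<Longrightarrow> part \<alpha> r \<noteq> 0 \<longleftrightarrow> r < length \<alpha>"
  by (auto simp: part_def Comp_def)

lemma part_beyond: "length \<alpha> \<le> r \<Longrightarrow> part \<alpha> r = 0"
  by (simp add: part_def)

lemma part_inject:
  assumes "\<alpha> \<in> Comp" "\<beta> \<in> Comp" "part \<alpha> = part \<beta>" shows "\<alpha> = \<beta>"
proof -
  have "r < length \<alpha> \<longleftrightarrow> r < length \<beta>" for r using part_nonzero assms by metis
  then have len: "length \<alpha> = length \<beta>" by (metis less_irrefl linorder_neqE_nat)
  show ?thesis
  proof (rule nth_equalityI[OF len])
    fix i assume i: "i < length \<alpha>"
    then have "length \<alpha> - 1 - i < length \<alpha>" "length \<alpha> - 1 - (length \<alpha> - 1 - i) = i" by auto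
    then show "\<alpha> ! i = \<beta> ! i"
      using fun_cong[OF assms(3), of "length \<alpha> - 1 - i"] len by (simp add: part_def)
  qed
qed

text \<open>\<open>r\<close> is the row that \<open>add_cell k\<close> prolongs; for \<open>k = 0\<close> it is the row on top of all
  others.\<close>

definition addable :: "(nat \<Rightarrow> nat) \<Rightarrow> nat \<Rightarrow> nat \<Rightarrow> bool" where
  "addable G k r \<longleftrightarrow> G r = k \<and> (if k = 0 then \<forall>s. G s \<noteq> 0 \<longleftrightarrow> s < r else \<forall>s>r. G s \<noteq> k)"

lemma addable_unique: "addable G k r \<Longrightarrow> addable G k s \<Longrightarrow> r = s"
  unfolding addable_def by (metis linorder_neqE_nat less_irrefl)

lemma grow_addable: "grow k \<alpha> = Some \<alpha>' \<Longrightarrow> 0 < k \<Longrightarrow>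
    \<exists>r. addable (part \<alpha>) k r \<and> part \<alpha>' = (part \<alpha>)(r := Suc k) \<and> length \<alpha>' = length \<alpha>"
proof (induction \<alpha> arbitrary: \<alpha>')
  case (Cons a \<alpha>)
  show ?case
  proof (cases "a = k")
    case True
    then have "\<alpha>' = Suc k # \<alpha>" using Cons.prems by simp
    moreover have "addable (part (a # \<alpha>)) k (length \<alpha>)"
      using True Cons.prems(2) by (auto simp: addable_def part_Cons part_beyond)
    moreover have "part \<alpha>' = (part (a # \<alpha>))(length \<alpha> := Suc k)" "length \<alpha>' = length (a # \<alpha>)"
      using \<open>\<alpha>' = _\<close> by (simp_all add: part_Cons)
    ultimately show ?thesis by blast
  next
    case False
    then obtain \<delta> where \<delta>: "grow k \<alpha> = Some \<delta>" "\<alpha>' = a # \<delta>" using Cons.prems by auto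
    then obtain r where r: "addable (part \<alpha>) k r" "part \<delta> = (part \<alpha>)(r := Suc k)" "length \<delta> = length \<alpha>"
      using Cons.IH[OF \<delta>(1) Cons.prems(2)] by blast
    have rl: "r < length \<alpha>" using r(1) Cons.prems(2) part_beyond[of \<alpha> r] by (force simp: addable_def)
    have "addable (part (a # \<alpha>)) k r" using r(1) rl False Cons.prems(2) by (auto simp: addable_def part_Cons)
    moreover have "part \<alpha>' = (part (a # \<alpha>))(r := Suc k)" using \<delta> r rl by (auto simp: part_Cons)
    ultimately show ?thesis using \<delta> r by auto
  qed
qed simp

lemma add_cell_addable:
  assumes "add_cell k \<alpha> = Some \<alpha>'" "\<alpha> \<in> Comp"
  obtains r where "addable (part \<alpha>) k r" "part \<alpha>' = (part \<alpha>)(r := Suc k)"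
proof (cases "k = 0")
  case True
  then have "\<alpha>' = 1 # \<alpha>" using assms by (simp add: add_cell_def)
  moreover have "addable (part \<alpha>) k (length \<alpha>)"
    using True part_nonzero[OF assms(2)] by (simp add: addable_def part_beyond)
  ultimately show ?thesis using that[of "length \<alpha>"] True by (simp add: part_Cons)
next
  case False
  then show ?thesis using that grow_addable[of k \<alpha> \<alpha>'] assms by (auto simp: add_cell_def)
qed

lemma addable_add_cell:
  assumes "addable (part \<alpha>) k r" "\<alpha> \<in> Comp" "\<alpha>' \<in> Comp" "part \<alpha>' = (part \<alpha>)(r := Suc k)"
  shows "add_cell k \<alpha> = Some \<alpha>'"
proof -
  have "k = 0 \<or> k \<in> set \<alpha>"
    using assms(1) unfolding addable_def part_def by (auto split: if_splits)
  then have "add_cell k \<alpha> \<noteq> None" using grow_None[of k \<alpha>] by (auto simp: add_cell_def)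
  then obtain \<delta> where \<delta>: "add_cell k \<alpha> = Some \<delta>" by blast
  then obtain s where s: "addable (part \<alpha>) k s" "part \<delta> = (part \<alpha>)(s := Suc k)"
    using add_cell_addable assms(2) by blast
  then have "part \<delta> = part \<alpha>'" using addable_unique[OF assms(1) s(1)] assms(4) by simp
  then show ?thesis using part_inject add_cell_Comp[OF \<delta> assms(2)] assms(3) \<delta> by simp
qed

text \<open>Semistandard composition tableaux with the rows counted from the bottom and the outer and
  inner row lengths given by functions.\<close>

definition bottom_ssct :: "(nat \<Rightarrow> nat) \<Rightarrow> (nat \<Rightarrow> nat) \<Rightarrow> filling \<Rightarrow> bool" where
  "bottom_ssct B G T \<longleftrightarrow>
     (\<forall>r. B r \<le> G r) \<and>
     (\<forall>r k. T (r, k) \<noteq> 0 \<longleftrightarrow> B r \<le> k \<and> k < G r) \<and>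
     (\<forall>r k l. k \<le> l \<longrightarrow> T (r, k) \<noteq> 0 \<longrightarrow> T (r, l) \<noteq> 0 \<longrightarrow> T (r, l) \<le> T (r, k)) \<and>
     (\<forall>r s. s < r \<longrightarrow> T (r, 0) \<noteq> 0 \<longrightarrow> T (s, 0) \<noteq> 0 \<longrightarrow> T (r, 0) < T (s, 0)) \<and>
     (\<forall>r s k. s < r \<longrightarrow> k < G r \<longrightarrow> T (s, Suc k) \<noteq> 0 \<longrightarrow> B r \<le> Suc k \<longrightarrow>
        k < B r \<or> T (s, Suc k) \<le> T (r, k) \<longrightarrow> T (r, Suc k) \<noteq> 0 \<and> T (s, Suc k) < T (r, Suc k))"

lemma bottom_ssctD:
  assumes "bottom_ssct B G T"
  shows "B r \<le> G r" "T (r, k) \<noteq> 0 \<longleftrightarrow> B r \<le> k \<and> k < G r"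
    "k \<le> l \<Longrightarrow> T (r, k) \<noteq> 0 \<Longrightarrow> T (r, l) \<noteq> 0 \<Longrightarrow> T (r, l) \<le> T (r, k)"
    "s < r \<Longrightarrow> T (r, 0) \<noteq> 0 \<Longrightarrow> T (s, 0) \<noteq> 0 \<Longrightarrow> T (r, 0) < T (s, 0)"
    "s < r \<Longrightarrow> k < G r \<Longrightarrow> T (s, Suc k) \<noteq> 0 \<Longrightarrow> B r \<le> Suc k \<Longrightarrow>
        k < B r \<or> T (s, Suc k) \<le> T (r, k) \<Longrightarrow> T (r, Suc k) \<noteq> 0 \<and> T (s, Suc k) < T (r, Suc k)"
proof -
  note F = assms[unfolded bottom_ssct_def]
  show "B r \<le> G r" by (rule F[THEN conjunct1, rule_format])
  show "T (r, k) \<noteq> 0 \<longleftrightarrow> B r \<le> k \<and> k < G r"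
    by (rule F[THEN conjunct2, THEN conjunct1, rule_format])
  show "k \<le> l \<Longrightarrow> T (r, k) \<noteq> 0 \<Longrightarrow> T (r, l) \<noteq> 0 \<Longrightarrow> T (r, l) \<le> T (r, k)"
    by (rule F[THEN conjunct2, THEN conjunct2, THEN conjunct1, rule_format])
  show "s < r \<Longrightarrow> T (r, 0) \<noteq> 0 \<Longrightarrow> T (s, 0) \<noteq> 0 \<Longrightarrow> T (r, 0) < T (s, 0)"
    by (rule F[THEN conjunct2, THEN conjunct2, THEN conjunct2, THEN conjunct1, rule_format])
  show "s < r \<Longrightarrow> k < G r \<Longrightarrow> T (s, Suc k) \<noteq> 0 \<Longrightarrow> B r \<le> Suc k \<Longrightarrow>
        k < B r \<or> T (s, Suc k) \<le> T (r, k) \<Longrightarrow> T (r, Suc k) \<noteq> 0 \<and> T (s, Suc k) < T (r, Suc k)"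
    by (rule F[THEN conjunct2, THEN conjunct2, THEN conjunct2, THEN conjunct2, rule_format])
qed

text \<open>Equal entries in one column would violate the triple condition for the cell to the left of
  the upper one.\<close>

lemma bottom_ssct_column_neq:
  assumes T: "bottom_ssct B G T" and "s < r" "T (r, k) \<noteq> 0" "T (s, k) \<noteq> 0"
  shows "T (s, k) \<noteq> T (r, k)"
proof (cases k)
  case 0
  then show ?thesis using bottom_ssctD(4)[OF T \<open>s < r\<close>] assms by auto
next
  case (Suc l)
  show ?thesis
  proof
    assume eq: "T (s, k) = T (r, k)"
    have r: "B r \<le> k" "k < G r" using bottom_ssctD(2)[OF T] assms by auto
    have "l < B r \<or> T (s, Suc l) \<le> T (r, l)"
      using bottom_ssctD(2)[OF T, of r l] bottom_ssctD(3)[OF T, of l k r] r Suc eq assms by force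
    then show False using bottom_ssctD(5)[OF T \<open>s < r\<close>, of l] r Suc assms eq by simp
  qed
qed

lemma bottom_ssct_column_inj: "bottom_ssct B G T \<Longrightarrow> T (r, k) \<noteq> 0 \<Longrightarrow> T (r, k) = T (s, k) \<Longrightarrow> r = s"
  using bottom_ssct_column_neq[of B G T] by (metis linorder_neqE_nat)

text \<open>The pairs of an entry and its column. Within a column the entries are distinct, so no
  multiplicities are lost.\<close>

definition biletters :: "filling \<Rightarrow> (nat \<times> nat) set" where
  "biletters T = {(v, k). v \<noteq> 0 \<and> (\<exists>r. T (r, k) = v)}"

lemma biletters_iff: "(v, k) \<in> biletters T \<longleftrightarrow> v \<noteq> 0 \<and> (\<exists>r. T (r, k) = v)"
  by (simp add: biletters_def)

text \<open>The entries are removed by increasing size, equal ones from right to left. Words list the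
  columns in this order.\<close>

definition before :: "nat \<times> nat \<Rightarrow> nat \<times> nat \<Rightarrow> bool" where
  "before p q \<longleftrightarrow> fst p < fst q \<or> fst p = fst q \<and> snd q < snd p"

lemma before_asym: "before p q \<Longrightarrow> \<not> before q p"
  by (auto simp: before_def)

text \<open>A new smallest entry can violate the triple condition only as the lower entry of a triple
  whose upper row has length \<open>k\<close>, or in the first column below another row, and both are
  excluded since row \<open>r\<close> is addable.\<close>

lemma bottom_ssct_add:
  assumes T: "bottom_ssct B G T" and r: "addable G k r" and v: "v \<noteq> 0"
    and least: "\<forall>q\<in>biletters T. before (v, k) q"
  shows "bottom_ssct B (G(r := Suc k)) (T((r, k) := v)) \<and> biletters (T((r, k) := v)) = insert (v, k) (biletters T)"
proof
  note D = bottom_ssctD[OF T]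
  have Gr: "G r = k" using r by (simp add: addable_def)
  have zero: "T (r, l) = 0" if "k \<le> l" for l using D(2)[of r l] Gr that by auto
  have lt: "v < T (s, l) \<or> v = T (s, l) \<and> l < k" if "T (s, l) \<noteq> 0" for s l
  proof -
    have "(T (s, l), l) \<in> biletters T" using that unfolding biletters_iff by blast
    then have "before (v, k) (T (s, l), l)" using least by blast
    then show ?thesis by (simp add: before_def)
  qed
  let ?T = "T((r, k) := v)" and ?G = "G(r := Suc k)"
  show "biletters ?T = insert (v, k) (biletters T)"
  proof (rule set_eqI)
    fix q :: "nat \<times> nat"
    obtain u l where q: "q = (u, l)" by fastforce
    have "u \<noteq> 0 \<and> (\<exists>s. ?T (s, l) = u)" if "u \<noteq> 0" "T (s, l) = u" for s
    proof -
      have "?T (s, l) = u" using that zero[of k] by auto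
      then show ?thesis using that by blast
    qed
    moreover have "?T (r, k) = v" by simp
    ultimately show "q \<in> biletters ?T \<longleftrightarrow> q \<in> insert (v, k) (biletters T)"
      unfolding q insert_iff biletters_iff using v by (metis fun_upd_other prod.inject)
  qed
  show "bottom_ssct B ?G ?T"
    unfolding bottom_ssct_def
  proof (intro conjI allI impI)
    fix s show "B s \<le> ?G s" using D(1)[of s] Gr by auto
    fix l show "?T (s, l) \<noteq> 0 \<longleftrightarrow> B s \<le> l \<and> l < ?G s"
      using D(2)[of s l] D(1)[of r] Gr v by (auto simp: less_Suc_eq)
    fix l' assume "l \<le> l'" "?T (s, l) \<noteq> 0" "?T (s, l') \<noteq> 0"
    then show "?T (s, l') \<le> ?T (s, l)"
      using D(3)[of l l' s] lt[of s l] zero by (auto split: if_splits)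
  next
    fix r' s assume "s < r'" "?T (r', 0) \<noteq> 0" "?T (s, 0) \<noteq> 0"
    then show "?T (r', 0) < ?T (s, 0)"
      using D(4)[of s r'] lt[of s 0] r D(2)[of r' 0] by (auto simp: addable_def split: if_splits)
  next
    fix r' s l
    assume a: "s < r'" "l < ?G r'" "?T (s, Suc l) \<noteq> 0" "B r' \<le> Suc l"
      "l < B r' \<or> ?T (s, Suc l) \<le> ?T (r', l)"
    show "?T (r', Suc l) \<noteq> 0" "?T (s, Suc l) < ?T (r', Suc l)"
    proof -
      \<comment> \<open>The new cell is the lower one, the upper left one or the upper right one of the triple,
        or it does not belong to it.\<close>
      consider (new) "s = r" "k = Suc l" | (left) "r' = r" "l = k" | (right) "r' = r" "k = Suc l"
        | (old) "(s, Suc l) \<noteq> (r, k)" "(r', l) \<noteq> (r, k)" "(r', Suc l) \<noteq> (r, k)" by auto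
      then have "?T (r', Suc l) \<noteq> 0 \<and> ?T (s, Suc l) < ?T (r', Suc l)"
      proof cases
        case new
        then have "G r' \<noteq> k" "l < G r'" using r a(1,2) by (auto simp: addable_def)
        then have "T (r', k) \<noteq> 0" using D(2)[of r' k] a(4) new by auto
        then show ?thesis using lt[of r' k] new a(1) by auto
      next
        case left
        then have "T (s, Suc l) \<noteq> 0" using a(1,3) by auto
        then show ?thesis using lt[of s "Suc l"] left a D(1)[of r] Gr by auto
      next
        case right
        then have "T (s, k) \<noteq> 0" "l < G r" using a(1,3) Gr by auto
        then show ?thesis using D(5)[of s r l] zero[of k] right a by auto
      next
        case old
        then have "l < G r'" using a(2) Gr by (auto split: if_splits)
        then show ?thesis using D(5)[of s r' l] old a by auto
      qed
      then show "?T (r', Suc l) \<noteq> 0" "?T (s, Suc l) < ?T (r', Suc l)" by auto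
    qed
  qed
qed

text \<open>Conversely the smallest entry, the rightmost one among equals, stands at the end of its
  row, and this row is the topmost one of its length after the removal: a row of length \<open>k\<close>
  above it would violate the triple condition, and a row above it that starts with a larger
  entry would violate the order of the first column.\<close>

lemma bottom_ssct_remove:
  assumes T: "bottom_ssct (part \<beta>) (part \<gamma>) T" and Comp: "\<beta> \<in> Comp" "\<gamma> \<in> Comp"
    and least: "biletters T = insert (v, k) N" "(v, k) \<notin> N" "\<forall>q\<in>N. before (v, k) q"
  obtains r \<gamma>' where "T (r, k) = v" "\<gamma>' \<in> Comp" "bottom_ssct (part \<beta>) (part \<gamma>') (T((r, k) := 0))"
    "biletters (T((r, k) := 0)) = N" "addable (part \<gamma>') k r" "part \<gamma> = (part \<gamma>')(r := Suc k)"
proof -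
  note D = bottom_ssctD[OF T]
  have "(v, k) \<in> biletters T" using least(1) by simp
  then obtain r where r: "T (r, k) = v" "v \<noteq> 0" by (auto simp: biletters_iff)
  let ?B = "part \<beta>" and ?G = "part \<gamma>"
  have lt: "v < T (s, l) \<or> v = T (s, l) \<and> l < k" if "T (s, l) \<noteq> 0" "(s, l) \<noteq> (r, k)" for s l
  proof -
    have "(T (s, l), l) \<in> biletters T" using that by (auto simp: biletters_iff)
    moreover have "(T (s, l), l) \<noteq> (v, k)" using bottom_ssct_column_inj[OF T that(1), of r] that r by auto
    ultimately have "(T (s, l), l) \<in> N" using least(1) by blast
    then show ?thesis using least(3) by (auto simp: before_def)
  qed
  have rk: "?B r \<le> k" "k < ?G r" using D(2)[of r k] r by auto
  have Gr: "?G r = Suc k"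
  proof (rule ccontr)
    assume "?G r \<noteq> Suc k"
    then have "T (r, Suc k) \<noteq> 0" using D(2)[of r "Suc k"] rk by simp
    then show False using D(3)[of k "Suc k" r] lt[of r "Suc k"] r by auto
  qed
  have rl: "r < length \<gamma>" using part_nonzero[OF Comp(2), of r] Gr by simp
  \<comment> \<open>A row above would begin with a larger entry, although the first column increases from top
    to bottom.\<close>
  have top: "r = length \<gamma> - 1" if "k = 0"
  proof (rule ccontr)
    assume "r \<noteq> length \<gamma> - 1"
    then have l: "r < length \<gamma> - 1" using rl by simp
    define s where "s = length \<gamma> - 1"
    have "r < s" "s < length \<gamma>" using l by (auto simp: s_def)
    then have "?B r = 0" "?G s \<noteq> 0" using rk that part_nonzero[OF Comp(2)] by auto
    then have "length \<beta> \<le> r" using part_nonzero[OF Comp(1), of r] by simp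
    then have "?B s = 0" using \<open>r < s\<close> by (intro part_beyond) simp
    then have "T (s, 0) \<noteq> 0" using D(2)[of s 0] \<open>?G s \<noteq> 0\<close> by simp
    then show False using D(4)[OF \<open>r < s\<close>] lt[of s 0] r that \<open>r < s\<close> by auto
  qed
  \<comment> \<open>A row above of length \<open>k\<close> would have to continue with an entry larger than \<open>v\<close>.\<close>
  have other: "?G s \<noteq> k" if "k \<noteq> 0" "r < s" for s
  proof
    assume s: "?G s = k"
    from that(1) obtain l where l: "k = Suc l" using not0_implies_Suc by blast
    have "?B s \<le> k" using D(1)[of s] s by simp
    moreover have "l < ?B s \<or> T (r, Suc l) \<le> T (s, l)"
      using D(2)[of s l] lt[of s l] s l r that by auto
    ultimately have "T (s, k) \<noteq> 0" using D(5)[OF that(2), of l] s l r by simp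
    then show False using D(2)[of s k] s by simp
  qed
  obtain \<gamma>' where \<gamma>': "\<gamma>' \<in> Comp" "part \<gamma>' = ?G(r := k)"
  proof (cases "k = 0")
    case True
    obtain a \<delta> where \<gamma>: "\<gamma> = a # \<delta>" using rl by (cases \<gamma>) auto
    have "r = length \<delta>" using top[OF True] \<gamma> by simp
    then have "part \<delta> = ?G(r := k)" using \<gamma> True by (auto simp: part_Cons part_beyond)
    moreover have "\<delta> \<in> Comp" using Comp(2) \<gamma> by (simp add: Comp_def)
    ultimately show ?thesis using that by blast
  next
    case False
    let ?\<delta> = "\<gamma>[length \<gamma> - 1 - r := k]"
    have "part ?\<delta> = ?G(r := k)" using rl by (auto simp: part_def nth_list_update fun_eq_iff)
    moreover have "?\<delta> \<in> Comp"
      using Comp(2) False set_update_subset_insert[of \<gamma> "length \<gamma> - 1 - r" k] by (auto simp: Comp_def)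
    ultimately show ?thesis using that by blast
  qed
  have add: "addable (part \<gamma>') k r"
  proof (cases "k = 0")
    case True
    have "s < length \<gamma> \<longleftrightarrow> s \<le> r" for s using top[OF True] rl by linarith
    then have "?G s \<noteq> 0 \<longleftrightarrow> s \<le> r" for s using part_nonzero[OF Comp(2), of s] by simp
    then have "part \<gamma>' s \<noteq> 0 \<longleftrightarrow> s < r" for s
      unfolding \<gamma>'(2) using True by (cases "s = r") auto
    moreover have "part \<gamma>' r = k" by (simp add: \<gamma>'(2))
    ultimately show ?thesis unfolding addable_def using True by simp
  next
    case False
    then show ?thesis unfolding \<gamma>'(2) addable_def using other by auto
  qed
  have G: "?G = (part \<gamma>')(r := Suc k)" using Gr by (auto simp: \<gamma>'(2))
  let ?T = "T((r, k) := 0)"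
  have biletters: "biletters ?T = N"
  proof (rule set_eqI)
    fix q :: "nat \<times> nat"
    obtain u l where q: "q = (u, l)" by fastforce
    have "q \<in> biletters ?T \<longleftrightarrow> q \<in> biletters T \<and> q \<noteq> (v, k)"
    proof
      assume "q \<in> biletters ?T"
      then obtain s where s: "u \<noteq> 0" "?T (s, l) = u" unfolding q biletters_iff by blast
      then have "(s, l) \<noteq> (r, k)" "T (s, l) = u" by (auto split: if_splits)
      moreover from this have "(u, l) \<noteq> (v, k)" using bottom_ssct_column_inj[OF T, of r k s] r by auto
      ultimately show "q \<in> biletters T \<and> q \<noteq> (v, k)" using s(1) unfolding q biletters_iff by blast
    next
      assume a: "q \<in> biletters T \<and> q \<noteq> (v, k)"
      then obtain s where s: "u \<noteq> 0" "T (s, l) = u" unfolding q biletters_iff by blast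
      then have "(s, l) \<noteq> (r, k)" using a r(1) q by auto
      then have "?T (s, l) = u" using s by simp
      then show "q \<in> biletters ?T" using s(1) unfolding q biletters_iff by blast
    qed
    then show "q \<in> biletters ?T \<longleftrightarrow> q \<in> N" using least(1,2) by blast
  qed
  have "bottom_ssct ?B (part \<gamma>') ?T"
    unfolding bottom_ssct_def \<gamma>'(2)
  proof (intro conjI allI impI)
    fix s show "?B s \<le> (?G(r := k)) s" using D(1)[of s] rk by auto
    fix l show "?T (s, l) \<noteq> 0 \<longleftrightarrow> ?B s \<le> l \<and> l < (?G(r := k)) s"
      using D(2)[of s l] Gr rk by auto
    fix l' assume "l \<le> l'" "?T (s, l) \<noteq> 0" "?T (s, l') \<noteq> 0"
    then show "?T (s, l') \<le> ?T (s, l)" using D(3)[of l l' s] by (auto split: if_splits)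
  next
    fix r' s assume "s < r'" "?T (r', 0) \<noteq> 0" "?T (s, 0) \<noteq> 0"
    then show "?T (r', 0) < ?T (s, 0)" using D(4)[of s r'] by (auto split: if_splits)
  next
    fix r' s l
    assume a: "s < r'" "l < (?G(r := k)) r'" "?T (s, Suc l) \<noteq> 0" "?B r' \<le> Suc l"
      "l < ?B r' \<or> ?T (s, Suc l) \<le> ?T (r', l)"
    have s: "T (s, Suc l) \<noteq> 0" "(s, Suc l) \<noteq> (r, k)" "?T (s, Suc l) = T (s, Suc l)"
      using a(3) by (auto split: if_splits)
    have "l < ?G r'" "(r', l) \<noteq> (r, k)" using a(2) Gr by (auto split: if_splits)
    then have *: "T (r', Suc l) \<noteq> 0" "T (s, Suc l) < T (r', Suc l)"
      using D(5)[of s r' l] a(1,4,5) s by auto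
    moreover have "(r', Suc l) \<noteq> (r, k)" using *(2) lt[OF s(1,2)] r(1) by auto
    ultimately show "?T (r', Suc l) \<noteq> 0" "?T (s, Suc l) < ?T (r', Suc l)" using s(3) by auto
  qed
  then show ?thesis using that[of r \<gamma>'] r \<gamma>' biletters add G by blast
qed

section \<open>Tableaux correspond to words\<close>

text \<open>\<open>E\<close> lists the pairs of entries and columns of a tableau; the second components form its
  word.\<close>

definition sorted_biword :: "(nat \<times> nat) list \<Rightarrow> bool" where
  "sorted_biword E \<longleftrightarrow> sorted_wrt before E \<and> (\<forall>q\<in>set E. fst q \<noteq> 0)"

lemma sorted_biword_Cons:
  "sorted_biword ((v, k) # E) \<longleftrightarrow> v \<noteq> 0 \<and> (\<forall>q\<in>set E. before (v, k) q) \<and> sorted_biword E"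
  by (auto simp: sorted_biword_def)

lemma biletters_empty: "biletters T = {} \<longleftrightarrow> T = (\<lambda>_. 0)"
proof
  assume b: "biletters T = {}"
  have "T (r, k) = 0" for r k
  proof (rule ccontr)
    assume "T (r, k) \<noteq> 0"
    then have "(T (r, k), k) \<in> biletters T" unfolding biletters_iff by blast
    then show False using b by simp
  qed
  then show "T = (\<lambda>_. 0)" by auto
qed (auto simp: biletters_def)

lemma bottom_ssct_zero: "bottom_ssct (part \<beta>) (part \<gamma>) (\<lambda>_. 0) \<Longrightarrow> part \<beta> = part \<gamma>"
proof
  fix r
  assume T: "bottom_ssct (part \<beta>) (part \<gamma>) (\<lambda>_. 0)"
  show "part \<beta> r = part \<gamma> r" using bottom_ssctD(1)[OF T, of r] bottom_ssctD(2)[OF T, of r "part \<beta> r"] by auto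
qed

text \<open>Take away the entries one by one, in the order of \<open>before\<close>.\<close>

lemma bottom_ssct_run:
  "sorted_biword E \<Longrightarrow> \<beta> \<in> Comp \<Longrightarrow> \<gamma> \<in> Comp \<Longrightarrow> bottom_ssct (part \<beta>) (part \<gamma>) T \<Longrightarrow> biletters T = set E \<Longrightarrow>
   run (map snd E) \<beta> = Some \<gamma>"
proof (induction E arbitrary: \<gamma> T)
  case Nil
  then have "T = (\<lambda>_. 0)" using biletters_empty by simp
  then show ?case using bottom_ssct_zero part_inject Nil.prems by auto
next
  case (Cons q E)
  obtain v k where q: "q = (v, k)" by fastforce
  have E: "v \<noteq> 0" "\<forall>q\<in>set E. before (v, k) q" "sorted_biword E" using Cons.prems(1) q by (auto simp: sorted_biword_Cons)
  then have n: "(v, k) \<notin> set E" using before_asym by blast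
  have b: "biletters T = insert (v, k) (set E)" using Cons.prems(5) q by simp
  obtain r \<gamma>' where "T (r, k) = v" and r: "\<gamma>' \<in> Comp" "bottom_ssct (part \<beta>) (part \<gamma>') (T((r, k) := 0))"
    "biletters (T((r, k) := 0)) = set E" "addable (part \<gamma>') k r" "part \<gamma> = (part \<gamma>')(r := Suc k)"
    by (rule bottom_ssct_remove[OF Cons.prems(4,2,3) b n E(2)])
  have "run (map snd E) \<beta> = Some \<gamma>'" using Cons.IH[OF E(3) Cons.prems(2) r(1,2,3)] .
  then show ?case using addable_add_cell[OF r(4,1) Cons.prems(3) r(5)] q by simp
qed

text \<open>Place the entries one by one.\<close>

lemma run_bottom_ssct:
  "sorted_biword E \<Longrightarrow> \<beta> \<in> Comp \<Longrightarrow> run (map snd E) \<beta> = Some \<gamma> \<Longrightarrow>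
   \<exists>T. bottom_ssct (part \<beta>) (part \<gamma>) T \<and> biletters T = set E"
proof (induction E arbitrary: \<gamma>)
  case Nil
  then show ?case by (intro exI[of _ "\<lambda>_. 0"]) (auto simp: bottom_ssct_def biletters_empty)
next
  case (Cons q E)
  obtain v k where q: "q = (v, k)" by fastforce
  have E: "v \<noteq> 0" "\<forall>q\<in>set E. before (v, k) q" "sorted_biword E" using Cons.prems(1) q by (auto simp: sorted_biword_Cons)
  obtain \<gamma>' where \<gamma>': "run (map snd E) \<beta> = Some \<gamma>'" "add_cell k \<gamma>' = Some \<gamma>"
    using Cons.prems(3) q by (auto split: Option.bind_splits)
  obtain T where T: "bottom_ssct (part \<beta>) (part \<gamma>') T" "biletters T = set E" using Cons.IH[OF E(3) Cons.prems(2) \<gamma>'(1)] by blast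
  obtain r where r: "addable (part \<gamma>') k r" "part \<gamma> = (part \<gamma>')(r := Suc k)"
    using add_cell_addable[OF \<gamma>'(2)] run_Comp[OF \<gamma>'(1) Cons.prems(2)] by blast
  have "bottom_ssct (part \<beta>) (part \<gamma>) (T((r, k) := v)) \<and> biletters (T((r, k) := v)) = set (q # E)"
    unfolding r(2) q list.set T(2)[symmetric] using E(2) T(2) by (intro bottom_ssct_add[OF T(1) r(1) E(1)]) simp
  then show ?case by blast
qed

text \<open>The shape after the removal of the smallest entry is determined by the remaining pairs
  (\<open>bottom_ssct_run\<close>), and so is its row.\<close>

lemma bottom_ssct_unique:
  "sorted_biword E \<Longrightarrow> \<beta> \<in> Comp \<Longrightarrow> \<gamma> \<in> Comp \<Longrightarrow> bottom_ssct (part \<beta>) (part \<gamma>) T \<Longrightarrow> biletters T = set E \<Longrightarrow>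
   bottom_ssct (part \<beta>) (part \<gamma>) T' \<Longrightarrow> biletters T' = set E \<Longrightarrow> T = T'"
proof (induction E arbitrary: \<gamma> T T')
  case Nil
  then show ?case using biletters_empty by (metis list.set(1))
next
  case (Cons q E)
  obtain v k where q: "q = (v, k)" by fastforce
  have E: "v \<noteq> 0" "\<forall>q\<in>set E. before (v, k) q" "sorted_biword E" using Cons.prems(1) q by (auto simp: sorted_biword_Cons)
  then have n: "(v, k) \<notin> set E" using before_asym by blast
  have b: "biletters T = insert (v, k) (set E)" "biletters T' = insert (v, k) (set E)" using Cons.prems(5,7) q by simp_all
  obtain r \<delta> where r: "T (r, k) = v" "\<delta> \<in> Comp" "bottom_ssct (part \<beta>) (part \<delta>) (T((r, k) := 0))"
    "biletters (T((r, k) := 0)) = set E" "addable (part \<delta>) k r" "part \<gamma> = (part \<delta>)(r := Suc k)"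
    by (rule bottom_ssct_remove[OF Cons.prems(4,2,3) b(1) n E(2)])
  obtain r' \<delta>' where r': "T' (r', k) = v" "\<delta>' \<in> Comp" "bottom_ssct (part \<beta>) (part \<delta>') (T'((r', k) := 0))"
    "biletters (T'((r', k) := 0)) = set E" "addable (part \<delta>') k r'" "part \<gamma> = (part \<delta>')(r' := Suc k)"
    by (rule bottom_ssct_remove[OF Cons.prems(6,2,3) b(2) n E(2)])
  have "\<delta> = \<delta>'"
    using bottom_ssct_run[OF E(3) Cons.prems(2) r(2,3,4)] bottom_ssct_run[OF E(3) Cons.prems(2) r'(2,3,4)] by simp
  then have "T((r, k) := 0) = T'((r', k) := 0)"
    using Cons.IH[OF E(3) Cons.prems(2) r(2,3,4)] r'(3,4) by blast
  moreover have "r = r'" using addable_unique r(5) r'(5) \<open>\<delta> = \<delta>'\<close> by blast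
  ultimately have "(T((r, k) := 0))((r, k) := v) = (T'((r, k) := 0))((r, k) := v)" by simp
  then show ?case using r(1) r'(1) \<open>r = r'\<close> by (metis fun_upd_triv fun_upd_upd)
qed

lemma sorted_biword_exists: "finite N \<Longrightarrow> \<forall>q\<in>N. fst q \<noteq> 0 \<Longrightarrow> \<exists>E. sorted_biword E \<and> set E = N"
proof (induction "card N" arbitrary: N)
  case 0
  then show ?case by (intro exI[of _ "[]"]) (simp add: sorted_biword_def)
next
  case (Suc n)
  then have ne: "N \<noteq> {}" by auto
  \<comment> \<open>The first pair in the order \<open>before\<close>: equal entries are listed from right to left.\<close>
  define v where "v = Min (fst ` N)"
  define k where "k = Max {k. (v, k) \<in> N}"
  have v: "v \<in> fst ` N" "\<forall>q\<in>N. v \<le> fst q"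
    unfolding v_def using Suc.prems ne by (auto intro: Min_in)
  have fin: "finite {k. (v, k) \<in> N}"
    by (rule finite_subset[of _ "snd ` N"]) (use Suc.prems in force)+
  moreover have "{k. (v, k) \<in> N} \<noteq> {}" using v by force
  ultimately have k: "(v, k) \<in> N" using Max_in[of "{k. (v, k) \<in> N}"] unfolding k_def by blast
  have "n = card (N - {(v, k)})" using Suc.hyps(2) Suc.prems(1) k by simp
  from Suc.hyps(1)[OF this] obtain E where E: "sorted_biword E" "set E = N - {(v, k)}"
    using Suc.prems by blast
  have "before (v, k) q" if q: "q \<in> set E" for q
  proof -
    have "v \<le> fst q" using v(2) q E(2) by blast
    moreover have "snd q < k" if "v = fst q"
    proof -
      from that obtain l where l: "q = (v, l)" by (metis prod.collapse)
      have "q \<in> N" "q \<noteq> (v, k)" using q E(2) by blast+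
      then have "(v, l) \<in> N" "l \<noteq> k" using l by simp_all
      moreover from this have "l \<le> k" unfolding k_def by (intro Max_ge[OF fin]) simp
      ultimately show ?thesis using l by simp
    qed
    ultimately show ?thesis by (auto simp: before_def)
  qed
  then have "sorted_biword ((v, k) # E)" using E(1) Suc.prems(2) k by (auto simp: sorted_biword_Cons)
  moreover have "set ((v, k) # E) = N" using E(2) k by auto
  ultimately show ?case by blast
qed

text \<open>The passage between rows counted from the top and rows counted from the bottom.\<close>

definition flip :: "nat \<Rightarrow> filling \<Rightarrow> filling" where
  "flip l T = (\<lambda>(r, k). if r < l then T (l - 1 - r, k) else 0)"

lemma flip_apply: "flip l T (r, k) = (if r < l then T (l - 1 - r, k) else 0)"
  by (simp add: flip_def)

lemma cells_part: "(i, k) \<in> cells \<gamma> \<longleftrightarrow> i < length \<gamma> \<and> k < part \<gamma> (length \<gamma> - 1 - i)"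
  by (auto simp: cells_def part_def)

lemma inner_cells_part:
  assumes "length \<beta> \<le> length \<gamma>"
  shows "(i, k) \<in> inner_cells \<gamma> \<beta> \<longleftrightarrow> i < length \<gamma> \<and> k < part \<beta> (length \<gamma> - 1 - i)"
proof
  assume "(i, k) \<in> inner_cells \<gamma> \<beta>"
  then obtain j where j: "i = j + (length \<gamma> - length \<beta>)" "(j, k) \<in> cells \<beta>" by (auto simp: inner_cells_def)
  then have "length \<gamma> - 1 - i = length \<beta> - 1 - j" "i < length \<gamma>" using assms by (auto simp: cells_part)
  then show "i < length \<gamma> \<and> k < part \<beta> (length \<gamma> - 1 - i)" using j(2) by (simp add: cells_part)
next
  assume a: "i < length \<gamma> \<and> k < part \<beta> (length \<gamma> - 1 - i)"
  then have "length \<gamma> - 1 - i < length \<beta>" using part_beyond by (metis not_less not_less0)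
  then have "i = (i - (length \<gamma> - length \<beta>)) + (length \<gamma> - length \<beta>)"
    "length \<beta> - 1 - (i - (length \<gamma> - length \<beta>)) = length \<gamma> - 1 - i"
    "i - (length \<gamma> - length \<beta>) < length \<beta>" using a assms by auto
  then show "(i, k) \<in> inner_cells \<gamma> \<beta>" using a unfolding inner_cells_def cells_part
    by (intro CollectI exI[of _ "i - (length \<gamma> - length \<beta>)"] exI[of _ k]) auto
qed

lemma contained_part:
  assumes "\<beta> \<in> Comp" "\<gamma> \<in> Comp"
  shows "\<beta> \<Subset> \<gamma> \<longleftrightarrow> (\<forall>r. part \<beta> r \<le> part \<gamma> r)"
proof
  assume c: "\<beta> \<Subset> \<gamma>"
  show "\<forall>r. part \<beta> r \<le> part \<gamma> r"
  proof
    fix r show "part \<beta> r \<le> part \<gamma> r" using c by (auto simp: contained_def part_def)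
  qed
next
  assume p: "\<forall>r. part \<beta> r \<le> part \<gamma> r"
  have len: "length \<beta> \<le> length \<gamma>"
  proof (rule ccontr)
    assume "\<not> length \<beta> \<le> length \<gamma>"
    then have "part \<beta> (length \<gamma>) \<noteq> 0" using part_nonzero[OF assms(1)] by simp
    then show False using p[rule_format, of "length \<gamma>"] part_beyond[of \<gamma> "length \<gamma>"] by simp
  qed
  have "\<beta> ! (length \<beta> - 1 - i) \<le> \<gamma> ! (length \<gamma> - 1 - i)" if "i < length \<beta>" for i
    using p[rule_format, of i] that len by (simp add: part_def)
  then show "\<beta> \<Subset> \<gamma>" using len by (simp add: contained_def)
qed

lemma ssct_bottom_ssct:
  assumes "\<beta> \<in> Comp" "\<gamma> \<in> Comp"
  shows "ssct \<gamma> \<beta> T \<longleftrightarrow> (\<forall>i k. T (i, k) \<noteq> 0 \<longrightarrow> i < length \<gamma>) \<and> bottom_ssct (part \<beta>) (part \<gamma>) (flip (length \<gamma>) T)"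
proof -
  let ?l = "length \<gamma>" and ?B = "part \<beta>" and ?G = "part \<gamma>"
  let ?T = "flip ?l T"
  have G: "?G r = 0" if "\<not> r < ?l" for r using part_beyond that by simp
  have T1: "?T (?l - 1 - i, k) = T (i, k)" if "i < ?l" for i k using that by (auto simp: flip_apply)
  show ?thesis
  proof
    assume ssct: "ssct \<gamma> \<beta> T"
    then have len: "length \<beta> \<le> ?l" by (simp add: ssct_def contained_def)
    have skew: "(i, k) \<in> skew_cells \<gamma> \<beta> \<longleftrightarrow> i < ?l \<and> ?B (?l - 1 - i) \<le> k \<and> k < ?G (?l - 1 - i)" for i k
      unfolding skew_cells_def using cells_part inner_cells_part[OF len] by auto
    have supp: "T (i, k) \<noteq> 0 \<longleftrightarrow> (i, k) \<in> skew_cells \<gamma> \<beta>" for i k using ssct by (simp add: ssct_def)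
    have rows: "T (i, l) \<le> T (i, k)" if "k \<le> l" "T (i, k) \<noteq> 0" "T (i, l) \<noteq> 0" for i k l
      using ssct that unfolding supp by (simp add: ssct_def)
    have first: "T (i, 0) < T (j, 0)" if "i < j" "T (i, 0) \<noteq> 0" "T (j, 0) \<noteq> 0" for i j
      using ssct that unfolding supp by (simp add: ssct_def)
    have triple: "T (i, Suc k) \<noteq> 0 \<and> T (j, Suc k) < T (i, Suc k)"
      if "i < j" "i < ?l" "k < ?G (?l - 1 - i)" "T (j, Suc k) \<noteq> 0" "?B (?l - 1 - i) \<le> Suc k"
        "k < ?B (?l - 1 - i) \<or> T (j, Suc k) \<le> T (i, k)" for i j k
    proof -
      have "(i, k) \<in> cells \<gamma>" using that by (simp add: cells_part)
      moreover have "attacks \<gamma> \<beta> (i, k) (j, k + 1)"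
        using that unfolding attacks_def supp by (simp add: inner_cells_part[OF len])
      moreover have "(i, k) \<in> inner_cells \<gamma> \<beta> \<or> T (j, k + 1) \<le> T (i, k)"
        using that by (simp add: inner_cells_part[OF len])
      ultimately have "(i, k + 1) \<in> skew_cells \<gamma> \<beta> \<and> T (j, k + 1) < T (i, k + 1)"
        by (rule ssct[unfolded ssct_def, THEN conjunct2, THEN conjunct2, THEN conjunct2, THEN conjunct2, rule_format])
      then show ?thesis unfolding supp by simp
    qed
    have ind: "?T (r, k) = T (?l - 1 - r, k)" if "r < ?l" for r k using that by (simp add: flip_apply)
    have nz: "r < ?l" if "?T (r, k) \<noteq> 0" for r k using that by (simp add: flip_apply split: if_splits)
    show "(\<forall>i k. T (i, k) \<noteq> 0 \<longrightarrow> i < ?l) \<and> bottom_ssct ?B ?G ?T"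
    proof
      show "\<forall>i k. T (i, k) \<noteq> 0 \<longrightarrow> i < ?l" unfolding supp skew by blast
      show "bottom_ssct ?B ?G ?T"
        unfolding bottom_ssct_def
      proof (intro conjI allI impI)
        fix r show "?B r \<le> ?G r" using ssct contained_part[OF assms] by (simp add: ssct_def)
        fix k show "?T (r, k) \<noteq> 0 \<longleftrightarrow> ?B r \<le> k \<and> k < ?G r"
        proof (cases "r < ?l")
          case True
          then have "?l - 1 - (?l - 1 - r) = r" "?l - 1 - r < ?l" by auto
          then show ?thesis unfolding ind[OF True] supp skew by simp
        next
          case False
          then show ?thesis using G by (simp add: flip_apply)
        qed
        fix l assume "k \<le> l" "?T (r, k) \<noteq> 0" "?T (r, l) \<noteq> 0"
        then show "?T (r, l) \<le> ?T (r, k)" using rows[of k l "?l - 1 - r"] nz ind by metis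
      next
        fix r s assume a: "s < r" "?T (r, 0) \<noteq> 0" "?T (s, 0) \<noteq> 0"
        then have "r < ?l" "s < ?l" using nz by blast+
        then show "?T (r, 0) < ?T (s, 0)" using first[of "?l - 1 - r" "?l - 1 - s"] a ind by simp
      next
        fix r s k
        assume a: "s < r" "k < ?G r" "?T (s, Suc k) \<noteq> 0" "?B r \<le> Suc k" "k < ?B r \<or> ?T (s, Suc k) \<le> ?T (r, k)"
        have rs: "r < ?l" "s < ?l" using nz[OF a(3)] G[of r] a(2) by auto
        then have "?l - 1 - (?l - 1 - r) = r" by auto
        then have "T (?l - 1 - r, Suc k) \<noteq> 0 \<and> T (?l - 1 - s, Suc k) < T (?l - 1 - r, Suc k)"
          using a rs unfolding ind[OF rs(1)] ind[OF rs(2)] by (intro triple) auto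
        then show "?T (r, Suc k) \<noteq> 0" "?T (s, Suc k) < ?T (r, Suc k)" using rs ind by auto
      qed
    qed
  next
    assume a: "(\<forall>i k. T (i, k) \<noteq> 0 \<longrightarrow> i < ?l) \<and> bottom_ssct ?B ?G ?T"
    then have bottom_ssct: "bottom_ssct ?B ?G ?T" and il: "\<And>i k. T (i, k) \<noteq> 0 \<Longrightarrow> i < ?l" by blast+
    note D = bottom_ssctD[OF bottom_ssct]
    have con: "\<beta> \<Subset> \<gamma>" using D(1) contained_part[OF assms] by blast
    then have len: "length \<beta> \<le> ?l" by (simp add: contained_def)
    have skew: "(i, k) \<in> skew_cells \<gamma> \<beta> \<longleftrightarrow> i < ?l \<and> ?B (?l - 1 - i) \<le> k \<and> k < ?G (?l - 1 - i)" for i k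
      unfolding skew_cells_def using cells_part inner_cells_part[OF len] by auto
    have supp: "(i, k) \<in> skew_cells \<gamma> \<beta> \<longleftrightarrow> T (i, k) \<noteq> 0" for i k
      unfolding skew using D(2)[of "?l - 1 - i" k] T1[of i k] il[of i k] by auto
    show "ssct \<gamma> \<beta> T"
      unfolding ssct_def
    proof (intro conjI allI impI)
      show "\<beta> \<Subset> \<gamma>" by (rule con)
      fix c :: "nat \<times> nat" show "T c \<noteq> 0 \<longleftrightarrow> c \<in> skew_cells \<gamma> \<beta>" using supp by (cases c) simp
    next
      fix i k l assume "k \<le> l" "(i, k) \<in> skew_cells \<gamma> \<beta>" "(i, l) \<in> skew_cells \<gamma> \<beta>"
      then show "T (i, l) \<le> T (i, k)" unfolding supp using D(3)[of k l "?l - 1 - i"] T1[of i] il[of i] by simp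
    next
      fix i j assume b: "i < j" "(i, 0) \<in> skew_cells \<gamma> \<beta>" "(j, 0) \<in> skew_cells \<gamma> \<beta>"
      then have "i < ?l" "j < ?l" unfolding supp using il by blast+
      moreover from this have "?l - 1 - j < ?l - 1 - i" using b(1) by auto
      ultimately show "T (i, 0) < T (j, 0)" using b D(4)[of "?l - 1 - j" "?l - 1 - i"] T1 unfolding supp by simp
    next
      fix i j k
      assume b: "(i, k) \<in> cells \<gamma>" "attacks \<gamma> \<beta> (i, k) (j, k + 1)"
        "(i, k) \<in> inner_cells \<gamma> \<beta> \<or> T (j, k + 1) \<le> T (i, k)"
      have ij: "i < j" "T (j, Suc k) \<noteq> 0" using b(2) unfolding attacks_def supp by auto
      have i: "i < ?l" "j < ?l" using b(1) il[OF ij(2)] by (auto simp: cells_part)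
      have "?T (?l - 1 - i, Suc k) \<noteq> 0 \<and> ?T (?l - 1 - j, Suc k) < ?T (?l - 1 - i, Suc k)"
      proof (rule D(5))
        show "?l - 1 - j < ?l - 1 - i" using ij i by auto
        show "k < ?G (?l - 1 - i)" using b(1) by (simp add: cells_part)
        show "?T (?l - 1 - j, Suc k) \<noteq> 0" using ij T1 i by simp
        show "?B (?l - 1 - i) \<le> Suc k" using b(2) i by (simp add: attacks_def inner_cells_part[OF len])
        show "k < ?B (?l - 1 - i) \<or> ?T (?l - 1 - j, Suc k) \<le> ?T (?l - 1 - i, k)"
          using b(3) i T1 by (simp add: inner_cells_part[OF len])
      qed
      then show "(i, k + 1) \<in> skew_cells \<gamma> \<beta>" "T (j, k + 1) < T (i, k + 1)"
        unfolding supp using T1 i by simp_all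
    qed
  qed
qed

lemma biletters_flip:
  assumes "\<forall>i k. T (i, k) \<noteq> 0 \<longrightarrow> i < l"
  shows "biletters (flip l T) = biletters T"
proof -
  have "(\<exists>r. flip l T (r, k) = v) \<longleftrightarrow> (\<exists>r. T (r, k) = v)" if "v \<noteq> 0" for v k
  proof
    assume "\<exists>r. flip l T (r, k) = v"
    then show "\<exists>r. T (r, k) = v" using that by (auto simp: flip_apply split: if_splits)
  next
    assume "\<exists>r. T (r, k) = v"
    then obtain r where r: "T (r, k) = v" by blast
    then have "r < l" using assms that by blast
    then have "flip l T (l - 1 - r, k) = v" using r by (simp add: flip_apply)
    then show "\<exists>r. flip l T (r, k) = v" by blast
  qed
  then show ?thesis unfolding biletters_def by blast
qed

lemma flip_flip:
  assumes "\<forall>i k. T (i, k) \<noteq> 0 \<longrightarrow> i < l"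
  shows "flip l (flip l T) = T"
proof
  fix c show "flip l (flip l T) c = T c" using assms by (cases c) (auto simp: flip_apply)
qed

lemma flip_support: "\<forall>i k. flip l T (i, k) \<noteq> 0 \<longrightarrow> i < l"
  by (simp add: flip_apply)

lemma ssct_run:
  assumes "sorted_biword E" "\<beta> \<in> Comp" "\<gamma> \<in> Comp" "ssct \<gamma> \<beta> T" "biletters T = set E"
  shows "run (map snd E) \<beta> = Some \<gamma>"
  using assms ssct_bottom_ssct[OF assms(2,3)] biletters_flip bottom_ssct_run by metis

lemma run_ssct:
  assumes "sorted_biword E" "\<beta> \<in> Comp" "run (map snd E) \<beta> = Some \<gamma>"
  shows "\<exists>T. ssct \<gamma> \<beta> T \<and> biletters T = set E"
proof -
  have \<gamma>: "\<gamma> \<in> Comp" using run_Comp assms by blast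
  obtain T where T: "bottom_ssct (part \<beta>) (part \<gamma>) T" "biletters T = set E" using run_bottom_ssct[OF assms] by blast
  have supp: "\<forall>i k. T (i, k) \<noteq> 0 \<longrightarrow> i < length \<gamma>"
    using bottom_ssctD(2)[OF T(1)] part_beyond by (metis not_less not_less0)
  show ?thesis
    using T ssct_bottom_ssct[OF assms(2) \<gamma>, of "flip (length \<gamma>) T"] flip_flip[OF supp] biletters_flip[OF supp] flip_support
    by (intro exI[of _ "flip (length \<gamma>) T"]) simp
qed

lemma ssct_unique:
  assumes "sorted_biword E" "\<beta> \<in> Comp" "\<gamma> \<in> Comp" "ssct \<gamma> \<beta> T" "biletters T = set E" "ssct \<gamma> \<beta> T'" "biletters T' = set E"
  shows "T = T'"
proof -
  let ?l = "length \<gamma>"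
  have s: "\<forall>i k. T (i, k) \<noteq> 0 \<longrightarrow> i < ?l" "\<forall>i k. T' (i, k) \<noteq> 0 \<longrightarrow> i < ?l"
    "bottom_ssct (part \<beta>) (part \<gamma>) (flip ?l T)" "bottom_ssct (part \<beta>) (part \<gamma>) (flip ?l T')"
    using assms ssct_bottom_ssct[OF assms(2,3)] by blast+
  then have "flip ?l T = flip ?l T'"
    using bottom_ssct_unique[OF assms(1,2,3)] biletters_flip[OF s(1)] biletters_flip[OF s(2)] assms by metis
  then show ?thesis using flip_flip[OF s(1)] flip_flip[OF s(2)] by metis
qed

definition entries :: "filling \<Rightarrow> nat multiset" where
  "entries T = image_mset T (mset_set {c. T c \<noteq> 0})"

lemma finite_cells: "finite (cells \<gamma>)"
proof (rule finite_subset)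
  show "cells \<gamma> \<subseteq> {..<length \<gamma>} \<times> {..<sum_list \<gamma>}"
    using elem_le_sum_list by (fastforce simp: cells_def)
qed simp

lemma ssct_finite: "ssct \<gamma> \<beta> T \<Longrightarrow> finite {c. T c \<noteq> 0}"
proof -
  assume "ssct \<gamma> \<beta> T"
  then have "{c. T c \<noteq> 0} = skew_cells \<gamma> \<beta>" unfolding ssct_def by blast
  then show ?thesis using finite_subset[OF _ finite_cells[of \<gamma>]] by (simp add: skew_cells_def)
qed

lemma ssct_column_inj:
  assumes "\<beta> \<in> Comp" "\<gamma> \<in> Comp" "ssct \<gamma> \<beta> T" "T (i, k) \<noteq> 0" "T (i, k) = T (j, k)"
  shows "i = j"
proof -
  let ?l = "length \<gamma>"
  have T: "\<forall>i k. T (i, k) \<noteq> 0 \<longrightarrow> i < ?l" "bottom_ssct (part \<beta>) (part \<gamma>) (flip ?l T)"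
    using assms ssct_bottom_ssct[OF assms(1,2)] by blast+
  have ij: "i < ?l" "j < ?l" using T(1) assms(4,5) by metis+
  then have "flip ?l T (?l - 1 - i, k) = T (i, k)" "flip ?l T (?l - 1 - j, k) = T (j, k)"
    by (auto simp: flip_apply)
  then have "?l - 1 - i = ?l - 1 - j" using bottom_ssct_column_inj[OF T(2)] assms(4,5) by metis
  then show ?thesis using ij by simp
qed

lemma biletters_image: "biletters T = (\<lambda>c. (T c, snd c)) ` {c. T c \<noteq> 0}"
  by (force simp: biletters_def)

lemma entries_biletters:
  assumes "\<beta> \<in> Comp" "\<gamma> \<in> Comp" "ssct \<gamma> \<beta> T"
  shows "entries T = image_mset fst (mset_set (biletters T))"
proof -
  have "inj_on (\<lambda>c. (T c, snd c)) {c. T c \<noteq> 0}"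
    using ssct_column_inj[OF assms] by (auto simp: inj_on_def)
  then have "mset_set (biletters T) = image_mset (\<lambda>c. (T c, snd c)) (mset_set {c. T c \<noteq> 0})"
    unfolding biletters_image by (rule image_mset_mset_set[symmetric])
  then show ?thesis by (simp add: entries_def image_mset.compositionality comp_def)
qed

lemma sorted_biword_distinct: "sorted_biword E \<Longrightarrow> distinct E"
  by (induction E) (fastforce simp: sorted_biword_Cons before_def)+

lemma sorted_biword_fst: "sorted_biword E \<Longrightarrow> sorted (map fst E)"
  by (induction E) (fastforce simp: sorted_biword_Cons before_def)+

text \<open>The words of the tableaux of shape \<open>\<gamma>//\<beta>\<close> whose entries, in weakly increasing order, are
  \<open>vs\<close>.\<close>

definition ssct_words :: "nat list \<Rightarrow> nat list \<Rightarrow> nat list \<Rightarrow> nat list set" where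
  "ssct_words \<gamma> \<beta> vs = {e. length e = length vs \<and> sorted_biword (zip vs e) \<and> run e \<beta> = Some \<gamma>}"

text \<open>A tableau is recovered from its pairs of entries and columns: \<open>f\<close> selects the tableau that
  has the given pairs, which exists by \<open>run_ssct\<close> and is unique by \<open>ssct_unique\<close>.\<close>

lemma ssct_words_bij:
  assumes Comp: "\<beta> \<in> Comp" "\<gamma> \<in> Comp" and vs: "sorted vs"
  obtains f where "bij_betw f (ssct_words \<gamma> \<beta> vs) {T. ssct \<gamma> \<beta> T \<and> entries T = mset vs}"
    "\<And>e. e \<in> ssct_words \<gamma> \<beta> vs \<Longrightarrow> biletters (f e) = set (zip vs e)"
proof -
  define f where "f e = (SOME T. ssct \<gamma> \<beta> T \<and> biletters T = set (zip vs e))" for e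
  have f: "ssct \<gamma> \<beta> (f e)" "biletters (f e) = set (zip vs e)" if "e \<in> ssct_words \<gamma> \<beta> vs" for e
  proof -
    have "sorted_biword (zip vs e)" "run (map snd (zip vs e)) \<beta> = Some \<gamma>" using that by (auto simp: ssct_words_def)
    then have "\<exists>T. ssct \<gamma> \<beta> T \<and> biletters T = set (zip vs e)" using run_ssct[OF _ Comp(1)] by blast
    then show "ssct \<gamma> \<beta> (f e)" "biletters (f e) = set (zip vs e)"
      unfolding f_def by (metis (mono_tags, lifting) someI_ex)+
  qed
  have ent: "entries (f e) = mset vs" if e: "e \<in> ssct_words \<gamma> \<beta> vs" for e
  proof -
    have "distinct (zip vs e)" using e sorted_biword_distinct by (auto simp: ssct_words_def)
    then have "mset_set (set (zip vs e)) = mset (zip vs e)" by (simp add: mset_set_set)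
    then have "entries (f e) = mset (map fst (zip vs e))"
      using entries_biletters[OF Comp f(1)[OF e]] f(2)[OF e] by simp
    moreover have "map fst (zip vs e) = vs" using e by (simp add: ssct_words_def)
    ultimately show ?thesis by (simp only:)
  qed
  have "bij_betw f (ssct_words \<gamma> \<beta> vs) {T. ssct \<gamma> \<beta> T \<and> entries T = mset vs}"
  proof (rule bij_betwI')
    fix e e' assume e: "e \<in> ssct_words \<gamma> \<beta> vs" "e' \<in> ssct_words \<gamma> \<beta> vs"
    show "f e = f e' \<longleftrightarrow> e = e'"
    proof
      assume "f e = f e'"
      then have "set (zip vs e) = set (zip vs e')" using f(2) e by metis
      then have "zip vs e = zip vs e'"
        using e by (intro sorted_wrt_unique[of before]) (auto simp: ssct_words_def sorted_biword_def before_asym)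
      then have "map snd (zip vs e) = map snd (zip vs e')" by simp
      then show "e = e'" using e by (simp add: ssct_words_def)
    qed simp
  next
    fix e assume "e \<in> ssct_words \<gamma> \<beta> vs"
    then show "f e \<in> {T. ssct \<gamma> \<beta> T \<and> entries T = mset vs}" using f(1) ent by blast
  next
    fix T assume "T \<in> {T. ssct \<gamma> \<beta> T \<and> entries T = mset vs}"
    then have T: "ssct \<gamma> \<beta> T" "entries T = mset vs" by auto
    have "finite (biletters T)" unfolding biletters_image using ssct_finite[OF T(1)] by simp
    moreover have "\<forall>q\<in>biletters T. fst q \<noteq> 0" by (auto simp: biletters_def)
    ultimately obtain E where E: "sorted_biword E" "set E = biletters T" using sorted_biword_exists by blast
    have "mset (map fst E) = mset vs"
      using entries_biletters[OF Comp T(1)] T(2) E mset_set_set[OF sorted_biword_distinct[OF E(1)]] by simp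
    then have "map fst E = vs" using sorted_biword_fst[OF E(1)] vs by (metis properties_for_sort)
    then have zip: "zip vs (map snd E) = E" by (metis zip_map_fst_snd)
    then have w: "map snd E \<in> ssct_words \<gamma> \<beta> vs"
      using ssct_run[OF E(1) Comp T(1)] E \<open>map fst E = vs\<close> by (auto simp: ssct_words_def)
    have "biletters (f (map snd E)) = set E" using f(2)[OF w] unfolding zip .
    then have "f (map snd E) = T"
      by (rule ssct_unique[OF E(1) Comp f(1)[OF w] _ T(1) E(2)[symmetric]])
    then show "\<exists>e\<in>ssct_words \<gamma> \<beta> vs. T = f e" using w by blast
  qed
  then show ?thesis using that f(2) by blast
qed

section \<open>Quasisymmetric Schur functions count words\<close>

text \<open>The weakly increasing word with \<open>m k\<close> letters \<open>k + 1\<close>.\<close>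

definition block_values :: "(nat \<Rightarrow> nat) \<Rightarrow> nat list \<Rightarrow> nat list" where
  "block_values m ks = concat (map (\<lambda>k. replicate (m k) (Suc k)) ks)"

lemma block_values_simps [simp]:
  "block_values m [] = []" "block_values m (k # ks) = replicate (m k) (Suc k) @ block_values m ks"
  by (simp_all add: block_values_def)

lemma length_block_values: "length (block_values m ks) = sum_list (map m ks)"
  by (induction ks) simp_all

lemma set_block_values: "set (block_values m ks) \<subseteq> Suc ` set ks"
  by (induction ks) auto

lemma sorted_block_values: "sorted_wrt (<) ks \<Longrightarrow> sorted (block_values m ks)"
proof (induction ks)
  case (Cons k ks)
  have "Suc k \<le> v" if "v \<in> set (block_values m ks)" for v
    using that set_block_values[of m ks] Cons.prems by fastforce
  then show ?case using Cons by (auto simp: sorted_append sorted_replicate)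
qed simp

lemma count_block_values: "distinct ks \<Longrightarrow> count (mset (block_values m ks)) (Suc k) = (if k \<in> set ks then m k else 0)"
  by (induction ks) auto

lemma before_block: "length xs = b \<Longrightarrow> sorted_wrt before (zip (replicate b v) xs) \<longleftrightarrow> sorted_wrt (>) xs"
proof (induction xs arbitrary: b)
  case (Cons x xs)
  then obtain b' where b: "b = Suc b'" "length xs = b'" by auto
  have "set (zip (replicate b' v) xs) = (\<lambda>y. (v, y)) ` set xs"
    using b(2) by (induction xs arbitrary: b') auto
  then show ?case using Cons.IH[OF b(2)] b(1) by (auto simp: before_def)
qed simp

lemma sorted_biword_blocks:
  "sorted_wrt (<) ks \<Longrightarrow> length e = sum_list (map m ks) \<Longrightarrow>
   sorted_biword (zip (block_values m ks) e) \<longleftrightarrow> block_decreasing (map m ks) e"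
proof (induction ks arbitrary: e)
  case Nil
  then show ?case by (simp add: sorted_biword_def)
next
  case (Cons k ks)
  define d where "d = take (m k) e"
  define d' where "d' = drop (m k) e"
  have e: "e = d @ d'" "length d = m k" "length d' = sum_list (map m ks)"
    using Cons.prems(2) by (simp_all add: d_def d'_def)
  have z: "zip (block_values m (k # ks)) e = zip (replicate (m k) (Suc k)) d @ zip (block_values m ks) d'"
    using e by simp
  have "before p q" if "p \<in> set (zip (replicate (m k) (Suc k)) d)" "q \<in> set (zip (block_values m ks) d')" for p q
  proof -
    have "(fst p, snd p) \<in> set (zip (replicate (m k) (Suc k)) d)"
      "(fst q, snd q) \<in> set (zip (block_values m ks) d')" using that by simp_all
    from this[THEN set_zip_leftD]
    have "fst p \<in> set (replicate (m k) (Suc k))" "fst q \<in> set (block_values m ks)" .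
    then have "fst p = Suc k" "fst q \<in> set (block_values m ks)" by (auto split: if_splits)
    then show ?thesis using set_block_values[of m ks] Cons.prems(1) by (force simp: before_def)
  qed
  moreover have "\<forall>q\<in>set (zip (replicate (m k) (Suc k)) d). fst q \<noteq> 0"
    by (auto simp: in_set_zip)
  ultimately have "sorted_biword (zip (block_values m (k # ks)) e) \<longleftrightarrow>
      sorted_wrt (>) d \<and> sorted_biword (zip (block_values m ks) d')"
    unfolding z sorted_biword_def sorted_wrt_append using before_block[OF e(2), of "Suc k"] by auto
  also have "sorted_biword (zip (block_values m ks) d') \<longleftrightarrow> block_decreasing (map m ks) d'"
    using Cons e by (intro Cons.IH) auto
  finally show ?case using Cons.prems(2) by (auto simp: d_def d'_def)
qed

lemma count_entries: "ssct \<gamma> \<beta> T \<Longrightarrow> 0 < v \<Longrightarrow> count (entries T) v = card {c. T c = v}"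
proof -
  assume T: "ssct \<gamma> \<beta> T" and v: "0 < v"
  have "T -` {v} \<inter> set_mset (mset_set {c. T c \<noteq> 0}) = {c. T c = v}" using v ssct_finite[OF T] by auto
  then show ?thesis unfolding entries_def count_image_mset using ssct_finite[OF T] v by simp
qed

lemma zero_notin_entries: "ssct \<gamma> \<beta> T \<Longrightarrow> count (entries T) 0 = 0"
  using ssct_finite by (auto simp: entries_def count_eq_zero_iff)

text \<open>The coefficient of a monomial depends only on its sequence of nonzero exponents: omitting
  the values that are not used does not change the conditions on the words.\<close>

lemma S_kostka:
  assumes "\<gamma> \<in> Comp"
  shows "S \<gamma> a = of_nat (kostka [] \<gamma> (nonzero_parts a))"
proof -
  let ?m = "Poly_Mapping.lookup a"
  define ks where "ks = sorted_list_of_set (Poly_Mapping.keys a)"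
  have ks: "sorted_wrt (<) ks" "distinct ks" "set ks = Poly_Mapping.keys a"
    unfolding ks_def by (simp_all add: strict_sorted_list_of_set)
  define vs where "vs = block_values ?m ks"
  have np: "nonzero_parts a = map ?m ks" by (simp add: nonzero_parts_def ks_def)
  have nil: "[] \<in> Comp" by (simp add: Comp_def)
  have cvs: "count (mset vs) (Suc i) = ?m i" for i
    unfolding vs_def count_block_values[OF ks(2)] by (simp add: ks(3) in_keys_iff)
  have "0 \<notin> set vs" using set_block_values unfolding vs_def by blast
  then have cvs0: "count (mset vs) 0 = 0" by (simp add: count_list_0_iff)
  have "cont T = ?m \<longleftrightarrow> entries T = mset vs" if T: "ssct \<gamma> [] T" for T
  proof -
    have "cont T i = count (entries T) (Suc i)" for i using count_entries[OF T, of "Suc i"] by (simp add: cont_def)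
    then have "cont T = ?m \<longleftrightarrow> (\<forall>i. count (entries T) (Suc i) = count (mset vs) (Suc i))"
      by (simp add: fun_eq_iff cvs)
    also have "\<dots> \<longleftrightarrow> entries T = mset vs"
      using zero_notin_entries[OF T] cvs0 unfolding multiset_eq_iff by (metis not0_implies_Suc)
    finally show ?thesis .
  qed
  then have "{T. ssct \<gamma> [] T \<and> cont T = ?m} = {T. ssct \<gamma> [] T \<and> entries T = mset vs}" by blast
  moreover obtain f where "bij_betw f (ssct_words \<gamma> [] vs) {T. ssct \<gamma> [] T \<and> entries T = mset vs}"
    using ssct_words_bij[OF nil assms] sorted_block_values[OF ks(1)] unfolding vs_def by metis
  moreover have "ssct_words \<gamma> [] vs = {e. run e [] = Some \<gamma> \<and> block_decreasing (nonzero_parts a) e}"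
    unfolding ssct_words_def np vs_def length_block_values
    using sorted_biword_blocks[OF ks(1)] block_decreasing_length by blast
  ultimately show ?thesis unfolding S_def kostka_def by (metis bij_betw_same_card)
qed

section \<open>Standard tableaux and rectification\<close>

lemma sct_entries:
  assumes "ssct \<gamma> \<beta> T"
  shows "sct \<gamma> \<beta> T \<longleftrightarrow> entries T = mset [1..<Suc (sum_list \<gamma> - sum_list \<beta>)]"
proof -
  let ?n = "sum_list \<gamma> - sum_list \<beta>"
  have supp: "{c. T c \<noteq> 0} = skew_cells \<gamma> \<beta>" using assms by (auto simp: ssct_def)
  have fin: "finite (skew_cells \<gamma> \<beta>)" using ssct_finite[OF assms] supp by simp
  have up: "mset [1..<Suc ?n] = mset_set {1..?n}"
    using mset_set_set[OF distinct_upt[of 1 "Suc ?n"]] by (simp add: atLeastLessThanSuc_atLeastAtMost del: upt_Suc)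
  have "bij_betw T (skew_cells \<gamma> \<beta>) {1..?n} \<longleftrightarrow> entries T = mset [1..<Suc ?n]"
  proof
    assume "bij_betw T (skew_cells \<gamma> \<beta>) {1..?n}"
    then show "entries T = mset [1..<Suc ?n]"
      unfolding entries_def supp up by (simp add: bij_betw_def image_mset_mset_set)
  next
    assume e: "entries T = mset [1..<Suc ?n]"
    have im: "T ` skew_cells \<gamma> \<beta> = {1..?n}"
      using arg_cong[OF e, of set_mset] fin unfolding entries_def supp up by simp
    have "card (skew_cells \<gamma> \<beta>) = ?n"
      using arg_cong[OF e, of size] unfolding entries_def supp up by simp
    then have "inj_on T (skew_cells \<gamma> \<beta>)" using im fin by (intro eq_card_imp_inj_on) auto
    then show "bij_betw T (skew_cells \<gamma> \<beta>) {1..?n}" using im by (simp add: bij_betw_def)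
  qed
  then show ?thesis using assms by (simp add: sct_def)
qed

lemma zip_upt: "(v, k) \<in> set (zip [1..<Suc (length e)] e) \<longleftrightarrow> v \<in> set (col_values e k)"
proof -
  have "(v, k) \<in> set (zip [1..<Suc (length e)] e) \<longleftrightarrow> (\<exists>i<length e. v = Suc i \<and> k = e ! i)"
  proof
    assume "(v, k) \<in> set (zip [1..<Suc (length e)] e)"
    then show "\<exists>i<length e. v = Suc i \<and> k = e ! i"
      by (auto simp: in_set_zip nth_upt simp del: upt_Suc)
  next
    assume "\<exists>i<length e. v = Suc i \<and> k = e ! i"
    then obtain i where "i < length e" "v = Suc i" "k = e ! i" by blast
    then show "(v, k) \<in> set (zip [1..<Suc (length e)] e)"
      unfolding in_set_zip by (intro exI[of _ i]) (simp add: nth_upt del: upt_Suc)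
  qed
  also have "\<dots> \<longleftrightarrow> v \<in> set (col_values e k)"
    unfolding set_col_values by (auto intro!: exI[of _ "v - 1"])
  finally show ?thesis .
qed

lemma sorted_biword_zip_upt: "sorted_biword (zip [1..<Suc (length e)] e)"
  unfolding sorted_biword_def
proof
  show "sorted_wrt before (zip [1..<Suc (length e)] e)"
    by (auto simp: sorted_wrt_iff_nth_less before_def simp del: upt_Suc)
  show "\<forall>q\<in>set (zip [1..<Suc (length e)] e). fst q \<noteq> 0" by (auto simp: in_set_zip simp del: upt_Suc)
qed

lemma column_biletters:
  assumes "\<beta> \<in> Comp" "\<gamma> \<in> Comp" "ssct \<gamma> \<beta> T"
  shows "column T k = sorted_list_of_set {v. (v, k) \<in> biletters T}"
proof -
  have "inj_on (\<lambda>i. T (i, k)) {i. T (i, k) \<noteq> 0}"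
    using ssct_column_inj[OF assms] by (auto simp: inj_on_def)
  moreover have "(\<lambda>i. T (i, k)) ` {i. T (i, k) \<noteq> 0} = {v. (v, k) \<in> biletters T}" by (auto simp: biletters_def)
  ultimately show ?thesis unfolding column_def by (simp add: image_mset_mset_set sorted_list_of_mset_set)
qed

lemma biletters_column:
  assumes "\<beta> \<in> Comp" "\<gamma> \<in> Comp" "ssct \<gamma> \<beta> T"
  shows "set (column T k) = {v. (v, k) \<in> biletters T}"
proof -
  have "finite {v. (v, k) \<in> biletters T}"
    by (rule finite_subset[of _ "fst ` biletters T"]) (use ssct_finite[OF assms(3)] in \<open>force simp: biletters_image\<close>)+
  then show ?thesis by (simp add: column_biletters[OF assms])
qed

lemma standard_column:
  assumes "\<beta> \<in> Comp" "\<gamma> \<in> Comp" "ssct \<gamma> \<beta> T" "biletters T = set (zip [1..<Suc (length e)] e)"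
  shows "column T k = col_values e k"
proof -
  have "{v. (v, k) \<in> biletters T} = set (col_values e k)" unfolding assms(4) zip_upt by simp
  moreover have "sorted (col_values e k)" "distinct (col_values e k)"
    using sorted_col_values[of e k] by (simp_all add: strict_sorted_iff)
  ultimately show ?thesis
    unfolding column_biletters[OF assms(1-3)] by (metis sorted_list_of_set.idem_if_sorted_distinct)
qed

lemma standard_col_word:
  assumes "\<beta> \<in> Comp" "\<gamma> \<in> Comp" "ssct \<gamma> \<beta> T" "biletters T = set (zip [1..<Suc (length e)] e)"
  shows "col_word T = reading e"
proof -
  have "(\<exists>i. T (i, k) \<noteq> 0) \<longleftrightarrow> k \<in> set e" for k
  proof -
    have "(\<exists>i. T (i, k) \<noteq> 0) \<longleftrightarrow> (\<exists>v. (v, k) \<in> biletters T)" by (auto simp: biletters_def)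
    also have "\<dots> \<longleftrightarrow> (\<exists>v. v \<in> set (col_values e k))" unfolding assms(4) zip_upt ..
    also have "\<dots> \<longleftrightarrow> k \<in> set e"
    proof
      assume "k \<in> set e"
      then obtain i where "i < length e" "e ! i = k" by (auto simp: in_set_conv_nth)
      then have "Suc i \<in> set (col_values e k)" by (simp add: set_col_values)
      then show "\<exists>v. v \<in> set (col_values e k)" ..
    qed (auto simp: set_col_values)
    finally show ?thesis .
  qed
  then have "{k. \<exists>i. T (i, k) \<noteq> 0} = set e" by blast
  moreover have "column T = col_values e" by (rule ext) (rule standard_column[OF assms])
  ultimately show ?thesis unfolding col_word_def reading_def by simp
qed

lemma rho_entry: "rho T (i, k) = entry (rev (column T k)) i"
  by (simp add: rho_def entry_def)

text \<open>The columns give the pairs of entries and columns, hence the word and, by uniqueness, the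
  shape and the filling.\<close>

lemma rho_inject:
  assumes \<alpha>: "\<alpha> \<in> Comp" "ssct \<alpha> [] V" and \<alpha>': "\<alpha>' \<in> Comp" "ssct \<alpha>' [] V'" and eq: "rho V = rho V'"
  shows "V = V'"
proof -
  have nil: "[] \<in> Comp" by (simp add: Comp_def)
  have pos: "0 \<notin> set (rev (column V k))" "0 \<notin> set (rev (column V' k))" for k
    unfolding set_rev biletters_column[OF nil \<alpha>] biletters_column[OF nil \<alpha>'] by (auto simp: biletters_def)
  have "rev (column V k) = rev (column V' k)" for k
    by (rule entry_inject[OF _ pos]) (metis eq rho_entry)
  then have "column V k = column V' k" for k by simp
  then have "{v. (v, k) \<in> biletters V} = {v. (v, k) \<in> biletters V'}" for k
    using biletters_column[OF nil \<alpha>] biletters_column[OF nil \<alpha>'] by metis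
  then have biletters: "biletters V = biletters V'" by auto
  have "finite (biletters V)" unfolding biletters_image using ssct_finite[OF \<alpha>(2)] by simp
  moreover have "\<forall>q\<in>biletters V. fst q \<noteq> 0" by (auto simp: biletters_def)
  ultimately obtain E where E: "sorted_biword E" "set E = biletters V" using sorted_biword_exists by blast
  have "\<alpha> = \<alpha>'"
    using ssct_run[OF E(1) nil \<alpha>] ssct_run[OF E(1) nil \<alpha>'] E(2) biletters by simp
  then show ?thesis using ssct_unique[OF E(1) nil \<alpha> _ _] \<alpha>' E(2) biletters by simp
qed

text \<open>Sorting the columns of a straight standard tableau yields the insertion tableau of its
  column word.\<close>

lemma rho_standard:
  assumes "run c [] = Some \<alpha>" "ssct \<alpha> [] V" "biletters V = set (zip [1..<Suc (length c)] c)"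
  shows "rho V = P_tab (reading c)"
proof -
  have nil: "[] \<in> Comp" by (simp add: Comp_def)
  have \<alpha>: "\<alpha> \<in> Comp" using run_Comp[OF assms(1) nil] .
  have yamanouchi: "yamanouchi c" using assms(1) yamanouchi_iff_run by simp
  have "rho V (i, k) = P_tab (reading c) (i, k)" for i k
    unfolding rho_entry P_tab_yamanouchi[OF yamanouchi] standard_column[OF nil \<alpha> assms(2,3)] ..
  then show ?thesis by (intro ext) (metis surj_pair)
qed

lemma U_apply: "(i, k) \<in> cells \<alpha> \<Longrightarrow> U \<alpha> (i, k) = sum_list (take (Suc i) \<alpha>) - k"
proof -
  assume "(i, k) \<in> cells \<alpha>"
  moreover have "sum_list \<alpha> = sum_list (take (Suc i) \<alpha>) + sum_list (drop (Suc i) \<alpha>)"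
    by (metis append_take_drop_id sum_list_append)
  ultimately show ?thesis by (simp add: U_def)
qed

lemma sum_take_Suc: "i < length \<alpha> \<Longrightarrow> sum_list (take (Suc i) \<alpha>) = sum_list (take i \<alpha>) + (\<alpha> ! i :: nat)"
  by (simp add: take_Suc_conv_app_nth)

lemma sum_take_mono: "i \<le> j \<Longrightarrow> sum_list (take i \<alpha>) \<le> sum_list (take j (\<alpha> :: nat list))"
proof -
  assume "i \<le> j"
  then have "take i \<alpha> = take i (take j \<alpha>)" by (simp add: min_def)
  then have "sum_list (take j \<alpha>) = sum_list (take i \<alpha>) + sum_list (drop i (take j \<alpha>))"
    by (metis append_take_drop_id sum_list_append)
  then show ?thesis by simp
qed

lemma U_bounds:
  assumes "(i, k) \<in> cells \<alpha>"
  shows "sum_list (take i \<alpha>) < U \<alpha> (i, k)" "U \<alpha> (i, k) \<le> sum_list (take (Suc i) \<alpha>)"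
  using assms U_apply[OF assms] sum_take_Suc[of i \<alpha>] by (auto simp: cells_def)

lemma ssct_U: "ssct \<alpha> [] (U \<alpha>)"
proof -
  have inner: "inner_cells \<alpha> [] = {}" by (simp add: inner_cells_def cells_def)
  have skew: "skew_cells \<alpha> [] = cells \<alpha>" by (simp add: skew_cells_def inner)
  have less: "U \<alpha> (i, k) < U \<alpha> (j, l)" if "i < j" "(i, k) \<in> cells \<alpha>" "(j, l) \<in> cells \<alpha>" for i j k l
    using U_bounds(2)[OF that(2)] U_bounds(1)[OF that(3)] sum_take_mono[of "Suc i" j \<alpha>] that(1) by simp
  show ?thesis
    unfolding ssct_def skew inner
  proof (intro conjI allI impI)
    show "[] \<Subset> \<alpha>" by (simp add: contained_def)
    fix c :: "nat \<times> nat"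
    obtain i k where c: "c = (i, k)" by fastforce
    show "U \<alpha> c \<noteq> 0 \<longleftrightarrow> c \<in> cells \<alpha>" using U_bounds(1)[of i k \<alpha>] unfolding c by (auto simp: U_def)
  next
    fix i k l assume "k \<le> l" "(i, k) \<in> cells \<alpha>" "(i, l) \<in> cells \<alpha>"
    then show "U \<alpha> (i, l) \<le> U \<alpha> (i, k)" by (simp add: U_apply)
  next
    fix i j assume "i < j" "(i, 0) \<in> cells \<alpha>" "(j, 0) \<in> cells \<alpha>"
    then show "U \<alpha> (i, 0) < U \<alpha> (j, 0)" by (rule less)
  next
    fix i j k
    assume a: "(i, k) \<in> cells \<alpha>" "attacks \<alpha> [] (i, k) (j, k + 1)" "(i, k) \<in> {} \<or> U \<alpha> (j, k + 1) \<le> U \<alpha> (i, k)"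
    have "i < j" "(j, k + 1) \<in> cells \<alpha>" using a(2) by (auto simp: attacks_def skew)
    then show "(i, k + 1) \<in> cells \<alpha>" "U \<alpha> (j, k + 1) < U \<alpha> (i, k + 1)" using less[of i j k "k + 1"] a by auto
  qed
qed

lemma length_U_word: "length (U_word \<alpha>) = sum_list \<alpha>"
  by (induction \<alpha>) simp_all

lemma biletters_U: "(v, k) \<in> biletters (U \<alpha>) \<longleftrightarrow> 1 \<le> v \<and> v \<le> sum_list \<alpha> \<and> U_word \<alpha> ! (v - 1) = k"
proof (induction \<alpha> arbitrary: v)
  case Nil
  then show ?case by (auto simp: biletters_def U_def cells_def)
next
  case (Cons a \<alpha>)
  have 0: "U (a # \<alpha>) (0, k) = a - k" by (simp add: U_def cells_def)
  have Suc: "U (a # \<alpha>) (Suc i, k) = (if U \<alpha> (i, k) = 0 then 0 else a + U \<alpha> (i, k))" for i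
  proof (cases "(i, k) \<in> cells \<alpha>")
    case True
    then have "(Suc i, k) \<in> cells (a # \<alpha>)" by (simp add: cells_def)
    then show ?thesis using True U_apply[of "Suc i" k "a # \<alpha>"] U_apply[OF True] U_bounds(1)[OF True] by simp
  qed (auto simp: U_def cells_def)
  have "(v, k) \<in> biletters (U (a # \<alpha>)) \<longleftrightarrow> v \<noteq> 0 \<and> (a - k = v \<or> (\<exists>i. U (a # \<alpha>) (Suc i, k) = v))"
    unfolding biletters_iff by (metis 0 not0_implies_Suc)
  also have "\<dots> \<longleftrightarrow> v \<noteq> 0 \<and> (a - k = v \<or> (a < v \<and> (v - a, k) \<in> biletters (U \<alpha>)))"
  proof -
    have "(\<exists>i. U (a # \<alpha>) (Suc i, k) = v) \<longleftrightarrow> a < v \<and> (v - a, k) \<in> biletters (U \<alpha>)" if "v \<noteq> 0"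
    proof
      assume "\<exists>i. U (a # \<alpha>) (Suc i, k) = v"
      then show "a < v \<and> (v - a, k) \<in> biletters (U \<alpha>)"
        using that unfolding Suc biletters_iff by (auto split: if_splits)
    next
      assume v: "a < v \<and> (v - a, k) \<in> biletters (U \<alpha>)"
      then obtain i where "U \<alpha> (i, k) = v - a" unfolding biletters_iff by blast
      then have "U (a # \<alpha>) (Suc i, k) = v" unfolding Suc using v by simp
      then show "\<exists>i. U (a # \<alpha>) (Suc i, k) = v" ..
    qed
    then show ?thesis by blast
  qed
  also have "\<dots> \<longleftrightarrow> 1 \<le> v \<and> v \<le> sum_list (a # \<alpha>) \<and> U_word (a # \<alpha>) ! (v - 1) = k"
    unfolding Cons.IH
  proof (cases "v \<le> a")
    case True
    then show "(v \<noteq> 0 \<and> (a - k = v \<or> (a < v \<and> 1 \<le> v - a \<and> v - a \<le> sum_list \<alpha> \<and> U_word \<alpha> ! (v - a - 1) = k)))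
      \<longleftrightarrow> 1 \<le> v \<and> v \<le> sum_list (a # \<alpha>) \<and> U_word (a # \<alpha>) ! (v - 1) = k"
      by (auto simp: nth_append rev_nth)
  next
    case False
    then show "(v \<noteq> 0 \<and> (a - k = v \<or> (a < v \<and> 1 \<le> v - a \<and> v - a \<le> sum_list \<alpha> \<and> U_word \<alpha> ! (v - a - 1) = k)))
      \<longleftrightarrow> 1 \<le> v \<and> v \<le> sum_list (a # \<alpha>) \<and> U_word (a # \<alpha>) ! (v - 1) = k"
      by (auto simp: nth_append diff_commute)
  qed
  finally show ?case .
qed

lemma biletters_U_zip: "biletters (U \<alpha>) = set (zip [1..<Suc (length (U_word \<alpha>))] (U_word \<alpha>))"
proof (rule set_eqI)
  fix q :: "nat \<times> nat"
  obtain v k where q: "q = (v, k)" by fastforce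
  show "q \<in> biletters (U \<alpha>) \<longleftrightarrow> q \<in> set (zip [1..<Suc (length (U_word \<alpha>))] (U_word \<alpha>))"
    unfolding q zip_upt unfolding set_col_values biletters_U length_U_word by simp
qed

text \<open>The straight word in the class of \<open>e\<close> is the word of a tableau that Mason's map sends to
  the insertion tableau, so the rectification is an actual preimage; injectivity then identifies
  it.\<close>

theorem rect_iff:
  assumes "\<beta> \<in> Comp" "\<gamma> \<in> Comp" "ssct \<gamma> \<beta> T" "biletters T = set (zip [1..<Suc (length e)] e)" "\<alpha> \<in> Comp"
  shows "rect T = U \<alpha> \<longleftrightarrow> same_rect e (U_word \<alpha>)"
proof -
  have nil: "[] \<in> Comp" by (simp add: Comp_def)
  let ?A = "{T. \<exists>\<alpha>\<in>Comp. ssct \<alpha> [] T}"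
  have word: "P_tab (col_word T) = P_tab (reading e)" by (simp add: standard_col_word[OF assms(1-4)])
  have "rho (U \<alpha>) = P_tab (reading (U_word \<alpha>))"
    using rho_standard[of "U_word \<alpha>" \<alpha>] run_U_word[OF assms(5), of "[]"] ssct_U biletters_U_zip by simp
  then have U: "rho (U \<alpha>) = P_tab (col_word T) \<longleftrightarrow> same_rect e (U_word \<alpha>)"
    unfolding word same_rect_iff_P_tab by auto
  obtain c where c: "yamanouchi c" "same_rect c e" using yamanouchi_exists by blast
  then obtain \<delta> where \<delta>: "run c [] = Some \<delta>" using yamanouchi_iff_run by blast
  have "map snd (zip [1..<Suc (length c)] c) = c" by (simp del: upt_Suc)
  then obtain V where V: "ssct \<delta> [] V" "biletters V = set (zip [1..<Suc (length c)] c)"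
    using run_ssct[OF sorted_biword_zip_upt nil, of c \<delta>] \<delta> by metis
  have "rho V = P_tab (col_word T)"
    using rho_standard[OF \<delta> V] c(2) word same_rect_iff_P_tab by simp
  moreover have "V \<in> ?A" using V(1) run_Comp[OF \<delta> nil] by blast
  ultimately have "P_tab (col_word T) \<in> rho ` ?A" by (rule image_eqI[OF sym])
  then have rect: "rect T \<in> ?A" "rho (rect T) = P_tab (col_word T)"
    unfolding rect_def rho_inv_def by (rule inv_into_into, rule f_inv_into_f)
  show ?thesis
  proof
    assume "rect T = U \<alpha>"
    then show "same_rect e (U_word \<alpha>)" using rect(2) U by simp
  next
    assume "same_rect e (U_word \<alpha>)"
    then have "rho (rect T) = rho (U \<alpha>)" using rect(2) U by simp
    then show "rect T = U \<alpha>" using rect(1) rho_inject[OF _ _ assms(5) ssct_U] by blast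
  qed
qed

theorem card_sct:
  assumes "\<alpha> \<in> Comp" "\<beta> \<in> Comp" "\<gamma> \<in> Comp"
  shows "card {T. sct \<gamma> \<beta> T \<and> rect T = U \<alpha>} = lr_coeff \<gamma> \<alpha> \<beta>"
proof -
  define n where "n = sum_list \<gamma> - sum_list \<beta>"
  define vs where "vs = [1..<Suc n]"
  have vs: "length vs = n" by (simp add: vs_def)
  have vs': "vs = [1..<Suc (length e)]" if "length e = n" for e :: "nat list" using that by (simp add: vs_def)
  obtain f where f: "bij_betw f (ssct_words \<gamma> \<beta> vs) {T. ssct \<gamma> \<beta> T \<and> entries T = mset vs}"
    "\<And>e. e \<in> ssct_words \<gamma> \<beta> vs \<Longrightarrow> biletters (f e) = set (zip vs e)"
    using ssct_words_bij[OF assms(2,3), of vs] by (auto simp: vs_def simp del: upt_Suc)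
  have ssct_words: "ssct_words \<gamma> \<beta> vs = {e. run e \<beta> = Some \<gamma>}"
  proof -
    have len: "length e = n" if "run e \<beta> = Some \<gamma>" for e using run_sum[OF that] by (simp add: n_def)
    moreover have "sorted_biword (zip vs e)" if "length e = n" for e using sorted_biword_zip_upt[of e] vs'[OF that] by simp
    ultimately show ?thesis unfolding ssct_words_def vs by blast
  qed
  have sct: "{T. ssct \<gamma> \<beta> T \<and> entries T = mset vs} = {T. sct \<gamma> \<beta> T}"
    using sct_entries[of \<gamma> \<beta>] by (auto simp: vs_def n_def sct_def simp del: upt_Suc)
  have iff: "rect (f e) = U \<alpha> \<longleftrightarrow> same_rect e (U_word \<alpha>)" if e: "e \<in> ssct_words \<gamma> \<beta> vs" for e
  proof (rule rect_iff[OF assms(2,3) _ _ assms(1)])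
    show "ssct \<gamma> \<beta> (f e)" using f(1) e by (auto simp: bij_betw_def)
    show "biletters (f e) = set (zip [1..<Suc (length e)] e)"
      using f(2)[OF e] e vs vs'[of e] by (simp add: ssct_words_def)
  qed
  have "bij_betw f {e \<in> ssct_words \<gamma> \<beta> vs. same_rect e (U_word \<alpha>)} {T. sct \<gamma> \<beta> T \<and> rect T = U \<alpha>}"
    unfolding bij_betw_def
  proof
    show "inj_on f {e \<in> ssct_words \<gamma> \<beta> vs. same_rect e (U_word \<alpha>)}"
      using f(1) by (auto simp: bij_betw_def inj_on_def)
    have im: "f ` ssct_words \<gamma> \<beta> vs = {T. sct \<gamma> \<beta> T}" using f(1) sct by (simp add: bij_betw_def)
    show "f ` {e \<in> ssct_words \<gamma> \<beta> vs. same_rect e (U_word \<alpha>)} = {T. sct \<gamma> \<beta> T \<and> rect T = U \<alpha>}"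
    proof -
      have "f ` {e \<in> ssct_words \<gamma> \<beta> vs. same_rect e (U_word \<alpha>)} = {T \<in> f ` ssct_words \<gamma> \<beta> vs. rect T = U \<alpha>}"
        using iff by blast
      then show ?thesis unfolding im by blast
    qed
  qed
  then have "card {T. sct \<gamma> \<beta> T \<and> rect T = U \<alpha>} = card {e \<in> ssct_words \<gamma> \<beta> vs. same_rect e (U_word \<alpha>)}"
    by (rule bij_betw_same_card[THEN sym])
  then show ?thesis by (simp add: ssct_words lr_coeff_def fiber_def)
qed

section \<open>Linearly independent families\<close>

lemma nonzero_parts_Comp: "nonzero_parts a \<in> Comp"
  by (auto simp: nonzero_parts_def Comp_def in_keys_iff)

definition indep_family :: "'i set \<Rightarrow> ('i \<Rightarrow> 'a \<Rightarrow> rat) \<Rightarrow> bool" where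
  "indep_family I b \<longleftrightarrow>
     (\<forall>A u. finite A \<longrightarrow> A \<subseteq> I \<longrightarrow> (\<Sum>i\<in>A. u i *\<^sub>Q b i) = 0 \<longrightarrow> (\<forall>i\<in>A. u i = 0))"

lemma indep_familyD:
  assumes "indep_family I b" "finite A" "A \<subseteq> I" "(\<Sum>i\<in>A. u i *\<^sub>Q b i) = 0" "i \<in> A"
  shows "u i = 0"
  using assms(1)[unfolded indep_family_def, rule_format, OF assms(2-5)] .

lemma has_expansionI:
  assumes "finite A" "A \<subseteq> I" "\<And>i. i \<in> I - A \<Longrightarrow> c i = 0" "v = (\<Sum>i\<in>A. c i *\<^sub>Q b i)"
  shows "has_expansion v I b c"
proof -
  have sub: "{i \<in> I. c i \<noteq> 0} \<subseteq> A" using assms(3) by blast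
  have "(\<Sum>i\<in>A. c i *\<^sub>Q b i) = (\<Sum>i\<in>{i \<in> I. c i \<noteq> 0}. c i *\<^sub>Q b i)"
    using assms(1,2) sub by (intro sum.mono_neutral_right) (auto simp: scale_def fun_eq_iff)
  then show ?thesis using finite_subset[OF sub assms(1)] assms(4) by (simp add: has_expansion_def)
qed

lemma has_expansion_iff:
  assumes ind: "indep_family I b" and c: "has_expansion v I b c"
  shows "has_expansion v I b d \<longleftrightarrow> (\<forall>i\<in>I. d i = c i)"
proof
  assume d: "has_expansion v I b d"
  let ?A = "{i \<in> I. c i \<noteq> 0} \<union> {i \<in> I. d i \<noteq> 0}"
  have fin: "finite ?A" using c d by (simp add: has_expansion_def)
  have ext: "v = (\<Sum>i\<in>?A. e i *\<^sub>Q b i)" if "has_expansion v I b e" "{i \<in> I. e i \<noteq> 0} \<subseteq> ?A" for e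
  proof -
    have "(\<Sum>i\<in>?A. e i *\<^sub>Q b i) = (\<Sum>i\<in>{i \<in> I. e i \<noteq> 0}. e i *\<^sub>Q b i)"
      using fin that(2) by (intro sum.mono_neutral_right) (auto simp: scale_def fun_eq_iff)
    then show ?thesis using that(1) by (simp add: has_expansion_def)
  qed
  have "(\<Sum>i\<in>?A. (d i - c i) *\<^sub>Q b i) = (\<Sum>i\<in>?A. d i *\<^sub>Q b i) - (\<Sum>i\<in>?A. c i *\<^sub>Q b i)"
    by (simp add: Q.scale_left_diff_distrib sum_subtractf)
  also have "\<dots> = 0" using ext[OF c] ext[OF d] by auto
  finally have zero: "(\<Sum>i\<in>?A. (d i - c i) *\<^sub>Q b i) = 0" .
  have "?A \<subseteq> I" by blast
  then have diff: "d i - c i = 0" if "i \<in> ?A" for i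
    by (rule indep_familyD[OF ind fin _ zero that])
  have eq: "d i = c i" if "i \<in> ?A" for i using diff[OF that] by simp
  show "\<forall>i\<in>I. d i = c i"
  proof
    fix i assume "i \<in> I"
    then show "d i = c i" using eq[of i] by (cases "i \<in> ?A") simp_all
  qed
next
  assume "\<forall>i\<in>I. d i = c i"
  then have "{i \<in> I. d i \<noteq> 0} = {i \<in> I. c i \<noteq> 0}" "\<And>i. i \<in> {i \<in> I. c i \<noteq> 0} \<Longrightarrow> d i *\<^sub>Q b i = c i *\<^sub>Q b i" by auto
  then show "has_expansion v I b d" using c unfolding has_expansion_def by (metis (no_types, lifting) sum.cong)
qed

section \<open>The basis of quasisymmetric Schur functions\<close>

lemma S_expansion:
  assumes "\<gamma> \<in> Comp"
  shows "S \<gamma> = (\<Sum>\<delta>\<in>Comps (sum_list \<gamma>). of_nat (kostka [] \<gamma> \<delta>) *\<^sub>Q M \<delta>)"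
proof
  fix a
  let ?d = "nonzero_parts a" and ?K = "\<lambda>\<delta>. of_nat (kostka [] \<gamma> \<delta>) :: rat"
  have "(\<Sum>\<delta>\<in>Comps (sum_list \<gamma>). ?K \<delta> *\<^sub>Q M \<delta>) a = (\<Sum>\<delta>\<in>Comps (sum_list \<gamma>). if \<delta> = ?d then ?K \<delta> else 0)"
    by (auto simp: sum_fun_apply scale_def M_def intro!: sum.cong)
  also have "\<dots> = (if ?d \<in> Comps (sum_list \<gamma>) then ?K ?d else 0)" by (simp add: finite_Comps)
  also have "\<dots> = ?K ?d" proof (cases "?d \<in> Comps (sum_list \<gamma>)")
    case False
    then have "sum_list \<gamma> \<noteq> sum_list ?d" using nonzero_parts_Comp[of a] by (simp add: Comps_def)
    then have "kostka [] \<gamma> ?d = 0" using kostka_sum[of "[]" \<gamma> ?d] by fastforce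
    then show ?thesis by simp
  qed simp
  finally show "S \<gamma> a = (\<Sum>\<delta>\<in>Comps (sum_list \<gamma>). ?K \<delta> *\<^sub>Q M \<delta>) a" by (simp add: S_kostka[OF assms])
qed

text \<open>The values \<open>u \<alpha>\<close> may be coefficients of tensors at a fixed exponent in the other set of
  variables; therefore independence is stated through the values of the series.\<close>

lemma S_pointwise_independent:
  assumes "finite A" "A \<subseteq> Comp" "\<And>a. (\<Sum>\<alpha>\<in>A. u \<alpha> * S \<alpha> a) = 0" "\<alpha> \<in> A"
  shows "u \<alpha> = 0"
proof (rule ccontr)
  assume "u \<alpha> \<noteq> 0"
  \<comment> \<open>Among the compositions with nonzero coefficient choose one of maximal level. At an exponent
    with these nonzero parts no other \<open>S \<delta>\<close> contributes.\<close>
  define B where "B = {\<alpha> \<in> A. u \<alpha> \<noteq> 0}"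
  have B: "finite B" "B \<noteq> {}" using assms \<open>u \<alpha> \<noteq> 0\<close> by (auto simp: B_def)
  then have "Max (level ` B) \<in> level ` B" by simp
  then obtain \<beta> where \<beta>: "\<beta> \<in> B" "level \<beta> = Max (level ` B)" by auto
  have max: "level \<delta> \<le> level \<beta>" if "\<delta> \<in> B" for \<delta> using that \<beta> B by simp
  have \<beta>': "\<beta> \<in> Comp" "\<beta> \<in> A" "u \<beta> \<noteq> 0" using \<beta> assms(2) by (auto simp: B_def)
  obtain a where a: "nonzero_parts a = \<beta>" by (rule nonzero_parts_surj[OF \<beta>'(1)])
  have "u \<delta> * S \<delta> a = (if \<delta> = \<beta> then u \<beta> else 0)" if \<delta>: "\<delta> \<in> A" for \<delta>
  proof -
    have "S \<delta> a = of_nat (kostka [] \<delta> \<beta>)" using S_kostka[of \<delta> a] \<delta> assms(2) a by auto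
    moreover have "kostka [] \<delta> \<beta> = 0" if "\<delta> \<noteq> \<beta>" "u \<delta> \<noteq> 0"
      using kostka_triangular[OF \<beta>'(1), of \<delta>] max[of \<delta>] that \<delta> by (force simp: B_def)
    ultimately show ?thesis using kostka_diagonal[OF \<beta>'(1)] by (cases "\<delta> = \<beta>"; cases "u \<delta> = 0") simp_all
  qed
  then have "(\<Sum>\<delta>\<in>A. u \<delta> * S \<delta> a) = (\<Sum>\<delta>\<in>A. if \<delta> = \<beta> then u \<beta> else 0)" by (rule sum.cong[OF refl])
  then show False using assms(1,3) \<beta>' by simp
qed

lemma S_indep: "indep_family Comp S"
  unfolding indep_family_def
proof (intro allI impI ballI)
  fix A u \<alpha> assume A: "finite A" "A \<subseteq> Comp" "(\<Sum>i\<in>A. u i *\<^sub>Q S i) = 0" "\<alpha> \<in> A"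
  have "(\<Sum>\<alpha>\<in>A. u \<alpha> * S \<alpha> a) = 0" for a
    using fun_cong[OF A(3), of a] by (simp add: sum_fun_apply scale_def)
  then show "u \<alpha> = 0" using S_pointwise_independent[OF A(1,2) _ A(4)] by blast
qed

lemma S_inj: "inj_on S Comp"
proof (rule inj_onI)
  fix \<alpha> \<beta> assume ab: "\<alpha> \<in> Comp" "\<beta> \<in> Comp" "S \<alpha> = S \<beta>"
  show "\<alpha> = \<beta>"
  proof (rule ccontr)
    assume ne: "\<alpha> \<noteq> \<beta>"
    have "(\<lambda>\<delta>. if \<delta> = \<alpha> then 1 else - 1 :: rat) \<alpha> = 0"
      by (rule S_pointwise_independent[of "{\<alpha>, \<beta>}"]) (use ab ne in auto)
    then show False by simp
  qed
qed

lemma S_independent: "Q.independent (S ` Comp)"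
proof
  assume "Q.dependent (S ` Comp)"
  then obtain t u v where t: "finite t" "t \<subseteq> S ` Comp" "(\<Sum>w\<in>t. u w *\<^sub>Q w) = 0" "v \<in> t" "u v \<noteq> 0"
    unfolding Q.dependent_explicit by blast
  obtain A where A: "A \<subseteq> Comp" "finite A" "t = S ` A" using finite_subset_image[OF t(1,2)] by blast
  have inj: "inj_on S A" using S_inj A(1) by (rule inj_on_subset)
  have "(\<Sum>\<alpha>\<in>A. u (S \<alpha>) *\<^sub>Q S \<alpha>) = 0" using t(3) unfolding A(3) by (simp add: sum.reindex[OF inj])
  then have "u (S \<alpha>) = 0" if "\<alpha> \<in> A" for \<alpha>
    using indep_familyD[OF S_indep A(2,1), of "\<lambda>\<alpha>. u (S \<alpha>)" \<alpha>] that by simp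
  then show False using t(4,5) A(3) by auto
qed

text \<open>Unitriangularity allows solving for \<open>M\<close> by induction on the level.\<close>

lemma M_in_span_S: "\<beta> \<in> Comp \<Longrightarrow> M \<beta> \<in> Q.span (S ` Comps (sum_list \<beta>))"
proof (induction "level \<beta>" arbitrary: \<beta> rule: less_induct)
  case less
  let ?C = "Comps (sum_list \<beta>)"
  have \<beta>: "\<beta> \<in> ?C" using less.prems by (simp add: Comps_def)
  have "S \<beta> = M \<beta> + (\<Sum>\<delta>\<in>?C - {\<beta>}. of_nat (kostka [] \<beta> \<delta>) *\<^sub>Q M \<delta>)"
    unfolding S_expansion[OF less.prems] using finite_Comps \<beta>
    by (subst sum.remove[of _ \<beta>]) (simp_all add: kostka_diagonal[OF less.prems])
  then have M: "M \<beta> = S \<beta> - (\<Sum>\<delta>\<in>?C - {\<beta>}. of_nat (kostka [] \<beta> \<delta>) *\<^sub>Q M \<delta>)" by simp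
  have "of_nat (kostka [] \<beta> \<delta>) *\<^sub>Q M \<delta> \<in> Q.span (S ` ?C)" if "\<delta> \<in> ?C - {\<beta>}" for \<delta>
  proof (cases "kostka [] \<beta> \<delta> = 0")
    case True
    then show ?thesis by (simp add: Q.span_zero)
  next
    case False
    have \<delta>: "\<delta> \<in> Comp" "sum_list \<delta> = sum_list \<beta>" using that by (auto simp: Comps_def)
    then have "level \<delta> < level \<beta>" using kostka_triangular[OF \<delta>(1) False] that by auto
    then have "M \<delta> \<in> Q.span (S ` ?C)" using less.hyps[of \<delta>] \<delta> by simp
    then show ?thesis by (rule Q.span_scale)
  qed
  then have "(\<Sum>\<delta>\<in>?C - {\<beta>}. of_nat (kostka [] \<beta> \<delta>) *\<^sub>Q M \<delta>) \<in> Q.span (S ` ?C)" by (rule Q.span_sum)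
  moreover have "S \<beta> \<in> Q.span (S ` ?C)" using \<beta> by (intro Q.span_base) simp
  ultimately show ?case unfolding M by (intro Q.span_diff)
qed

lemma S_in_QSym_deg: "\<gamma> \<in> Comp \<Longrightarrow> S \<gamma> \<in> QSym_deg (sum_list \<gamma>)"
  unfolding QSym_deg_def
  by (subst S_expansion, assumption)
     (intro Q.span_sum Q.span_scale Q.span_base, simp add: Comps_def)

lemma QSym_deg_subset: "QSym_deg n \<subseteq> QSym"
  unfolding QSym_deg_def QSym_def by (rule Q.span_mono) auto

lemma S_in_QSym: "\<gamma> \<in> Comp \<Longrightarrow> S \<gamma> \<in> QSym"
  using S_in_QSym_deg QSym_deg_subset by blast

lemma QSym_deg_span_S: "QSym_deg n = Q.span (S ` Comps n)"
proof
  show "QSym_deg n \<subseteq> Q.span (S ` Comps n)"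
    unfolding QSym_deg_def using M_in_span_S by (intro Q.span_minimal) (auto simp: Q.subspace_span)
  show "Q.span (S ` Comps n) \<subseteq> QSym_deg n"
    using S_in_QSym_deg unfolding QSym_deg_def
    by (intro Q.span_minimal) (auto simp: Q.subspace_span Comps_def)
qed

lemma QSym_span_S: "QSym = Q.span (S ` Comp)"
proof
  have "M \<beta> \<in> Q.span (S ` Comp)" if "\<beta> \<in> Comp" for \<beta>
    using M_in_span_S[OF that] Q.span_mono[of "S ` Comps (sum_list \<beta>)" "S ` Comp"] by (auto simp: Comps_def)
  then show "QSym \<subseteq> Q.span (S ` Comp)"
    unfolding QSym_def by (intro Q.span_minimal) (auto simp: Q.subspace_span)
  show "Q.span (S ` Comp) \<subseteq> QSym"
    using S_in_QSym unfolding QSym_def by (intro Q.span_minimal) (auto simp: Q.subspace_span)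
qed

lemma QSym_expansion:
  assumes "f \<in> QSym"
  obtains A c where "finite A" "A \<subseteq> Comp" "f = (\<Sum>\<gamma>\<in>A. c \<gamma> *\<^sub>Q S \<gamma>)"
proof -
  obtain t r where t: "finite t" "t \<subseteq> S ` Comp" "f = (\<Sum>v\<in>t. r v *\<^sub>Q v)"
    using assms unfolding QSym_span_S Q.span_explicit by blast
  obtain A where A: "A \<subseteq> Comp" "finite A" "t = S ` A" using finite_subset_image[OF t(1,2)] by blast
  have "inj_on S A" using S_inj A(1) by (rule inj_on_subset)
  then have "f = (\<Sum>\<gamma>\<in>A. r (S \<gamma>) *\<^sub>Q S \<gamma>)" unfolding t(3) A(3) by (simp add: sum.reindex)
  then show ?thesis using that[of A "\<lambda>\<gamma>. r (S \<gamma>)"] A by blast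
qed

lemma QSym_sum: "(\<And>i. i \<in> A \<Longrightarrow> f i \<in> QSym) \<Longrightarrow> (\<Sum>i\<in>A. c i *\<^sub>Q f i) \<in> QSym"
  unfolding QSym_def by (intro Q.span_sum Q.span_scale)

section \<open>The dual basis\<close>

lemma NSym_zero: "\<phi> \<in> NSym \<Longrightarrow> \<phi> 0 = 0"
proof -
  assume "\<phi> \<in> NSym"
  moreover have "(0 :: series) \<in> QSym" unfolding QSym_def by (rule Q.span_zero)
  ultimately have "\<phi> (0 *\<^sub>Q (0 :: series)) = 0 * \<phi> 0" unfolding NSym_def by blast
  then show ?thesis by simp
qed

lemma NSym_sum:
  assumes "\<phi> \<in> NSym" "finite A" "\<And>i. i \<in> A \<Longrightarrow> f i \<in> QSym"
  shows "\<phi> (\<Sum>i\<in>A. c i *\<^sub>Q f i) = (\<Sum>i\<in>A. c i * \<phi> (f i))"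
  using assms(2,3)
proof (induction A rule: finite_induct)
  case empty
  show ?case unfolding sum.empty by (rule NSym_zero[OF assms(1)])
next
  case (insert x A)
  have "c x *\<^sub>Q f x \<in> QSym" using insert.prems[of x] unfolding QSym_def by (intro Q.span_scale) simp
  moreover have "(\<Sum>i\<in>A. c i *\<^sub>Q f i) \<in> QSym" using insert.prems by (intro QSym_sum) simp
  ultimately have "\<phi> (c x *\<^sub>Q f x + (\<Sum>i\<in>A. c i *\<^sub>Q f i)) = \<phi> (c x *\<^sub>Q f x) + \<phi> (\<Sum>i\<in>A. c i *\<^sub>Q f i)"
    using assms(1) unfolding NSym_def by blast
  moreover have "\<phi> (c x *\<^sub>Q f x) = c x * \<phi> (f x)" using assms(1) insert.prems[of x] unfolding NSym_def by blast
  moreover have "\<phi> (\<Sum>i\<in>A. c i *\<^sub>Q f i) = (\<Sum>i\<in>A. c i * \<phi> (f i))" using insert by blast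
  ultimately show ?case unfolding sum.insert[OF insert.hyps] by (simp only:)
qed

text \<open>The coefficient functional for the basis \<open>S\<close>.\<close>

lemma S_dual_exists:
  assumes "\<beta> \<in> Comp"
  shows "\<exists>\<phi>. \<phi> \<in> NSym \<and> (\<forall>\<alpha>\<in>Comp. \<langle>S \<alpha>, \<phi>\<rangle> = (if \<alpha> = \<beta> then 1 else 0))"
proof -
  define \<phi> where "\<phi> f = Q.representation (S ` Comp) f (S \<beta>)" for f
  have S: "\<phi> (S \<alpha>) = (if \<alpha> = \<beta> then 1 else 0)" if "\<alpha> \<in> Comp" for \<alpha>
  proof -
    have "Q.representation (S ` Comp) (S \<alpha>) = (\<lambda>v. if v = S \<alpha> then 1 else 0)"
      using that by (intro Q.representation_basis S_independent) auto
    then show ?thesis using that assms inj_onD[OF S_inj, of \<beta> \<alpha>] by (auto simp: \<phi>_def)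
  qed
  have add: "\<phi> (f + g) = \<phi> f + \<phi> g" if "f \<in> QSym" "g \<in> QSym" for f g
    using that Q.representation_add[OF S_independent, of g f] by (simp add: \<phi>_def QSym_span_S)
  have scale: "\<phi> (c *\<^sub>Q f) = c * \<phi> f" if "f \<in> QSym" for c f
    using that Q.representation_scale[OF S_independent, of f c] by (simp add: \<phi>_def QSym_span_S)
  have out: "\<phi> f = 0" if "f \<notin> QSym" for f
    using that by (simp add: \<phi>_def QSym_span_S Q.representation_def)
  have deg: "\<phi> f = 0" if "f \<in> QSym_deg n" "n \<noteq> sum_list \<beta>" for f n
  proof -
    have "Q.subspace {f \<in> QSym. \<phi> f = 0}"
    proof (rule Q.subspaceI)
      have "\<phi> 0 = 0" using scale[of 0 0] by (simp add: QSym_def Q.span_zero)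
      then show "0 \<in> {f \<in> QSym. \<phi> f = 0}" by (simp add: QSym_def Q.span_zero)
    qed (auto simp: add scale, auto simp: QSym_def Q.span_add Q.span_scale)
    moreover have "S ` Comps n \<subseteq> {f \<in> QSym. \<phi> f = 0}" using S S_in_QSym that(2) by (auto simp: Comps_def)
    ultimately show ?thesis using that(1) Q.span_minimal[of "S ` Comps n" "{f \<in> QSym. \<phi> f = 0}"]
      unfolding QSym_deg_span_S by blast
  qed
  have "{n. \<exists>f\<in>QSym_deg n. \<phi> f \<noteq> 0} \<subseteq> {sum_list \<beta>}" using deg by blast
  then have "finite {n. \<exists>f\<in>QSym_deg n. \<phi> f \<noteq> 0}" by (rule finite_subset) simp
  then have "\<phi> \<in> NSym" using add scale out unfolding NSym_def by blast
  then show ?thesis using S unfolding pairing_def by blast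
qed

lemma NSym_eqI:
  assumes "\<phi> \<in> NSym" "\<psi> \<in> NSym" "\<And>\<alpha>. \<alpha> \<in> Comp \<Longrightarrow> \<phi> (S \<alpha>) = \<psi> (S \<alpha>)"
  shows "\<phi> = \<psi>"
proof
  fix f
  show "\<phi> f = \<psi> f"
  proof (cases "f \<in> QSym")
    case True
    then obtain A c where A: "finite A" "A \<subseteq> Comp" "f = (\<Sum>\<gamma>\<in>A. c \<gamma> *\<^sub>Q S \<gamma>)" by (rule QSym_expansion)
    have "S \<gamma> \<in> QSym" if "\<gamma> \<in> A" for \<gamma> using S_in_QSym A(2) that by blast
    then have "\<phi> f = (\<Sum>\<gamma>\<in>A. c \<gamma> * \<phi> (S \<gamma>))" "\<psi> f = (\<Sum>\<gamma>\<in>A. c \<gamma> * \<psi> (S \<gamma>))"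
      unfolding A(3) using NSym_sum[OF assms(1) A(1)] NSym_sum[OF assms(2) A(1)] by blast+
    moreover have "(\<Sum>\<gamma>\<in>A. c \<gamma> * \<phi> (S \<gamma>)) = (\<Sum>\<gamma>\<in>A. c \<gamma> * \<psi> (S \<gamma>))"
      using assms(3) A(2) by (intro sum.cong) auto
    ultimately show ?thesis by simp
  next
    case False
    then show ?thesis using assms(1,2) unfolding NSym_def by auto
  qed
qed

lemma S_dual:
  assumes "\<beta> \<in> Comp"
  shows "S\<^sup>* \<beta> \<in> NSym" "\<alpha> \<in> Comp \<Longrightarrow> (S\<^sup>* \<beta>) (S \<alpha>) = (if \<alpha> = \<beta> then 1 else 0)"
proof -
  let ?P = "\<lambda>\<phi>. \<phi> \<in> NSym \<and> (\<forall>\<alpha>\<in>Comp. \<langle>S \<alpha>, \<phi>\<rangle> = (if \<alpha> = \<beta> then 1 else 0))"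
  have "\<exists>!\<phi>. ?P \<phi>"
  proof (rule ex_ex1I)
    show "\<exists>\<phi>. ?P \<phi>" using S_dual_exists[OF assms] .
    fix \<phi> \<psi> assume "?P \<phi>" "?P \<psi>"
    then show "\<phi> = \<psi>" by (intro NSym_eqI) (auto simp: pairing_def)
  qed
  then have "?P (S\<^sup>* \<beta>)" unfolding S_dual_def by (rule theI')
  then show "S\<^sup>* \<beta> \<in> NSym" "\<alpha> \<in> Comp \<Longrightarrow> (S\<^sup>* \<beta>) (S \<alpha>) = (if \<alpha> = \<beta> then 1 else 0)"
    by (auto simp: pairing_def)
qed

lemma S_dual_sum:
  assumes "\<beta> \<in> Comp" "finite A" "\<And>i. i \<in> A \<Longrightarrow> p i \<in> Comp"
  shows "(S\<^sup>* \<beta>) (\<Sum>i\<in>A. c i *\<^sub>Q S (p i)) = (\<Sum>i\<in>A. if p i = \<beta> then c i else 0)"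
proof -
  have "(S\<^sup>* \<beta>) (\<Sum>i\<in>A. c i *\<^sub>Q S (p i)) = (\<Sum>i\<in>A. c i * (S\<^sup>* \<beta>) (S (p i)))"
    using assms S_dual(1) S_in_QSym by (intro NSym_sum) auto
  also have "\<dots> = (\<Sum>i\<in>A. if p i = \<beta> then c i else 0)"
    using S_dual(2)[OF assms(1)] assms(3) by (intro sum.cong) auto
  finally show ?thesis .
qed

lemma S_dual_indep: "indep_family Comp S\<^sup>*"
  unfolding indep_family_def
proof (intro allI impI ballI)
  fix A u \<alpha> assume A: "finite A" "A \<subseteq> Comp" "(\<Sum>i\<in>A. u i *\<^sub>Q S\<^sup>* i) = 0" "\<alpha> \<in> A"
  have "0 = (\<Sum>i\<in>A. u i * (S\<^sup>* i) (S \<alpha>))"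
    using fun_cong[OF A(3), of "S \<alpha>"] by (simp add: sum_fun_apply scale_def)
  also have "\<dots> = (\<Sum>i\<in>A. if i = \<alpha> then u i else 0)"
  proof (rule sum.cong[OF refl])
    fix i assume "i \<in> A"
    then have "i \<in> Comp" "\<alpha> \<in> Comp" using A(2,4) by blast+
    then show "u i * (S\<^sup>* i) (S \<alpha>) = (if i = \<alpha> then u i else 0)" by (auto simp: S_dual(2))
  qed
  finally show "u \<alpha> = 0" using A by simp
qed

section \<open>Coproduct, skew functions and product\<close>

text \<open>The coefficient of \<open>M \<alpha> \<otimes> M \<beta>\<close> in \<open>\<Delta> f\<close> is the coefficient of \<open>M (\<alpha> @ \<beta>)\<close> in \<open>f\<close>.\<close>

lemma coproduct_apply:
  assumes "f \<in> QSym" "nonzero_parts c = nonzero_parts a @ nonzero_parts b"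
  shows "\<Delta> f (a, b) = f c"
proof -
  define r where "r = Q.representation (M ` Comp) f"
  have f: "f \<in> Q.span (M ` Comp)" using assms(1) by (simp add: QSym_def)
  have rM: "r (M (nonzero_parts c)) = f c" for c
  proof -
    have fin: "finite {v. r v \<noteq> 0}" unfolding r_def by (rule Q.finite_representation)
    have v: "v c = (if v = M (nonzero_parts c) then 1 else 0)" if "r v \<noteq> 0" for v
    proof -
      have "v \<in> M ` Comp" using that Q.representation_ne_zero unfolding r_def by blast
      then obtain \<delta> where "\<delta> \<in> Comp" "v = M \<delta>" by blast
      then show ?thesis using inj_onD[OF M_inj, of \<delta> "nonzero_parts c"] nonzero_parts_Comp by (auto simp: M_def)
    qed
    have "f c = (\<Sum>v | r v \<noteq> 0. r v *\<^sub>Q v) c"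
      using Q.sum_nonzero_representation_eq[OF M_independent f] by (simp add: r_def)
    also have "\<dots> = (\<Sum>v | r v \<noteq> 0. if v = M (nonzero_parts c) then r v else 0)"
      unfolding sum_fun_apply
    proof (rule sum.cong[OF refl])
      fix v assume "v \<in> {v. r v \<noteq> 0}"
      then show "(r v *\<^sub>Q v) c = (if v = M (nonzero_parts c) then r v else 0)"
        using v[of v] by (simp add: scale_def)
    qed
    also have "\<dots> = r (M (nonzero_parts c))" using fin by simp
    finally show ?thesis by simp
  qed
  let ?A = "{\<alpha> \<in> Comp. r (M \<alpha>) \<noteq> 0}"
  have "finite (M ` ?A)" using Q.finite_representation[of "M ` Comp" f] by (rule rev_finite_subset) (auto simp: r_def)
  then have fin: "finite ?A" by (rule finite_imageD) (rule inj_on_subset[OF M_inj], auto)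
  define N where "N \<alpha> = (\<Sum>(\<beta>, \<gamma>)\<in>{(\<beta>, \<gamma>). \<beta> @ \<gamma> = \<alpha>}. M \<beta> \<otimes> M \<gamma>)" for \<alpha>
  have split: "N \<alpha> (a, b) = (if nonzero_parts c = \<alpha> then 1 else 0)" for \<alpha>
  proof -
    have fin: "finite {(\<beta>, \<gamma>). \<beta> @ \<gamma> = \<alpha>}"
    proof (rule finite_subset)
      show "{(\<beta>, \<gamma>). \<beta> @ \<gamma> = \<alpha>} \<subseteq> (\<lambda>n. (take n \<alpha>, drop n \<alpha>)) ` {..length \<alpha>}"
      proof clarify
        fix \<beta> \<gamma> :: "nat list"
        show "(\<beta>, \<gamma>) \<in> (\<lambda>n. (take n (\<beta> @ \<gamma>), drop n (\<beta> @ \<gamma>))) ` {..length (\<beta> @ \<gamma>)}"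
          by (rule image_eqI[of _ _ "length \<beta>"]) simp_all
      qed
    qed simp
    have "N \<alpha> (a, b) =
        (\<Sum>p\<in>{(\<beta>, \<gamma>). \<beta> @ \<gamma> = \<alpha>}. if p = (nonzero_parts a, nonzero_parts b) then 1 else 0)"
      unfolding N_def sum_fun_apply by (intro sum.cong) (auto simp: tensor_def M_def split: if_splits)
    also have "\<dots> = (if nonzero_parts c = \<alpha> then 1 else 0)" using fin assms(2) by simp
    finally show ?thesis .
  qed
  have "\<Delta> f (a, b) = (\<Sum>\<alpha>\<in>?A. if \<alpha> = nonzero_parts c then r (M \<alpha>) else 0)"
    unfolding coproduct_def Let_def r_def[symmetric] N_def[symmetric] sum_fun_apply scale_def
    using split by (intro sum.cong) auto
  also have "\<dots> = r (M (nonzero_parts c))" using fin nonzero_parts_Comp[of c] by auto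
  finally show ?thesis using rM by simp
qed

text \<open>By homogeneity, only these pairs contribute to the coproduct of a function of degree \<open>n\<close>.\<close>

definition degree_pairs :: "nat \<Rightarrow> (nat list \<times> nat list) set" where
  "degree_pairs n = {(\<alpha>, \<beta>). \<alpha> \<in> Comp \<and> \<beta> \<in> Comp \<and> sum_list \<alpha> + sum_list \<beta> = n}"

lemma finite_degree_pairs: "finite (degree_pairs n)"
proof (rule finite_subset)
  show "degree_pairs n \<subseteq> (\<Union>i\<le>n. Comps i) \<times> (\<Union>i\<le>n. Comps i)" by (auto simp: degree_pairs_def Comps_def)
qed (simp add: finite_Comps)

text \<open>The coefficient of \<open>\<Delta> (S \<gamma>)\<close> at \<open>(a, b)\<close> is the Kostka number for the concatenated
  content. Cut the content by \<open>kostka_append\<close> and expand the skew factor by \<open>kostka_expansion\<close>.\<close>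

lemma coproduct_S_apply:
  assumes "\<gamma> \<in> Comp"
  shows "\<Delta> (S \<gamma>) (a, b) = (\<Sum>(\<alpha>, \<beta>)\<in>degree_pairs (sum_list \<gamma>). of_nat (lr_coeff \<gamma> \<alpha> \<beta>) * (S \<alpha> a * S \<beta> b))"
proof -
  let ?a = "nonzero_parts a" and ?b = "nonzero_parts b"
  have ab: "?a @ ?b \<in> Comp" using nonzero_parts_Comp[of a] nonzero_parts_Comp[of b] by (auto simp: Comp_def)
  obtain c where c: "nonzero_parts c = ?a @ ?b" by (rule nonzero_parts_surj[OF ab])
  define t where "t \<alpha> \<beta> = lr_coeff \<gamma> \<alpha> \<beta> * (kostka [] \<alpha> ?a * kostka [] \<beta> ?b)" for \<alpha> \<beta>
  have t: "sum_list \<alpha> = sum_list ?a \<and> sum_list \<beta> = sum_list ?b \<and> sum_list \<alpha> + sum_list \<beta> = sum_list \<gamma>"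
    if "t \<alpha> \<beta> \<noteq> 0" for \<alpha> \<beta>
    using that kostka_sum[of "[]" \<alpha> ?a] kostka_sum[of "[]" \<beta> ?b] lr_coeff_sum[of \<gamma> \<alpha> \<beta>] by (auto simp: t_def)
  have "kostka [] \<gamma> (?a @ ?b) = (\<Sum>\<beta>\<in>Comps (sum_list ?b). \<Sum>\<alpha>\<in>Comps (sum_list ?a). t \<alpha> \<beta>)"
    unfolding kostka_append
  proof (rule sum.cong[OF refl])
    fix \<beta> assume "\<beta> \<in> Comps (sum_list ?b)"
    then have "\<beta> \<in> Comp" by (simp add: Comps_def)
    then show "kostka \<beta> \<gamma> ?a * kostka [] \<beta> ?b = (\<Sum>\<alpha>\<in>Comps (sum_list ?a). t \<alpha> \<beta>)"
      by (simp add: kostka_expansion t_def sum_distrib_right mult.assoc)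
  qed
  also have "\<dots> = (\<Sum>(\<alpha>, \<beta>)\<in>Comps (sum_list ?a) \<times> Comps (sum_list ?b). t \<alpha> \<beta>)"
    by (subst sum.swap) (simp add: sum.cartesian_product)
  also have "\<dots> = (\<Sum>(\<alpha>, \<beta>)\<in>degree_pairs (sum_list \<gamma>) \<union> Comps (sum_list ?a) \<times> Comps (sum_list ?b). t \<alpha> \<beta>)"
    using finite_degree_pairs finite_Comps t by (intro sum.mono_neutral_left) (auto simp: degree_pairs_def Comps_def)
  also have "\<dots> = (\<Sum>(\<alpha>, \<beta>)\<in>degree_pairs (sum_list \<gamma>). t \<alpha> \<beta>)"
    using finite_degree_pairs finite_Comps t by (intro sum.mono_neutral_right) (auto simp: degree_pairs_def Comps_def)
  finally have "of_nat (kostka [] \<gamma> (?a @ ?b)) = (\<Sum>(\<alpha>, \<beta>)\<in>degree_pairs (sum_list \<gamma>). of_nat (t \<alpha> \<beta>) :: rat)"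
    by (simp add: of_nat_sum split_def)
  moreover have "\<Delta> (S \<gamma>) (a, b) = of_nat (kostka [] \<gamma> (?a @ ?b))"
    using coproduct_apply[OF S_in_QSym[OF assms] c] S_kostka[OF assms, of c] c by simp
  moreover have "(\<Sum>(\<alpha>, \<beta>)\<in>degree_pairs (sum_list \<gamma>). of_nat (t \<alpha> \<beta>) :: rat) =
      (\<Sum>(\<alpha>, \<beta>)\<in>degree_pairs (sum_list \<gamma>). of_nat (lr_coeff \<gamma> \<alpha> \<beta>) * (S \<alpha> a * S \<beta> b))"
    by (rule sum.cong[OF refl]) (auto simp: degree_pairs_def t_def S_kostka)
  ultimately show ?thesis by simp
qed

text \<open>Apply the independence of the \<open>S \<alpha>\<close> in one set of variables after the other.\<close>

lemma tensor_indep: "indep_family (Comp \<times> Comp) (\<lambda>(\<alpha>, \<beta>). S \<alpha> \<otimes> S \<beta>)"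
  unfolding indep_family_def
proof (intro allI impI ballI)
  fix A u p
  assume A: "finite A" "A \<subseteq> Comp \<times> Comp" "(\<Sum>i\<in>A. u i *\<^sub>Q (case i of (\<alpha>, \<beta>) \<Rightarrow> S \<alpha> \<otimes> S \<beta>)) = 0" "p \<in> A"
  define A1 A2 where "A1 = fst ` A" "A2 = snd ` A"
  have fin: "finite A1" "finite A2" "A1 \<subseteq> Comp" "A2 \<subseteq> Comp" "A \<subseteq> A1 \<times> A2"
    using A(1,2) by (force simp: A1_A2_def)+
  \<comment> \<open>The coefficients are extended by 0 to a rectangle of indices.\<close>
  define w where "w q = (if q \<in> A then u q else 0)" for q
  have "(\<Sum>\<beta>\<in>A2. (\<Sum>\<alpha>\<in>A1. w (\<alpha>, \<beta>) * S \<alpha> a) * S \<beta> b) = 0" for a b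
  proof -
    have "0 = (\<Sum>(\<alpha>, \<beta>)\<in>A. u (\<alpha>, \<beta>) * (S \<alpha> a * S \<beta> b))"
      using fun_cong[OF A(3), of "(a, b)"] by (simp add: sum_fun_apply scale_def tensor_def split_def)
    also have "\<dots> = (\<Sum>(\<alpha>, \<beta>)\<in>A1 \<times> A2. w (\<alpha>, \<beta>) * (S \<alpha> a * S \<beta> b))"
      using fin by (intro sum.mono_neutral_cong_left) (auto simp: w_def)
    also have "\<dots> = (\<Sum>\<alpha>\<in>A1. \<Sum>\<beta>\<in>A2. w (\<alpha>, \<beta>) * (S \<alpha> a * S \<beta> b))" by (simp add: sum.cartesian_product)
    also have "\<dots> = (\<Sum>\<beta>\<in>A2. (\<Sum>\<alpha>\<in>A1. w (\<alpha>, \<beta>) * S \<alpha> a) * S \<beta> b)"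
      by (subst sum.swap) (simp add: sum_distrib_right mult.assoc)
    finally show ?thesis by simp
  qed
  then have "(\<Sum>\<alpha>\<in>A1. w (\<alpha>, \<beta>) * S \<alpha> a) = 0" if "\<beta> \<in> A2" for \<beta> a
    using S_pointwise_independent[OF fin(2,4), of "\<lambda>\<beta>. \<Sum>\<alpha>\<in>A1. w (\<alpha>, \<beta>) * S \<alpha> a"] that by blast
  then have zero: "w (\<alpha>, \<beta>) = 0" if "\<alpha> \<in> A1" "\<beta> \<in> A2" for \<alpha> \<beta>
    using S_pointwise_independent[OF fin(1,3), of "\<lambda>\<alpha>. w (\<alpha>, \<beta>)"] that by blast
  obtain \<alpha> \<beta> where p: "p = (\<alpha>, \<beta>)" by fastforce
  then have "w (\<alpha>, \<beta>) = 0" using A(4) fin(5) by (intro zero) auto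
  then show "u p = 0" using A(4) p by (simp add: w_def)
qed

lemma coproduct_S_expansion:
  assumes "\<gamma> \<in> Comp"
  shows "has_expansion (\<Delta> (S \<gamma>)) (Comp \<times> Comp) (\<lambda>(\<alpha>, \<beta>). S \<alpha> \<otimes> S \<beta>) (\<lambda>(\<alpha>, \<beta>). of_nat (lr_coeff \<gamma> \<alpha> \<beta>))"
proof (rule has_expansionI)
  show "finite (degree_pairs (sum_list \<gamma>))" by (rule finite_degree_pairs)
  show "degree_pairs (sum_list \<gamma>) \<subseteq> Comp \<times> Comp" by (auto simp: degree_pairs_def)
  show "(case i of (\<alpha>, \<beta>) \<Rightarrow> of_nat (lr_coeff \<gamma> \<alpha> \<beta>)) = (0 :: rat)" if "i \<in> Comp \<times> Comp - degree_pairs (sum_list \<gamma>)" for i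
    using that lr_coeff_sum[of \<gamma>] by (force simp: degree_pairs_def)
  show "\<Delta> (S \<gamma>) = (\<Sum>i\<in>degree_pairs (sum_list \<gamma>).
      (case i of (\<alpha>, \<beta>) \<Rightarrow> of_nat (lr_coeff \<gamma> \<alpha> \<beta>)) *\<^sub>Q (case i of (\<alpha>, \<beta>) \<Rightarrow> S \<alpha> \<otimes> S \<beta>))"
  proof
    fix p :: "exponent \<times> exponent"
    obtain a b where p: "p = (a, b)" by fastforce
    show "\<Delta> (S \<gamma>) p = (\<Sum>i\<in>degree_pairs (sum_list \<gamma>).
      (case i of (\<alpha>, \<beta>) \<Rightarrow> of_nat (lr_coeff \<gamma> \<alpha> \<beta>)) *\<^sub>Q (case i of (\<alpha>, \<beta>) \<Rightarrow> S \<alpha> \<otimes> S \<beta>)) p"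
      unfolding p coproduct_S_apply[OF assms] sum_fun_apply
      by (intro sum.cong) (auto simp: scale_def tensor_def)
  qed
qed

text \<open>Collect the terms of the coproduct with the same second factor; independence of the second
  factors shows that there is no other such family.\<close>

lemma skew_S_expansion:
  assumes "\<gamma> \<in> Comp" "\<beta> \<in> Comp"
  shows "has_expansion (skew_S \<gamma> \<beta>) Comp S (\<lambda>\<alpha>. of_nat (lr_coeff \<gamma> \<alpha> \<beta>))"
proof -
  let ?n = "sum_list \<gamma>"
  \<comment> \<open>All compositions that can occur in either factor.\<close>
  define D where "D = (\<Union>i\<le>?n. Comps i)"
  have D: "finite D" "D \<subseteq> Comp" by (simp add: D_def finite_Comps, auto simp: D_def Comps_def)
  have out: "lr_coeff \<gamma> \<alpha> \<beta> = 0" if "\<alpha> \<in> Comp" "\<beta> \<in> Comp" "\<alpha> \<notin> D \<or> \<beta> \<notin> D" for \<alpha> \<beta>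
    by (rule ccontr) (use lr_coeff_sum[of \<gamma> \<alpha> \<beta>] that in \<open>auto simp: D_def Comps_def\<close>)
  define F where "F \<beta> = (if \<beta> \<in> Comp then (\<Sum>\<alpha>\<in>D. of_nat (lr_coeff \<gamma> \<alpha> \<beta>) *\<^sub>Q S \<alpha>) else 0)" for \<beta>
  let ?P = "\<lambda>F. (\<forall>\<beta>\<in>Comp. F \<beta> \<in> QSym) \<and> (\<forall>\<beta>. \<beta> \<notin> Comp \<longrightarrow> F \<beta> = 0) \<and> finite {\<beta>. F \<beta> \<noteq> 0} \<and>
     \<Delta> (S \<gamma>) = (\<Sum>\<beta>\<in>{\<beta>. F \<beta> \<noteq> 0}. F \<beta> \<otimes> S \<beta>)"
  have "F \<beta> = 0" if "\<beta> \<notin> D" for \<beta>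
    using out[of _ \<beta>] that D(2) unfolding F_def by (auto intro!: sum.neutral)
  then have supp: "{\<beta>. F \<beta> \<noteq> 0} \<subseteq> D" by blast
  have "\<Delta> (S \<gamma>) = (\<Sum>\<beta>\<in>D. F \<beta> \<otimes> S \<beta>)"
  proof
    fix p :: "exponent \<times> exponent"
    obtain a b where p: "p = (a, b)" by fastforce
    have "\<Delta> (S \<gamma>) p = (\<Sum>(\<alpha>, \<beta>)\<in>D \<times> D. of_nat (lr_coeff \<gamma> \<alpha> \<beta>) * (S \<alpha> a * S \<beta> b))"
      unfolding p coproduct_S_apply[OF assms(1)]
    proof (rule sum.mono_neutral_left)
      show "degree_pairs ?n \<subseteq> D \<times> D" by (auto simp: degree_pairs_def D_def Comps_def)
      show "\<forall>i\<in>D \<times> D - degree_pairs ?n. (case i of (\<alpha>, \<beta>) \<Rightarrow> of_nat (lr_coeff \<gamma> \<alpha> \<beta>) * (S \<alpha> a * S \<beta> b)) = 0"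
        using lr_coeff_sum[of \<gamma>] D(2) by (force simp: degree_pairs_def)
    qed (simp add: D)
    also have "\<dots> = (\<Sum>\<alpha>\<in>D. \<Sum>\<beta>\<in>D. of_nat (lr_coeff \<gamma> \<alpha> \<beta>) * (S \<alpha> a * S \<beta> b))" by (simp add: sum.cartesian_product)
    also have "\<dots> = (\<Sum>\<beta>\<in>D. (\<Sum>\<alpha>\<in>D. of_nat (lr_coeff \<gamma> \<alpha> \<beta>) * S \<alpha> a) * S \<beta> b)"
      by (subst sum.swap) (simp add: sum_distrib_right mult.assoc)
    also have "\<dots> = (\<Sum>\<beta>\<in>D. F \<beta> \<otimes> S \<beta>) p"
      unfolding p sum_fun_apply using D(2)
      by (intro sum.cong) (auto simp: F_def tensor_def sum_fun_apply scale_def)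
    finally show "\<Delta> (S \<gamma>) p = (\<Sum>\<beta>\<in>D. F \<beta> \<otimes> S \<beta>) p" .
  qed
  also have "\<dots> = (\<Sum>\<beta>\<in>{\<beta>. F \<beta> \<noteq> 0}. F \<beta> \<otimes> S \<beta>)"
    using D(1) supp by (intro sum.mono_neutral_right) (auto simp: tensor_def fun_eq_iff)
  finally have P: "?P F"
    using finite_subset[OF supp D(1)] D S_in_QSym by (auto simp: F_def intro!: QSym_sum)
  have uniq: "G = F" if "?P G" for G
  proof
    fix \<beta>
    let ?B = "{\<beta>. F \<beta> \<noteq> 0} \<union> {\<beta>. G \<beta> \<noteq> 0}"
    have B: "finite ?B" "?B \<subseteq> Comp" using that P by auto
    have ext: "(\<Sum>\<beta>\<in>?B. H \<beta> a * S \<beta> b) = \<Delta> (S \<gamma>) (a, b)" if "?P H" "{\<beta>. H \<beta> \<noteq> 0} \<subseteq> ?B" for H a b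
    proof -
      have "(\<Sum>\<beta>\<in>?B. H \<beta> a * S \<beta> b) = (\<Sum>\<beta>\<in>{\<beta>. H \<beta> \<noteq> 0}. H \<beta> a * S \<beta> b)"
        using B(1) that(2) by (intro sum.mono_neutral_right) auto
      also have "\<dots> = (\<Sum>\<beta>\<in>{\<beta>. H \<beta> \<noteq> 0}. H \<beta> \<otimes> S \<beta>) (a, b)" by (simp add: sum_fun_apply tensor_def)
      finally show ?thesis using that(1) by simp
    qed
    have zero: "(\<Sum>\<beta>\<in>?B. (G \<beta> a - F \<beta> a) * S \<beta> b) = 0" for a b
      using ext[OF P, of a b] ext[OF \<open>?P G\<close>, of a b] by (simp add: left_diff_distrib sum_subtractf)
    show "G \<beta> = F \<beta>"
    proof (cases "\<beta> \<in> ?B")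
      case True
      have "G \<beta> a - F \<beta> a = 0" for a
        using S_pointwise_independent[OF B, of "\<lambda>\<beta>. G \<beta> a - F \<beta> a"] zero True by blast
      then show ?thesis by (simp add: fun_eq_iff)
    qed auto
  qed
  have "skew_S \<gamma> = F" unfolding skew_S_def by (rule the_equality) (use P uniq in blast)+
  then have "skew_S \<gamma> \<beta> = (\<Sum>\<alpha>\<in>D. of_nat (lr_coeff \<gamma> \<alpha> \<beta>) *\<^sub>Q S \<alpha>)" using assms(2) by (simp add: F_def)
  then show ?thesis using D out assms(2) by (intro has_expansionI[of D]) auto
qed

lemma expansion_pairing:
  assumes "has_expansion f Comp S c" "\<alpha> \<in> Comp"
  shows "\<langle>f, S\<^sup>* \<alpha>\<rangle> = c \<alpha>"
proof -
  let ?A = "{i \<in> Comp. c i \<noteq> 0}"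
  have A: "finite ?A" "f = (\<Sum>i\<in>?A. c i *\<^sub>Q S i)" using assms(1) by (auto simp: has_expansion_def)
  have "(S\<^sup>* \<alpha>) f = (\<Sum>i\<in>?A. if i = \<alpha> then c i else 0)"
    unfolding A(2) by (rule S_dual_sum[OF assms(2) A(1)]) simp
  then show ?thesis using A(1) assms(2) by (auto simp: pairing_def)
qed

text \<open>Contract the second and then the first factor of the coproduct by the dual basis.\<close>

lemma product_apply:
  assumes "\<alpha> \<in> Comp" "\<beta> \<in> Comp" "finite A" "A \<subseteq> Comp"
  shows "(S\<^sup>* \<alpha> \<star> S\<^sup>* \<beta>) (\<Sum>\<gamma>\<in>A. c \<gamma> *\<^sub>Q S \<gamma>) = (\<Sum>\<gamma>\<in>A. c \<gamma> * of_nat (lr_coeff \<gamma> \<alpha> \<beta>))"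
proof -
  let ?f = "\<Sum>\<gamma>\<in>A. c \<gamma> *\<^sub>Q S \<gamma>"
  define J where "J = Sigma A (\<lambda>\<gamma>. degree_pairs (sum_list \<gamma>))"
  define u where "u j = (case j of (\<gamma>, \<alpha>, \<beta>) \<Rightarrow> c \<gamma> * of_nat (lr_coeff \<gamma> \<alpha> \<beta>))" for j
  define p where "p j = fst (snd j)" for j :: "nat list \<times> nat list \<times> nat list"
  define q where "q j = snd (snd j)" for j :: "nat list \<times> nat list \<times> nat list"
  have J: "finite J" using assms(3) finite_degree_pairs by (simp add: J_def)
  have pq: "p j \<in> Comp" "q j \<in> Comp" if "j \<in> J" for j using that by (auto simp: J_def p_def q_def degree_pairs_def)
  have f: "?f \<in> QSym" using assms(4) S_in_QSym by (intro QSym_sum) auto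
  have "\<Delta> ?f (a, b) = (\<Sum>j\<in>J. u j * (S (p j) a * S (q j) b))" for a b
  proof -
    have "nonzero_parts a @ nonzero_parts b \<in> Comp"
      using nonzero_parts_Comp[of a] nonzero_parts_Comp[of b] by (auto simp: Comp_def)
    then obtain d where d: "nonzero_parts d = nonzero_parts a @ nonzero_parts b" by (rule nonzero_parts_surj)
    have "\<Delta> ?f (a, b) = (\<Sum>\<gamma>\<in>A. c \<gamma> * S \<gamma> d)"
      using coproduct_apply[OF f d] by (simp add: sum_fun_apply scale_def)
    also have "\<dots> = (\<Sum>\<gamma>\<in>A. c \<gamma> * \<Delta> (S \<gamma>) (a, b))"
      using assms(4) S_in_QSym by (intro sum.cong) (auto simp: coproduct_apply[OF _ d])
    also have "\<dots> = (\<Sum>\<gamma>\<in>A. \<Sum>(\<alpha>, \<beta>)\<in>degree_pairs (sum_list \<gamma>). c \<gamma> * (of_nat (lr_coeff \<gamma> \<alpha> \<beta>) * (S \<alpha> a * S \<beta> b)))"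
      using assms(4) by (intro sum.cong) (auto simp: coproduct_S_apply sum_distrib_left split_def)
    also have "\<dots> = (\<Sum>j\<in>J. u j * (S (p j) a * S (q j) b))"
      unfolding J_def using assms(3) finite_degree_pairs
      by (subst sum.Sigma) (auto simp: u_def p_def q_def split_def mult.assoc intro!: sum.cong)
    finally show ?thesis .
  qed
  then have "(\<lambda>b. \<Delta> ?f (a, b)) = (\<Sum>j\<in>J. (u j * S (p j) a) *\<^sub>Q S (q j))" for a
    by (simp add: fun_eq_iff sum_fun_apply scale_def mult.assoc)
  then have "(S\<^sup>* \<beta>) (\<lambda>b. \<Delta> ?f (a, b)) = (\<Sum>j\<in>J. if q j = \<beta> then u j * S (p j) a else 0)" for a
    using S_dual_sum[OF assms(2) J pq(2)] by simp
  then have "(\<lambda>a. (S\<^sup>* \<beta>) (\<lambda>b. \<Delta> ?f (a, b))) = (\<Sum>j\<in>J. (if q j = \<beta> then u j else 0) *\<^sub>Q S (p j))"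
    by (auto simp: fun_eq_iff sum_fun_apply scale_def intro!: sum.cong)
  then have "(S\<^sup>* \<alpha> \<star> S\<^sup>* \<beta>) ?f = (\<Sum>j\<in>J. if p j = \<alpha> then (if q j = \<beta> then u j else 0) else 0)"
    using S_dual_sum[OF assms(1) J pq(1)] f by (simp add: nsym_mult_def tensor_pairing_def pairing_def)
  also have "\<dots> = (\<Sum>\<gamma>\<in>A. \<Sum>i\<in>degree_pairs (sum_list \<gamma>). if i = (\<alpha>, \<beta>) then c \<gamma> * of_nat (lr_coeff \<gamma> \<alpha> \<beta>) else 0)"
    unfolding J_def using assms(3) finite_degree_pairs
    by (subst sum.Sigma) (auto simp: u_def p_def q_def split_def intro!: sum.cong)
  also have "\<dots> = (\<Sum>\<gamma>\<in>A. c \<gamma> * of_nat (lr_coeff \<gamma> \<alpha> \<beta>))"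
  proof (rule sum.cong[OF refl])
    fix \<gamma>
    have "(\<alpha>, \<beta>) \<in> degree_pairs (sum_list \<gamma>)" if "lr_coeff \<gamma> \<alpha> \<beta> \<noteq> 0"
      using lr_coeff_sum[OF that] assms(1,2) by (simp add: degree_pairs_def)
    then show "(\<Sum>i\<in>degree_pairs (sum_list \<gamma>). if i = (\<alpha>, \<beta>) then c \<gamma> * of_nat (lr_coeff \<gamma> \<alpha> \<beta>) else 0) =
        c \<gamma> * of_nat (lr_coeff \<gamma> \<alpha> \<beta>)"
      by (auto simp: finite_degree_pairs)
  qed
  finally show ?thesis .
qed

lemma product_S:
  assumes "\<alpha> \<in> Comp" "\<beta> \<in> Comp" "\<gamma> \<in> Comp"
  shows "\<langle>S \<gamma>, S\<^sup>* \<alpha> \<star> S\<^sup>* \<beta>\<rangle> = of_nat (lr_coeff \<gamma> \<alpha> \<beta>)"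
  using product_apply[OF assms(1,2), of "{\<gamma>}" "\<lambda>_. 1"] assms(3) by (simp add: pairing_def)

lemma product_expansion:
  assumes "\<alpha> \<in> Comp" "\<beta> \<in> Comp"
  shows "has_expansion (S\<^sup>* \<alpha> \<star> S\<^sup>* \<beta>) Comp S\<^sup>* (\<lambda>\<gamma>. of_nat (lr_coeff \<gamma> \<alpha> \<beta>))"
proof (rule has_expansionI)
  let ?D = "Comps (sum_list \<alpha> + sum_list \<beta>)"
  show "finite ?D" "?D \<subseteq> Comp" by (rule finite_Comps, auto simp: Comps_def)
  show out: "of_nat (lr_coeff \<gamma> \<alpha> \<beta>) = (0 :: rat)" if "\<gamma> \<in> Comp - ?D" for \<gamma>
    by (rule ccontr) (use lr_coeff_sum[of \<gamma> \<alpha> \<beta>] that in \<open>auto simp: Comps_def\<close>)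
  show "S\<^sup>* \<alpha> \<star> S\<^sup>* \<beta> = (\<Sum>\<gamma>\<in>?D. of_nat (lr_coeff \<gamma> \<alpha> \<beta>) *\<^sub>Q S\<^sup>* \<gamma>)"
  proof
    fix f
    show "(S\<^sup>* \<alpha> \<star> S\<^sup>* \<beta>) f = (\<Sum>\<gamma>\<in>?D. of_nat (lr_coeff \<gamma> \<alpha> \<beta>) *\<^sub>Q S\<^sup>* \<gamma>) f"
    proof (cases "f \<in> QSym")
      case True
      then obtain A c where A: "finite A" "A \<subseteq> Comp" "f = (\<Sum>\<gamma>\<in>A. c \<gamma> *\<^sub>Q S \<gamma>)" by (rule QSym_expansion)
      have "(\<Sum>\<gamma>\<in>?D. of_nat (lr_coeff \<gamma> \<alpha> \<beta>) *\<^sub>Q S\<^sup>* \<gamma>) f = (\<Sum>\<gamma>\<in>?D. of_nat (lr_coeff \<gamma> \<alpha> \<beta>) * (\<Sum>\<delta>\<in>A. if \<delta> = \<gamma> then c \<delta> else 0))"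
      proof -
        have "(S\<^sup>* \<gamma>) f = (\<Sum>\<delta>\<in>A. if \<delta> = \<gamma> then c \<delta> else 0)" if "\<gamma> \<in> ?D" for \<gamma>
          unfolding A(3) using that A(2) by (intro S_dual_sum A(1)) (auto simp: Comps_def)
        then show ?thesis unfolding sum_fun_apply by (intro sum.cong) (simp_all add: scale_def)
      qed
      also have "\<dots> = (\<Sum>\<gamma>\<in>?D. \<Sum>\<delta>\<in>A. if \<delta> = \<gamma> then c \<delta> * of_nat (lr_coeff \<delta> \<alpha> \<beta>) else 0)"
        by (auto simp: sum_distrib_left intro!: sum.cong)
      also have "\<dots> = (\<Sum>\<delta>\<in>A. \<Sum>\<gamma>\<in>?D. if \<gamma> = \<delta> then c \<delta> * of_nat (lr_coeff \<delta> \<alpha> \<beta>) else 0)"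
        by (subst sum.swap) (auto intro!: sum.cong)
      also have "\<dots> = (\<Sum>\<delta>\<in>A. c \<delta> * of_nat (lr_coeff \<delta> \<alpha> \<beta>))"
        using out A(2) by (intro sum.cong) (auto simp: finite_Comps)
      finally show ?thesis using product_apply[OF assms A(1,2)] A(3) by simp
    next
      case False
      have "(S\<^sup>* \<gamma>) f = 0" if "\<gamma> \<in> ?D" for \<gamma>
        using S_dual(1)[of \<gamma>] that False unfolding NSym_def Comps_def by blast
      then show ?thesis using False by (simp add: nsym_mult_def sum_fun_apply scale_def)
    qed
  qed
qed

theorem theorem3p5:
  fixes C :: "nat list \<Rightarrow> nat list \<Rightarrow> nat list \<Rightarrow> rat"
  shows "let C_counts_tableaux =
           (\<forall>\<alpha>\<in>Comp. \<forall>\<beta>\<in>Comp. \<forall>\<gamma>\<in>Comp. C \<gamma> \<alpha> \<beta> = of_nat (card {T. sct \<gamma> \<beta> T \<and> rect T = U \<alpha>}))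
         in
           ((\<forall>\<alpha>\<in>Comp. \<forall>\<beta>\<in>Comp. has_expansion (S\<^sup>* \<alpha> \<star> S\<^sup>* \<beta>) Comp S\<^sup>* (\<lambda>\<gamma>. C \<gamma> \<alpha> \<beta>))
              \<longleftrightarrow> C_counts_tableaux) \<and>
           ((\<forall>\<gamma>\<in>Comp. has_expansion (\<Delta> (S \<gamma>)) (Comp \<times> Comp) (\<lambda>(\<alpha>, \<beta>). S \<alpha> \<otimes> S \<beta>) (\<lambda>(\<alpha>, \<beta>). C \<gamma> \<alpha> \<beta>))
              \<longleftrightarrow> C_counts_tableaux) \<and>
           ((\<forall>\<beta>\<in>Comp. \<forall>\<gamma>\<in>Comp. has_expansion (skew_S \<gamma> \<beta>) Comp S (\<lambda>\<alpha>. C \<gamma> \<alpha> \<beta>))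
              \<longleftrightarrow> C_counts_tableaux) \<and>
           ((\<forall>\<alpha>\<in>Comp. \<forall>\<beta>\<in>Comp. \<forall>\<gamma>\<in>Comp. C \<gamma> \<alpha> \<beta> = \<langle>skew_S \<gamma> \<beta>, S\<^sup>* \<alpha>\<rangle>)
              \<longleftrightarrow> C_counts_tableaux) \<and>
           ((\<forall>\<alpha>\<in>Comp. \<forall>\<beta>\<in>Comp. \<forall>\<gamma>\<in>Comp. C \<gamma> \<alpha> \<beta> = \<langle>S \<gamma>, S\<^sup>* \<alpha> \<star> S\<^sup>* \<beta>\<rangle>)
              \<longleftrightarrow> C_counts_tableaux)"

proof -
  define L :: "nat list \<Rightarrow> nat list \<Rightarrow> nat list \<Rightarrow> rat" where "L \<gamma> \<alpha> \<beta> = of_nat (lr_coeff \<gamma> \<alpha> \<beta>)" for \<gamma> \<alpha> \<beta>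
  have count: "(\<forall>\<alpha>\<in>Comp. \<forall>\<beta>\<in>Comp. \<forall>\<gamma>\<in>Comp. C \<gamma> \<alpha> \<beta> = of_nat (card {T. sct \<gamma> \<beta> T \<and> rect T = U \<alpha>}))
      \<longleftrightarrow> (\<forall>\<alpha>\<in>Comp. \<forall>\<beta>\<in>Comp. \<forall>\<gamma>\<in>Comp. C \<gamma> \<alpha> \<beta> = L \<gamma> \<alpha> \<beta>)"
    by (simp add: card_sct L_def)
  have product: "has_expansion (S\<^sup>* \<alpha> \<star> S\<^sup>* \<beta>) Comp S\<^sup>* (\<lambda>\<gamma>. C \<gamma> \<alpha> \<beta>) \<longleftrightarrow> (\<forall>\<gamma>\<in>Comp. C \<gamma> \<alpha> \<beta> = L \<gamma> \<alpha> \<beta>)"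
    if "\<alpha> \<in> Comp" "\<beta> \<in> Comp" for \<alpha> \<beta>
    unfolding L_def by (rule has_expansion_iff[OF S_dual_indep product_expansion[OF that]])
  have coproduct: "has_expansion (\<Delta> (S \<gamma>)) (Comp \<times> Comp) (\<lambda>(\<alpha>, \<beta>). S \<alpha> \<otimes> S \<beta>) (\<lambda>(\<alpha>, \<beta>). C \<gamma> \<alpha> \<beta>)
      \<longleftrightarrow> (\<forall>\<alpha>\<in>Comp. \<forall>\<beta>\<in>Comp. C \<gamma> \<alpha> \<beta> = L \<gamma> \<alpha> \<beta>)" if "\<gamma> \<in> Comp" for \<gamma>
    unfolding has_expansion_iff[OF tensor_indep coproduct_S_expansion[OF that]] L_def by auto
  have skew: "has_expansion (skew_S \<gamma> \<beta>) Comp S (\<lambda>\<alpha>. C \<gamma> \<alpha> \<beta>) \<longleftrightarrow> (\<forall>\<alpha>\<in>Comp. C \<gamma> \<alpha> \<beta> = L \<gamma> \<alpha> \<beta>)"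
    if "\<beta> \<in> Comp" "\<gamma> \<in> Comp" for \<beta> \<gamma>
    unfolding L_def by (rule has_expansion_iff[OF S_indep skew_S_expansion[OF that(2,1)]])
  have pair1: "\<langle>skew_S \<gamma> \<beta>, S\<^sup>* \<alpha>\<rangle> = L \<gamma> \<alpha> \<beta>" if "\<alpha> \<in> Comp" "\<beta> \<in> Comp" "\<gamma> \<in> Comp" for \<alpha> \<beta> \<gamma>
    unfolding L_def by (rule expansion_pairing[OF skew_S_expansion[OF that(3,2)] that(1)])
  have pair2: "\<langle>S \<gamma>, S\<^sup>* \<alpha> \<star> S\<^sup>* \<beta>\<rangle> = L \<gamma> \<alpha> \<beta>" if "\<alpha> \<in> Comp" "\<beta> \<in> Comp" "\<gamma> \<in> Comp" for \<alpha> \<beta> \<gamma>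
    unfolding L_def by (rule product_S[OF that])
  \<comment> \<open>After rewriting, the conditions differ at most in the order of the quantifiers.\<close>
  show ?thesis
    unfolding Let_def count
    by (intro conjI; simp only: product coproduct skew pair1 pair2 cong: ball_cong; blast?)
qed

end
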